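(* Suppose $\mathcal{R}$ expands an ordered field. Let $(X,\tau)$ be a Hausdorff definable topological space in $\mathcal{R}$ with $\dim X\leq 1$. Then exactly one of the following holds: (1) $(X,\tau)$ contains a subspace definably homeomorphic to an interval equipped with either the discrete topology or the right half-open interval topology; (2) $(X,\tau)$ is definably homeomorphic to a euclidean space, i.e. to some definable set $Y\subseteq R^m$ equipped with the euclidean topology.
   Context: $\mathcal{R}=(R,<,\dots)$ is an o-minimal structure; "definable" means definable in $\mathcal{R}$ with parameters; $\dim$ is o-minimal dimension. A definable topological space is a pair $(X,\tau)$ with $X\subseteq R^n$ definable and $\tau$ a topology on $X$ with a basis which is a definable family of sets; a definable homeomorphism is a definable map which is a homeomorphism. The euclidean topology on $R^m$ is the product of the order topology, and on subsets the subspace topology. An interval is an open interval with endpoints in $R\cup\{\pm\infty\}$; the right half-open interval topology on it is generated by the sets $[x,y)$, $x<y$. *)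

theory Defs
  imports "HOL-Analysis.Analysis"
begin

section \<open>First-order structures and definable sets\<close>

text \<open>
  The universe of a structure is the whole type \<open>'a\<close>. Symbols carry no fixed arity: a symbol
  applied to a list of \<open>k\<close> arguments plays the role of a \<open>k\<close>-ary symbol. A structure for a
  signature with arities is obtained by giving arbitrary constant values off the intended arity,
  which does not change the definable sets.
\<close>

record ('a, 'f, 'r) fo_structure =
  fun_interp :: "'f \<Rightarrow> 'a list \<Rightarrow> 'a"
  rel_interp :: "'r \<Rightarrow> 'a list \<Rightarrow> bool"

datatype 'f fo_term = Var nat | App 'f "'f fo_term list"

datatype ('f, 'r) fo_formula =
    Eq "'f fo_term" "'f fo_term"
  | Rel 'r "'f fo_term list"
  | Neg "('f, 'r) fo_formula"
  | Conj "('f, 'r) fo_formula" "('f, 'r) fo_formula"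
  | Exi nat "('f, 'r) fo_formula"

primrec term_val :: "('a, 'f, 'r) fo_structure \<Rightarrow> (nat \<Rightarrow> 'a) \<Rightarrow> 'f fo_term \<Rightarrow> 'a" where
  "term_val M e (Var i) = e i"
| "term_val M e (App s ts) = fun_interp M s (map (term_val M e) ts)"

primrec sat :: "('a, 'f, 'r) fo_structure \<Rightarrow> (nat \<Rightarrow> 'a) \<Rightarrow> ('f, 'r) fo_formula \<Rightarrow> bool" where
  "sat M e (Eq s t) \<longleftrightarrow> term_val M e s = term_val M e t"
| "sat M e (Rel r ts) \<longleftrightarrow> rel_interp M r (map (term_val M e) ts)"
| "sat M e (Neg p) \<longleftrightarrow> \<not> sat M e p"
| "sat M e (Conj p q) \<longleftrightarrow> sat M e p \<and> sat M e q"
| "sat M e (Exi i p) \<longleftrightarrow> (\<exists>x. sat M (e(i := x)) p)"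

text \<open>
  Points of \<open>R\<^sup>n\<close> are lists of length \<open>n\<close>. The variables with index below \<open>n\<close> stand for the
  coordinates; the values \<open>p i\<close> of the remaining ones are the parameters.
\<close>

definition definable :: "('a, 'f, 'r) fo_structure \<Rightarrow> nat \<Rightarrow> 'a list set \<Rightarrow> bool" where
  "definable M n A \<longleftrightarrow>
     (\<exists>\<phi> p. A = {xs. length xs = n \<and> sat M (\<lambda>i. if i < n then xs ! i else p i) \<phi>})"

definition definable_map ::
  "('a, 'f, 'r) fo_structure \<Rightarrow> nat \<Rightarrow> 'a list set \<Rightarrow> nat \<Rightarrow> 'a list set \<Rightarrow> ('a list \<Rightarrow> 'a list) \<Rightarrow> bool"
  where
  "definable_map M n X m Y f \<longleftrightarrow>
     definable M n X \<and> definable M m Y \<and> f ` X \<subseteq> Y \<and> definable M (n + m) ((\<lambda>x. x @ f x) ` X)"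

definition definable_family ::
  "('a, 'f, 'r) fo_structure \<Rightarrow> nat \<Rightarrow> 'a list set set \<Rightarrow> bool" where
  "definable_family M n \<B> \<longleftrightarrow>
     (\<exists>k P W. definable M k P \<and> definable M (k + n) W \<and>
        \<B> = (\<lambda>b. {x. length x = n \<and> b @ x \<in> W}) ` P)"


section \<open>O-minimality\<close>

text \<open>Intervals are open, with endpoints in \<open>R \<union> {\<plusminus>\<infinity>}\<close>, and nonempty.\<close>

definition intervals :: "'a::linorder set set" where
  "intervals = {{a<..<b} |a b. a < b} \<union> range greaterThan \<union> range lessThan \<union> {UNIV}"

definition o_minimal :: "('a::unbounded_dense_linorder, 'f, 'r) fo_structure \<Rightarrow> bool" where
  "o_minimal M \<longleftrightarrow>
     (\<exists>r. \<forall>x y. rel_interp M r [x, y] \<longleftrightarrow> x < y) \<and>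
     (\<forall>A. definable M 1 ((\<lambda>x. [x]) ` A) \<longrightarrow>
        (\<exists>\<C>. finite \<C> \<and> \<C> \<subseteq> intervals \<union> {{a} |a. True} \<and> A = \<Union> \<C>))"

definition expands_ordered_field :: "('a::linordered_field, 'f, 'r) fo_structure \<Rightarrow> bool" where
  "expands_ordered_field M \<longleftrightarrow>
     (\<exists>r. \<forall>x y. rel_interp M r [x, y] \<longleftrightarrow> x < y) \<and>
     (\<exists>s. \<forall>x y. fun_interp M s [x, y] = x + y) \<and>
     (\<exists>s. \<forall>x y. fun_interp M s [x, y] = x * y)"


section \<open>The euclidean topology and o-minimal dimension\<close>

text \<open>
  On a type of class \<^class>\<open>linorder_topology\<close>, \<^const>\<open>euclidean\<close> is the order topology.
  The product topology is transported from extensional functions on \<open>{..<m}\<close> to lists of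
  length \<open>m\<close>.
\<close>

definition euclid :: "nat \<Rightarrow> 'a::linorder_topology list topology" where
  "euclid m = pullback_topology {xs. length xs = m} (\<lambda>xs. \<lambda>i\<in>{..<m}. xs ! i)
                (product_topology (\<lambda>_. euclidean) {..<m})"

definition definable_continuous ::
  "('a::linorder_topology, 'f, 'r) fo_structure \<Rightarrow> nat \<Rightarrow> 'a list set \<Rightarrow> ('a list \<Rightarrow> 'a) \<Rightarrow> bool" where
  "definable_continuous M n C f \<longleftrightarrow>
     definable_map M n C 1 {y. length y = 1} (\<lambda>x. [f x]) \<and>
     continuous_map (subtopology (euclid n) C) euclidean f"

text \<open>
  \<open>cell M n d C\<close>: the set \<open>C \<subseteq> R\<^sup>n\<close> is a cell of dimension \<open>d\<close>, i.e. an \<open>(i\<^sub>1,\<dots>,i\<^sub>n)\<close>-cell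
  with \<open>d = i\<^sub>1 + \<dots> + i\<^sub>n\<close>. The recursion starts with the one-point space \<open>R\<^sup>0\<close>, so that the
  cells in \<open>R\<^sup>1\<close> are the points and the intervals. In a band, the bound \<^const>\<open>None\<close> stands for
  \<open>-\<infinity>\<close> (below) or \<open>+\<infinity>\<close> (above).
\<close>

inductive cell ::
  "('a::linorder_topology, 'f, 'r) fo_structure \<Rightarrow> nat \<Rightarrow> nat \<Rightarrow> 'a list set \<Rightarrow> bool"
  for M where
  origin: "cell M 0 0 {[]}"
| graph: "cell M n d C \<Longrightarrow> definable_continuous M n C f \<Longrightarrow>
    cell M (Suc n) d {x @ [f x] |x. x \<in> C}"
| band: "cell M n d C \<Longrightarrow>
    \<forall>f\<in>set_option lo. definable_continuous M n C f \<Longrightarrow>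
    \<forall>g\<in>set_option hi. definable_continuous M n C g \<Longrightarrow>
    \<forall>f\<in>set_option lo. \<forall>g\<in>set_option hi. \<forall>x\<in>C. f x < g x \<Longrightarrow>
    cell M (Suc n) (Suc d)
      {x @ [y] |x y. x \<in> C \<and> (\<forall>f\<in>set_option lo. f x < y) \<and> (\<forall>g\<in>set_option hi. y < g x)}"

text \<open>The values are extended reals in order that the empty set has dimension \<open>-\<infinity>\<close>.\<close>

definition o_dim ::
  "('a::linorder_topology, 'f, 'r) fo_structure \<Rightarrow> nat \<Rightarrow> 'a list set \<Rightarrow> ereal" where
  "o_dim M n X = Sup {ereal (real d) |d. \<exists>C. cell M n d C \<and> C \<subseteq> X}"


section \<open>Definable topological spaces\<close>

definition definable_topological_space ::
  "('a, 'f, 'r) fo_structure \<Rightarrow> nat \<Rightarrow> 'a list topology \<Rightarrow> bool" where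
  "definable_topological_space M n T \<longleftrightarrow>
     definable M n (topspace T) \<and>
     (\<exists>\<B>. definable_family M n \<B> \<and> openin T = arbitrary union_of (\<lambda>U. U \<in> \<B>))"

definition definably_homeomorphic ::
  "('a, 'f, 'r) fo_structure \<Rightarrow> nat \<Rightarrow> 'a list topology \<Rightarrow> nat \<Rightarrow> 'a list topology \<Rightarrow> bool" where
  "definably_homeomorphic M n S m T \<longleftrightarrow>
     (\<exists>f. definable_map M n (topspace S) m (topspace T) f \<and> homeomorphic_map S T f)"

text \<open>A subset of \<open>R\<close> is regarded as a subset of \<open>R\<^sup>1\<close> via \<open>x \<mapsto> [x]\<close>.\<close>

definition discrete_interval :: "'a set \<Rightarrow> 'a list topology" where
  "discrete_interval I = discrete_topology ((\<lambda>x. [x]) ` I)"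

definition half_open_interval :: "'a::linorder set \<Rightarrow> 'a list topology" where
  "half_open_interval I =
     topology_generated_by {(\<lambda>z. [z]) ` {x..<y} |x y. x \<in> I \<and> y \<in> I \<and> x < y}"

definition contains_discrete_or_half_open_interval ::
  "('a::linorder, 'f, 'r) fo_structure \<Rightarrow> nat \<Rightarrow> 'a list topology \<Rightarrow> bool" where
  "contains_discrete_or_half_open_interval M n T \<longleftrightarrow>
     (\<exists>S I. S \<subseteq> topspace T \<and> I \<in> intervals \<and>
        (definably_homeomorphic M n (subtopology T S) 1 (discrete_interval I) \<or>
         definably_homeomorphic M n (subtopology T S) 1 (half_open_interval I)))"

definition definably_homeomorphic_to_euclidean ::
  "('a::linorder_topology, 'f, 'r) fo_structure \<Rightarrow> nat \<Rightarrow> 'a list topology \<Rightarrow> bool" where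
  "definably_homeomorphic_to_euclidean M n T \<longleftrightarrow>
     (\<exists>m Y. definable M m Y \<and> definably_homeomorphic M n T m (subtopology (euclid m) Y))"

end

theory Submission
  imports Defs
begin

text \<open>
  In an o-minimal field every definable positive function is bounded below by a positive constant on a
  subinterval; together with one-sided germs this gives monotonicity and continuity on subintervals,
  continuity on subboxes and uniform finiteness, and hence a definable injection of a set of dimension
  at most one into the unit interval. On the line, a definable Hausdorff topology is determined by the
  partial map that sends a one-sided germ to the point all of whose neighbourhoods contain it. If this
  map fixes both germs of all but finitely many points, the space is a finite graph with some open ends
  and embeds explicitly into euclidean space. Otherwise continuity of the map yields a subinterval on
  which the topology is discrete or half-open. Both cases exclude each other because a definable map from
  an interval to euclidean space is continuous on a subinterval.
\<close>

section \<open>A calculus of definable predicates\<close>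

text \<open>Cell decomposition is avoided. The dimension enters once, as the absence of
  two-dimensional cells inside the space. A definable set that contains no surface patch has finite
  fibres over its projection, up to finitely many vertical lines; uniform finiteness lets finitely
  many definable functions select the fibre points, which are packed into disjoint parts of the unit
  interval. An arbitrary open set need not be definable, but the basis is a definable family; a
  condition that is monotone in the neighbourhood can therefore be quantified over the parameters of
  the basis, and this makes the limit relation of one-sided germs definable. By the Hausdorff
  property a germ has at most one limit. A supremum replaces compactness: if all neighbourhoods of a
  point have infinite traces on a bounded definable set, some germ in that set converges to the
  point.\<close>

inductive trm :: "('a, 'f, 'r) fo_structure \<Rightarrow> ((nat \<Rightarrow> 'a) \<Rightarrow> 'a) \<Rightarrow> bool" for M where
  trm_var: "trm M (\<lambda>e. e i)"
| trm_const: "trm M (\<lambda>e. c)"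
| trm_app: "(\<And>t. t \<in> set ts \<Longrightarrow> trm M t) \<Longrightarrow> trm M (\<lambda>e. fun_interp M s (map (\<lambda>t. t e) ts))"

text \<open>
  Variables are de Bruijn indices: a quantifier binds index \<open>0\<close> and shifts the others by one.
  In this form the class is closed under substitution without any renaming of bound variables.
\<close>

inductive dfn :: "('a, 'f, 'r) fo_structure \<Rightarrow> ((nat \<Rightarrow> 'a) \<Rightarrow> bool) \<Rightarrow> bool" for M where
  dfn_Eq: "trm M t \<Longrightarrow> trm M u \<Longrightarrow> dfn M (\<lambda>e. t e = u e)"
| dfn_Rel: "(\<And>t. t \<in> set ts \<Longrightarrow> trm M t) \<Longrightarrow> dfn M (\<lambda>e. rel_interp M r (map (\<lambda>t. t e) ts))"
| dfn_not: "dfn M P \<Longrightarrow> dfn M (\<lambda>e. \<not> P e)"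
| dfn_conj: "dfn M P \<Longrightarrow> dfn M Q \<Longrightarrow> dfn M (\<lambda>e. P e \<and> Q e)"
| dfn_Exi: "dfn M P \<Longrightarrow> dfn M (\<lambda>e. \<exists>x. P (case_nat x e))"

lemma trm_subst:
  assumes "trm M t" "\<And>i. trm M (s i)"
  shows "trm M (\<lambda>e. t (\<lambda>i. s i e))"
  using assms(1)
proof induction
  case (trm_app ts f)
  have "trm M (\<lambda>e. fun_interp M f (map (\<lambda>t. t e) (map (\<lambda>t e. t (\<lambda>i. s i e)) ts)))"
    using trm_app by (intro trm.trm_app) auto
  then show ?case by (simp add: comp_def)
qed (auto intro: trm.intros assms)

lemma dfn_subst:
  assumes "dfn M P" "\<And>i. trm M (s i)"
  shows "dfn M (\<lambda>e. P (\<lambda>i. s i e))"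
  using assms
proof (induction arbitrary: s)
  case (dfn_Eq t u)
  then show ?case using trm_subst[of M t s] trm_subst[of M u s] by (auto intro: dfn.dfn_Eq)
next
  case (dfn_Rel ts r)
  have "dfn M (\<lambda>e. rel_interp M r (map (\<lambda>t. t e) (map (\<lambda>t e. t (\<lambda>i. s i e)) ts)))"
    using dfn_Rel trm_subst[of M _ s] by (intro dfn.dfn_Rel) auto
  then show ?case by (simp add: comp_def)
next
  case (dfn_not P)
  then show ?case by (intro dfn.dfn_not) auto
next
  case (dfn_conj P Q)
  then show ?case by (intro dfn.dfn_conj) auto
next
  case (dfn_Exi P)
  define s' where "s' j = (case j of 0 \<Rightarrow> (\<lambda>e. e 0) | Suc i \<Rightarrow> (\<lambda>e. s i (\<lambda>k. e (Suc k))))"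
    for j
  have tr: "trm M (s' j)" for j
    unfolding s'_def using trm_subst[OF dfn_Exi.prems, of "\<lambda>k e. e (Suc k)"]
    by (auto split: nat.split intro: trm.intros)
  have "dfn M (\<lambda>e. \<exists>x. P (\<lambda>j. s' j (case_nat x e)))"
    using dfn.dfn_Exi[OF dfn_Exi.IH[OF tr]] .
  moreover have "(\<lambda>j. s' j (case_nat x e)) = case_nat x (\<lambda>i. s i e)" for x e
    by (auto simp: s'_def fun_eq_iff split: nat.split)
  ultimately show ?case by simp
qed

lemma dfn_ren: "dfn M P \<Longrightarrow> dfn M (\<lambda>e. P (\<lambda>i. e (r i)))"
  by (rule dfn_subst) (auto intro: trm.intros)

text \<open>The bound value is a separate argument of \<open>P\<close>, so that \<open>intro\<close>
  finds the predicate by higher-order unification; the premise shows the environment already shifted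
  past the new index 0.\<close>

lemma dfn_ex:
  assumes "dfn M (\<lambda>e. P (e 0) (\<lambda>i. e (Suc i)))"
  shows "dfn M (\<lambda>e. \<exists>x. P x e)"
  using dfn.dfn_Exi[OF assms] by simp

lemma dfn_all:
  assumes "dfn M (\<lambda>e. P (e 0) (\<lambda>i. e (Suc i)))"
  shows "dfn M (\<lambda>e. \<forall>x. P x e)"
  using dfn_not[OF dfn_ex[of M "\<lambda>x e. \<not> P x e", OF dfn_not[OF assms]]] by simp

lemma dfn_disj: "dfn M P \<Longrightarrow> dfn M Q \<Longrightarrow> dfn M (\<lambda>e. P e \<or> Q e)"
  using dfn_not[OF dfn_conj[OF dfn_not[of M P] dfn_not[of M Q]]] by simp

lemma dfn_imp: "dfn M P \<Longrightarrow> dfn M Q \<Longrightarrow> dfn M (\<lambda>e. P e \<longrightarrow> Q e)"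
  using dfn_disj[OF dfn_not[of M P], of Q] by simp

lemma dfn_iff: "dfn M P \<Longrightarrow> dfn M Q \<Longrightarrow> dfn M (\<lambda>e. P e \<longleftrightarrow> Q e)"
  using dfn_conj[OF dfn_imp[of M P Q] dfn_imp[of M Q P]] by (simp add: iff_conv_conj_imp)

lemma dfn_const: "dfn M (\<lambda>e. c)"
proof -
  have "dfn M (\<lambda>e. e 0 = e 0)" by (intro dfn.intros trm.intros)
  then have "dfn M (\<lambda>e. True)" by simp
  with dfn_not[OF this] show ?thesis by (cases c) auto
qed

lemma dfn_if: "dfn M P \<Longrightarrow> dfn M Q \<Longrightarrow> dfn M R \<Longrightarrow> dfn M (\<lambda>e. if P e then Q e else R e)"
  unfolding if_bool_eq_conj by (intro dfn_conj dfn_imp dfn_not)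

lemma dfn_finite_all:
  assumes "finite A" "\<And>a. a \<in> A \<Longrightarrow> dfn M (P a)"
  shows "dfn M (\<lambda>e. \<forall>a\<in>A. P a e)"
  using assms by induction (auto intro: dfn_const dfn_conj)

lemma dfn_finite_ex:
  assumes "finite A" "\<And>a. a \<in> A \<Longrightarrow> dfn M (P a)"
  shows "dfn M (\<lambda>e. \<exists>a\<in>A. P a e)"
  using assms by induction (auto intro: dfn_const dfn_disj)

subsection \<open>Formulas\<close>

primrec ren_term :: "(nat \<Rightarrow> nat) \<Rightarrow> 'f fo_term \<Rightarrow> 'f fo_term" where
  "ren_term r (Var i) = Var (r i)"
| "ren_term r (App s ts) = App s (map (ren_term r) ts)"

primrec ren :: "(nat \<Rightarrow> nat) \<Rightarrow> ('f, 'r) fo_formula \<Rightarrow> ('f, 'r) fo_formula" where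
  "ren r (Eq s t) = Eq (ren_term r s) (ren_term r t)"
| "ren r (Rel q ts) = Rel q (map (ren_term r) ts)"
| "ren r (Neg p) = Neg (ren r p)"
| "ren r (Conj p q) = Conj (ren r p) (ren r q)"
| "ren r (Exi i p) = Exi (r i) (ren r p)"

lemma term_val_ren: "term_val M e (ren_term r t) = term_val M (\<lambda>i. e (r i)) t"
  by (induction t) (auto simp: comp_def cong: map_cong)

lemma sat_ren:
  assumes "inj r"
  shows "sat M e (ren r p) = sat M (\<lambda>i. e (r i)) p"
proof (induction p arbitrary: e)
  case (Exi i p)
  have "(\<lambda>j. (e(r i := x)) (r j)) = (\<lambda>j. e (r j))(i := x)" for x
    using assms by (auto simp: fun_eq_iff inj_eq)
  then show ?case using Exi by simp
qed (auto simp: term_val_ren comp_def)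

text \<open>Even variables are the free ones, odd variables stand for parameters.\<close>

definition merge_env :: "(nat \<Rightarrow> 'a) \<Rightarrow> (nat \<Rightarrow> 'a) \<Rightarrow> nat \<Rightarrow> 'a" where
  "merge_env e p i = (if even i then e (i div 2) else p (i div 2))"

text \<open>Joining two formulas requires disjoint parameters: the odd variables of the left formula
  move to residue 1 modulo 4, those of the right one to residue 3, which matches
  \<open>merge_env p q\<close> in the parameter slots. The shared free variables stay.\<close>

definition left_ren :: "nat \<Rightarrow> nat" where
  "left_ren i = (if even i then i else 4 * (i div 2) + 1)"

definition right_ren :: "nat \<Rightarrow> nat" where
  "right_ren i = (if even i then i else 4 * (i div 2) + 3)"

lemma inj_left_ren: "inj left_ren" and inj_right_ren: "inj right_ren"
  by (auto simp: inj_def left_ren_def right_ren_def elim!: evenE oddE split: if_splits) presburger+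

lemma merge_left_ren: "(\<lambda>i. merge_env e (merge_env p q) (left_ren i)) = merge_env e p"
  and merge_right_ren: "(\<lambda>i. merge_env e (merge_env p q) (right_ren i)) = merge_env e q"
proof -
  have "(4 * b + 3) div 2 = Suc (2 * b)" "(4 * b + 1) div 2 = 2 * b" for b :: nat
    by presburger+
  then show "(\<lambda>i. merge_env e (merge_env p q) (left_ren i)) = merge_env e p"
    "(\<lambda>i. merge_env e (merge_env p q) (right_ren i)) = merge_env e q"
    by (auto simp: fun_eq_iff merge_env_def left_ren_def right_ren_def elim!: oddE)
qed

lemma trm_list_formula:
  assumes "\<And>t. t \<in> set ts \<Longrightarrow> \<exists>u p. \<forall>e. t e = term_val M (merge_env e p) u"
  shows "\<exists>us p. \<forall>e. map (\<lambda>t. t e) ts = map (term_val M (merge_env e p)) us"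
  using assms
proof (induction ts)
  case Nil
  show ?case by (rule exI[of _ "[]"]) simp
next
  case (Cons t ts)
  obtain u p where u: "\<And>e. t e = term_val M (merge_env e p) u" using Cons.prems[of t] by auto
  obtain us q where us: "\<And>e. map (\<lambda>t. t e) ts = map (term_val M (merge_env e q)) us"
    using Cons.IH Cons.prems by auto
  show ?case
    by (intro exI[of _ "ren_term left_ren u # map (ren_term right_ren) us"]
        exI[of _ "merge_env p q"])
      (simp add: u us term_val_ren merge_left_ren merge_right_ren comp_def)
qed

lemma trm_formula: "trm M t \<Longrightarrow> \<exists>u p. \<forall>e. t e = term_val M (merge_env e p) u"
proof (induction rule: trm.induct)
  case (trm_var i)
  show ?case by (intro exI[of _ "Var (2 * i)"]) (simp add: merge_env_def)
next
  case (trm_const c)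
  show ?case by (intro exI[of _ "Var 1"] exI[of _ "\<lambda>_. c"]) (simp add: merge_env_def)
next
  case (trm_app ts s)
  obtain us p where us: "\<And>e. map (\<lambda>t. t e) ts = map (term_val M (merge_env e p)) us"
    using trm_list_formula[OF trm_app.IH] by blast
  show ?case by (intro exI[of _ "App s us"] exI[of _ p]) (simp add: us)
qed

text \<open>With \<open>dfn_sat\<close> this identifies the inductive class with the predicates
  given by first-order formulas with parameters. Each subformula comes with its own parameter
  sequence, hence the renamings at conjunctions.\<close>

lemma dfn_formula: "dfn M P \<Longrightarrow> \<exists>\<phi> p. \<forall>e. P e = sat M (merge_env e p) \<phi>"
proof (induction rule: dfn.induct)
  case (dfn_Eq t u)
  have "\<exists>us p. \<forall>e. map (\<lambda>t. t e) [t, u] = map (term_val M (merge_env e p)) us"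
    by (intro trm_list_formula) (auto intro: trm_formula dfn_Eq)
  then obtain us p where us: "\<And>e. [t e, u e] = map (term_val M (merge_env e p)) us"
    by auto
  moreover from arg_cong[OF us, of length] obtain t' u' where "us = [t', u']"
    by (auto simp: length_Suc_conv Suc_length_conv)
  ultimately have "\<And>e. t e = term_val M (merge_env e p) t'"
    "\<And>e. u e = term_val M (merge_env e p) u'"
    by auto
  then show ?case by (intro exI[of _ "Eq t' u'"] exI[of _ p]) simp
next
  case (dfn_Rel ts r)
  obtain us p where us: "\<And>e. map (\<lambda>t. t e) ts = map (term_val M (merge_env e p)) us"
    using trm_list_formula[OF trm_formula[OF dfn_Rel]] by blast
  show ?case by (intro exI[of _ "Rel r us"] exI[of _ p]) (simp add: us)
next
  case (dfn_not P)
  then show ?case by (metis sat.simps(3))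
next
  case (dfn_conj P Q)
  then obtain \<phi> p \<psi> q where *: "\<And>e. P e = sat M (merge_env e p) \<phi>"
    "\<And>e. Q e = sat M (merge_env e q) \<psi>" by blast
  show ?case
    by (intro exI[of _ "Conj (ren left_ren \<phi>) (ren right_ren \<psi>)"] exI[of _ "merge_env p q"])
      (simp add: * sat_ren inj_left_ren inj_right_ren merge_left_ren merge_right_ren)
next
  case (dfn_Exi P)
  then obtain \<phi> p where *: "\<And>e. P e = sat M (merge_env e p) \<phi>" by blast
  \<comment> \<open>The quantified variable, free index 0, moves to variable 1; the other free
    variables move down by two and the parameters up by two, which vacates that slot. The parameter
    sequence receives a dummy entry there.\<close>
  define r :: "nat \<Rightarrow> nat" where "r i = (if i = 0 then 1 else if even i then i - 2 else i + 2)" for i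
  have "inj r"
    by (rule inj_on_inverseI[where g = "\<lambda>j. if j = 1 then 0 else if even j then j + 2 else j - 2"])
      (auto simp: r_def elim!: evenE oddE; presburger)
  have "(\<lambda>i. ((merge_env e (case_nat c p))(1 := x)) (r i)) = merge_env (case_nat x e) p" for e x c
  proof
    fix i show "((merge_env e (case_nat c p))(1 := x)) (r i) = merge_env (case_nat x e) p i"
    proof (cases "even i")
      case True
      then obtain k where "i = 2 * k" by auto
      then show ?thesis by (cases k) (auto simp: r_def merge_env_def)
    qed (auto simp: r_def merge_env_def elim!: oddE)
  qed
  then show ?case
    using \<open>inj r\<close>
    by (intro exI[of _ "Exi 1 (ren r \<phi>)"] exI[of _ "case_nat undefined p"]) (simp add: * sat_ren)
qed

lemma trm_term_val: "(\<And>i. trm M (s i)) \<Longrightarrow> trm M (\<lambda>e. term_val M (\<lambda>i. s i e) t)"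
proof (induction t)
  case (App f ts)
  have "trm M (\<lambda>e. fun_interp M f (map (\<lambda>t. t e) (map (\<lambda>t e. term_val M (\<lambda>i. s i e) t) ts)))"
    using App by (intro trm.trm_app) auto
  then show ?case by (simp add: comp_def)
qed auto

lemma dfn_sat: "dfn M (\<lambda>e. sat M e \<phi>)"
proof (induction \<phi>)
  case (Eq s t)
  show ?case using trm_term_val[OF trm_var, of M "\<lambda>i. i"] by (auto intro: dfn.dfn_Eq)
next
  case (Rel r ts)
  have "dfn M (\<lambda>e. rel_interp M r (map (\<lambda>t. t e) (map (\<lambda>t e. term_val M e t) ts)))"
    using trm_term_val[OF trm_var, of M "\<lambda>i. i"] by (intro dfn.dfn_Rel) auto
  then show ?case by (simp add: comp_def)
next
  case (Exi i \<phi>)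
  have "dfn M (\<lambda>e. sat M (\<lambda>j. e (if j = i then 0 else Suc j)) \<phi>)"
    using dfn_ren[OF Exi] .
  moreover have "(\<lambda>j. e (if j = i then 0 else Suc j)) = (\<lambda>j. e (Suc j))(i := e 0)" for e :: "nat \<Rightarrow> 'a"
    by auto
  ultimately have "dfn M (\<lambda>e. sat M ((\<lambda>j. e (Suc j))(i := e 0)) \<phi>)" by (simp only:)
  then show ?case using dfn_ex[of M "\<lambda>x e. sat M (e(i := x)) \<phi>"] by simp
qed (auto intro: dfn.intros)

lemma definable_dfn:
  assumes "definable M n A"
  shows "dfn M (\<lambda>e. map e [0..<n] \<in> A)"
proof -
  obtain \<phi> p where A: "A = {xs. length xs = n \<and> sat M (\<lambda>i. if i < n then xs ! i else p i) \<phi>}"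
    using assms by (auto simp: definable_def)
  have "dfn M (\<lambda>e. sat M (\<lambda>i. (if i < n then (\<lambda>e. e i) else (\<lambda>e. p i)) e) \<phi>)"
    by (rule dfn_subst[OF dfn_sat]) (auto intro: trm.intros)
  moreover have "(\<lambda>i. if i < n then map e [0..<n] ! i else p i)
    = (\<lambda>i. (if i < n then (\<lambda>e. e i) else (\<lambda>e. p i)) e)" for e
    by auto
  ultimately show ?thesis by (simp add: A)
qed

text \<open>\<open>definable\<close> treats the first n variables as coordinates, whereas
  \<open>dfn\<close> leaves all indices free. The indices from n on are frozen at the constant c and
  become parameters of the renamed formula.\<close>

lemma dfn_definable:
  assumes "dfn M P" and "\<And>xs. length xs = n \<Longrightarrow> xs \<in> A \<longleftrightarrow> P (\<lambda>i. if i < n then xs ! i else c)"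
    and "\<And>xs. xs \<in> A \<Longrightarrow> length xs = n"
  shows "definable M n A"
proof -
  obtain \<phi> p where \<phi>: "\<And>e. P e = sat M (merge_env e p) \<phi>" using dfn_formula[OF assms(1)] by blast
  define r where "r i = (if even i \<and> i div 2 < n then i div 2 else n + i)" for i
  define q where "q i = (if even (i - n) then c else p ((i - n) div 2))" for i
  have "inj r" by (auto simp: inj_def r_def elim!: evenE split: if_splits)
  have "P (\<lambda>i. if i < n then xs ! i else c) = sat M (\<lambda>i. if i < n then xs ! i else q i) (ren r \<phi>)"
    if "length xs = n" for xs
    using \<open>inj r\<close> unfolding \<phi> by (auto simp: sat_ren merge_env_def r_def q_def fun_eq_iff
        intro!: arg_cong[of _ _ "\<lambda>e. sat M e \<phi>"])
  then show ?thesis unfolding definable_def using assms(2,3) by blast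
qed

text \<open>The passage between formulas and the calculus: apart from the length of members, later
  arguments use definability only in this form.\<close>

lemma definable_iff_dfn:
  "definable M n A \<longleftrightarrow> (\<forall>xs\<in>A. length xs = n) \<and> dfn M (\<lambda>e. map e [0..<n] \<in> A)"
proof
  assume "definable M n A"
  then show "(\<forall>xs\<in>A. length xs = n) \<and> dfn M (\<lambda>e. map e [0..<n] \<in> A)"
    by (auto simp: definable_dfn) (auto simp: definable_def)
next
  assume *: "(\<forall>xs\<in>A. length xs = n) \<and> dfn M (\<lambda>e. map e [0..<n] \<in> A)"
  show "definable M n A"
  proof (rule dfn_definable[of M "\<lambda>e. map e [0..<n] \<in> A"])
    fix xs :: "'a list" assume "length xs = n"
    then have "map (\<lambda>i. if i < n then xs ! i else undefined) [0..<n] = xs"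
      by (auto intro!: nth_equalityI)
    then show "xs \<in> A \<longleftrightarrow> map (\<lambda>i. if i < n then xs ! i else undefined) [0..<n] \<in> A" by simp
  qed (use * in auto)
qed

lemma definable_length: "definable M n A \<Longrightarrow> xs \<in> A \<Longrightarrow> length xs = n"
  by (auto simp: definable_def)

subsection \<open>Definable terms\<close>

text \<open>A value counts as a term as soon as its graph is definable, with the value at index 0.
  This admits division, case distinctions and definably chosen points, which need not be terms of
  the language.\<close>

definition dtm :: "('a, 'f, 'r) fo_structure \<Rightarrow> ((nat \<Rightarrow> 'a) \<Rightarrow> 'a) \<Rightarrow> bool" where
  "dtm M t \<longleftrightarrow> dfn M (\<lambda>e. t (\<lambda>i. e (Suc i)) = e 0)"

lemma dfn_dtm_subst:
  assumes "dtm M t" "dfn M (\<lambda>e. P (e 0) (\<lambda>i. e (Suc i)))"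
  shows "dfn M (\<lambda>e. P (t e) e)"
proof -
  have "dfn M (\<lambda>e. \<exists>x. t e = x \<and> P x e)"
    by (rule dfn_ex) (use assms in \<open>auto intro: dfn_conj simp: dtm_def\<close>)
  then show ?thesis by simp
qed

lemma dtm_shift: "dtm M t \<Longrightarrow> dtm M (\<lambda>e. t (\<lambda>i. e (r i)))"
  unfolding dtm_def
  by (drule dfn_ren[of M _ "\<lambda>i. case i of 0 \<Rightarrow> 0 | Suc j \<Rightarrow> Suc (r j)"]) simp

lemma dtm_trm: "trm M t \<Longrightarrow> dtm M t"
  unfolding dtm_def by (auto intro!: dfn_Eq trm_subst[of M t] intro: trm.intros)

lemma dtm_var: "dtm M (\<lambda>e. e i)" and dtm_const: "dtm M (\<lambda>e. c)"
  by (auto intro: dtm_trm trm.intros)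

lemma dfn_eq:
  assumes "dtm M t" "dtm M u"
  shows "dfn M (\<lambda>e. t e = u e)"
  by (rule dfn_dtm_subst[OF assms(2), of "\<lambda>x e. t e = x"])
    (use assms(1) in \<open>simp add: dtm_def\<close>)

lemma dtm_if:
  assumes "dfn M P" "dtm M t" "dtm M u"
  shows "dtm M (\<lambda>e. if P e then t e else u e)"
proof -
  have "dfn M (\<lambda>e. if P (\<lambda>i. e (Suc i)) then t (\<lambda>i. e (Suc i)) = e 0 else u (\<lambda>i. e (Suc i)) = e 0)"
    using dfn_if[OF dfn_ren[OF assms(1), of Suc]] assms by (simp add: dtm_def)
  then show ?thesis unfolding dtm_def
    by (rule back_subst[of "dfn M"]) auto
qed

lemma dfn_rel1:
  assumes "dfn M (\<lambda>e. R (e 0))" "dtm M t"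
  shows "dfn M (\<lambda>e. R (t e))"
  by (rule dfn_dtm_subst[OF assms(2)]) (use assms in simp)

text \<open>A relation known to be definable on the variables 0 and 1 can be filled with definable
  terms, also below binders. The local facts \<open>Xr\<close>, \<open>Yr\<close> and similar ones
  in later proofs are instances.\<close>

lemma dfn_rel2:
  assumes "dfn M (\<lambda>e. R (e 0) (e 1))" "dtm M t" "dtm M u"
  shows "dfn M (\<lambda>e. R (t e) (u e))"
proof (rule dfn_dtm_subst[OF assms(2), of "\<lambda>x e. R x (u e)"],
    rule dfn_dtm_subst[OF dtm_shift[OF assms(3)], of "\<lambda>y e. R (e 0) y"])
  show "dfn M (\<lambda>e. R (e (Suc 0)) (e 0))"
    using dfn_ren[OF assms(1), of "\<lambda>i. if i = 0 then 1 else 0"] by simp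
qed

lemma dfn_rel3:
  assumes "dfn M (\<lambda>e. R (e 0) (e 1) (e 2))" "dtm M t" "dtm M u" "dtm M v"
  shows "dfn M (\<lambda>e. R (t e) (u e) (v e))"
proof (rule dfn_dtm_subst[OF assms(4), of "\<lambda>x e. R (t e) (u e) x"],
    rule dfn_dtm_subst[OF dtm_shift[OF assms(3)], of "\<lambda>x e. R (t (\<lambda>i. e (Suc i))) x (e 0)"],
    rule dfn_dtm_subst[OF dtm_shift[OF dtm_shift[OF assms(2)]], of "\<lambda>x e. R x (e 0) (e (Suc 0))"])
  show "dfn M (\<lambda>e. R (e 0) (e (Suc 0)) (e (Suc (Suc 0))))"
    using assms(1) by (simp add: numeral_2_eq_2)
qed

definition dfun1 :: "('a, 'f, 'r) fo_structure \<Rightarrow> ('a \<Rightarrow> 'a) \<Rightarrow> bool" where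
  "dfun1 M f \<longleftrightarrow> dtm M (\<lambda>e. f (e 0))"

definition dfun2 :: "('a, 'f, 'r) fo_structure \<Rightarrow> ('a \<Rightarrow> 'a \<Rightarrow> 'a) \<Rightarrow> bool" where
  "dfun2 M f \<longleftrightarrow> dtm M (\<lambda>e. f (e 0) (e 1))"

lemma dtm_fun1:
  assumes "dfun1 M f" "dtm M t"
  shows "dtm M (\<lambda>e. f (t e))"
  unfolding dtm_def
  by (rule dfn_rel2[of M "\<lambda>y x. f x = y"])
    (use assms dtm_shift[OF assms(2), of Suc] in \<open>auto simp: dfun1_def dtm_def dtm_var[unfolded dtm_def]\<close>)

lemma dtm_fun2:
  assumes "dfun2 M f" "dtm M t" "dtm M u"
  shows "dtm M (\<lambda>e. f (t e) (u e))"
  unfolding dtm_def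
  by (rule dfn_rel3[of M "\<lambda>z x y. f x y = z", OF _ dtm_var])
    (use assms dtm_shift[OF assms(2), of Suc] dtm_shift[OF assms(3), of Suc]
      in \<open>auto simp: dfun2_def dtm_def numeral_2_eq_2\<close>)

definition dlist :: "('a, 'f, 'r) fo_structure \<Rightarrow> nat \<Rightarrow> ((nat \<Rightarrow> 'a) \<Rightarrow> 'a list) \<Rightarrow> bool" where
  "dlist M n t \<longleftrightarrow> (\<forall>e. length (t e) = n) \<and> (\<forall>i<n. dtm M (\<lambda>e. t e ! i))"

lemma dlist_vars: "(\<And>i. dtm M (\<lambda>e. t i e)) \<Longrightarrow> dlist M n (\<lambda>e. map (\<lambda>i. t i e) [0..<n])"
  by (auto simp: dlist_def)

lemma dlist_append:
  assumes "dlist M n t" "dlist M m u"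
  shows "dlist M (n + m) (\<lambda>e. t e @ u e)"
proof -
  have "dtm M (\<lambda>e. (t e @ u e) ! i)" if "i < n + m" for i
    using assms that by (cases "i < n") (auto simp: dlist_def nth_append)
  then show ?thesis using assms by (auto simp: dlist_def)
qed

lemma dlist_Nil: "dlist M 0 (\<lambda>e. [])"
  by (auto simp: dlist_def)

lemma dlist_Cons:
  assumes "dtm M t" "dlist M n u"
  shows "dlist M (Suc n) (\<lambda>e. t e # u e)"
proof -
  have "dtm M (\<lambda>e. (t e # u e) ! i)" if "i < Suc n" for i
    using assms that by (cases i) (auto simp: dlist_def)
  then show ?thesis using assms by (auto simp: dlist_def)
qed

lemma dlist_const: "length c = n \<Longrightarrow> dlist M n (\<lambda>e. c)"
  by (auto simp: dlist_def dtm_const)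

lemma dlist_snoc: "dlist M n t \<Longrightarrow> dtm M u \<Longrightarrow> dlist M (Suc n) (\<lambda>e. t e @ [u e])"
  using dlist_append[of M n t 1 "\<lambda>e. [u e]"] dlist_Cons[OF _ dlist_Nil, of M u] by simp

lemma dlist_single: "dtm M u \<Longrightarrow> dlist M 1 (\<lambda>e. [u e])"
  using dlist_Cons[OF _ dlist_Nil, of M u] by simp

lemma dtm_nth: "dlist M n t \<Longrightarrow> i < n \<Longrightarrow> dtm M (\<lambda>e. t e ! i)"
  by (auto simp: dlist_def)

lemma dfn_exlist:
  assumes "dfn M (\<lambda>e. P (map e [0..<k]) (\<lambda>i. e (i + k)))"
  shows "dfn M (\<lambda>e. \<exists>b. length b = k \<and> P b e)"
  using assms
proof (induction k arbitrary: P)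
  case (Suc k)
  \<comment> \<open>The list is split as \<open>b @ [x]\<close>. Its last entry is bound innermost
    and becomes index 0, the entries before it shift by one, and the outer variables keep their
    places.\<close>
  have "dfn M (\<lambda>e. P (map (\<lambda>i. e (if i = k then 0 else if i < k then Suc i else i)) [0..<Suc k])
          (\<lambda>i. e (if i + Suc k = k then 0 else if i + Suc k < k then Suc (i + Suc k) else i + Suc k)))"
    using dfn_ren[OF Suc.prems, of "\<lambda>i. if i = k then 0 else if i < k then Suc i else i"] .
  then have *: "dfn M (\<lambda>e. P (map (\<lambda>i. e (Suc i)) [0..<k] @ [e 0]) (\<lambda>i. e (Suc (i + k))))"
    by (rule back_subst[of "dfn M"]) (auto intro!: arg_cong2[of _ _ _ _ P])
  have "dfn M (\<lambda>e. \<exists>b. length b = k \<and> (\<exists>x. P (b @ [x]) e))"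
    by (rule Suc.IH, rule dfn_ex) (use * in simp)
  moreover have "(\<exists>b. length b = Suc k \<and> Q b) \<longleftrightarrow> (\<exists>b. length b = k \<and> (\<exists>x. Q (b @ [x])))"
    for Q :: "'a list \<Rightarrow> bool"
    by (auto simp: length_Suc_conv_rev)
  ultimately show ?case by simp
qed simp

lemma dfn_alllist:
  assumes "dfn M (\<lambda>e. P (map e [0..<k]) (\<lambda>i. e (i + k)))"
  shows "dfn M (\<lambda>e. \<forall>b. length b = k \<longrightarrow> P b e)"
  using dfn_not[OF dfn_exlist[of M "\<lambda>b e. \<not> P b e", OF dfn_not[OF assms]]] by simp

text \<open>A predicate on lists of length \<open>n\<close> is represented by its values on the first \<open>n\<close> variables.\<close>

lemma dfn_list:
  assumes "dfn M (\<lambda>e. P (map e [0..<n]))" "dlist M n t"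
  shows "dfn M (\<lambda>e. P (t e))"
proof -
  have "dfn M (\<lambda>e. \<exists>b. length b = n \<and> ((\<forall>i\<in>{..<n}. b ! i = t e ! i) \<and> P b))"
  proof (intro dfn_exlist dfn_conj dfn_finite_all dfn_eq finite_lessThan)
    fix i assume "i \<in> {..<n}"
    then show "dtm M (\<lambda>e. map e [0..<n] ! i)" "dtm M (\<lambda>e. t (\<lambda>i. e (i + n)) ! i)"
      using dtm_shift[of M "\<lambda>e. t e ! i"] assms(2) by (auto simp: dtm_var dlist_def)
  qed (rule assms(1))
  moreover have "(\<exists>b. length b = n \<and> ((\<forall>i\<in>{..<n}. b ! i = t e ! i) \<and> P b)) \<longleftrightarrow> P (t e)" for e
  proof -
    have "b = t e" if "length b = n" "\<forall>i\<in>{..<n}. b ! i = t e ! i" for b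
      using assms(2) that by (intro nth_equalityI) (auto simp: dlist_def)
    moreover have "length (t e) = n" using assms(2) by (simp add: dlist_def)
    ultimately show ?thesis by blast
  qed
  ultimately show ?thesis by simp
qed

lemma dfn_mem:
  assumes "definable M n S" "dlist M n t"
  shows "dfn M (\<lambda>e. t e \<in> S)"
  using dfn_list[OF definable_dfn[OF assms(1)] assms(2)] .

lemma definableI:
  assumes "dfn M (\<lambda>e. P (map e [0..<n]))" "\<And>xs. xs \<in> A \<longleftrightarrow> length xs = n \<and> P xs"
  shows "definable M n A"
  using assms by (simp add: definable_iff_dfn)

section \<open>Definable sets in an o-minimal field\<close>

text \<open>The default 0 makes the description total, so that its graph is definable from the
  predicate alone, whether or not there is a unique witness.\<close>

definition the0 :: "('a::zero \<Rightarrow> bool) \<Rightarrow> 'a" where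
  "the0 P = (if \<exists>!y. P y then THE y. P y else 0)"

lemma the0_equality: "P a \<Longrightarrow> (\<And>x. P x \<Longrightarrow> x = a) \<Longrightarrow> the0 P = a"
  unfolding the0_def by (metis the_equality)

text \<open>Serves to reuse a definability hypothesis below further binders, where the environment
  reappears renamed and the first argument is an arbitrary definable term.\<close>

lemma dfn_open:
  assumes "dfn M (\<lambda>e. P (e 0) (\<lambda>i. e (Suc i)))" "dtm M t"
  shows "dfn M (\<lambda>e. P (t e) (\<lambda>i. e (r i)))"
proof (rule dfn_dtm_subst[OF assms(2), of "\<lambda>x e. P x (\<lambda>i. e (r i))"])
  show "dfn M (\<lambda>e. P (e 0) (\<lambda>i. e (Suc (r i))))"
    using dfn_ren[OF assms(1), of "\<lambda>i. case i of 0 \<Rightarrow> 0 | Suc j \<Rightarrow> Suc (r j)"] by simp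
qed

lemma dtm_the0:
  fixes M :: "('a::zero, 'f, 'r) fo_structure"
  assumes "dfn M (\<lambda>e. P (e 0) (\<lambda>i. e (Suc i)))"
  shows "dtm M (\<lambda>e. the0 (\<lambda>y. P y e))"
proof -
  have "the0 P = v \<longleftrightarrow> (P v \<and> (\<forall>y. P y \<longrightarrow> y = v)) \<or> v = 0 \<and> \<not> (\<exists>x. P x \<and> (\<forall>y. P y \<longrightarrow> y = x))"
    for P and v :: 'a
  proof (cases "\<exists>!y. P y")
    case True
    then obtain z where "P z" "\<And>y. P y \<Longrightarrow> y = z" by blast
    then show ?thesis using the0_equality[of P z] by blast
  qed (auto simp: the0_def)
  moreover have "dfn M (\<lambda>e. (P (e 0) (\<lambda>i. e (Suc i)) \<and> (\<forall>y. P y (\<lambda>i. e (Suc i)) \<longrightarrow> y = e 0)) \<or>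
    e 0 = 0 \<and> \<not> (\<exists>x. P x (\<lambda>i. e (Suc i)) \<and> (\<forall>y. P y (\<lambda>i. e (Suc i)) \<longrightarrow> y = x)))"
    by (intro dfn_disj dfn_conj dfn_not dfn_all dfn_ex dfn_imp dfn_eq dtm_var dtm_const
        dfn_open[OF assms])
  ultimately show ?thesis by (simp add: dtm_def)
qed

locale o_minimal_field =
  fixes M :: "('a::{linordered_field, linorder_topology}, 'f, 'r) fo_structure"
  assumes o_minimal: "o_minimal M" and expands: "expands_ordered_field M"
begin

lemma dfn_less:
  assumes "dtm M t" "dtm M u"
  shows "dfn M (\<lambda>e. t e < u e)"
proof (rule dfn_rel2[OF _ assms])
  obtain r where r: "\<And>x y. rel_interp M r [x, y] \<longleftrightarrow> x < y"
    using expands by (auto simp: expands_ordered_field_def)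
  have "dfn M (\<lambda>e. rel_interp M r (map (\<lambda>t. t e) [\<lambda>e. e 0, \<lambda>e. e 1]))"
    by (rule dfn_Rel) (auto intro: trm.intros)
  then show "dfn M (\<lambda>e. e 0 < e 1)" by (simp add: r)
qed

lemma dfn_le: "dtm M t \<Longrightarrow> dtm M u \<Longrightarrow> dfn M (\<lambda>e. t e \<le> u e)"
  unfolding le_less by (intro dfn_disj dfn_less dfn_eq)

lemma dtm_add:
  assumes "dtm M t" "dtm M u"
  shows "dtm M (\<lambda>e. t e + u e)"
proof (rule dtm_fun2[OF _ assms])
  obtain s where s: "\<And>x y. fun_interp M s [x, y] = x + y"
    using expands by (auto simp: expands_ordered_field_def)
  have "trm M (\<lambda>e. fun_interp M s (map (\<lambda>t. t e) [\<lambda>e. e 0, \<lambda>e. e 1]))"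
    by (rule trm_app) (auto intro: trm.intros)
  then show "dfun2 M (+)" by (simp add: s dfun2_def dtm_trm)
qed

lemma dtm_mult:
  assumes "dtm M t" "dtm M u"
  shows "dtm M (\<lambda>e. t e * u e)"
proof (rule dtm_fun2[OF _ assms])
  obtain s where s: "\<And>x y. fun_interp M s [x, y] = x * y"
    using expands by (auto simp: expands_ordered_field_def)
  have "trm M (\<lambda>e. fun_interp M s (map (\<lambda>t. t e) [\<lambda>e. e 0, \<lambda>e. e 1]))"
    by (rule trm_app) (auto intro: trm.intros)
  then show "dfun2 M (*)" by (simp add: s dfun2_def dtm_trm)
qed

lemma dtm_uminus:
  assumes "dtm M t" shows "dtm M (\<lambda>e. - t e)"
  using dtm_mult[OF dtm_const[of M "-1"] assms] by simp

lemma dtm_diff: "dtm M t \<Longrightarrow> dtm M u \<Longrightarrow> dtm M (\<lambda>e. t e - u e)"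
  using dtm_add[of t, OF _ dtm_uminus[of u]] by simp

lemma dtm_divide:
  assumes "dtm M t" "dtm M u"
  shows "dtm M (\<lambda>e. t e / u e)"
proof (rule dtm_fun2[OF _ assms])
  \<comment> \<open>Among the operations only addition and multiplication are given by symbols, so
    the graph of division is described by multiplication, together with the convention x / 0 =
    0.\<close>
  have "x / y = z \<longleftrightarrow> (if y = 0 then z = 0 else z * y = x)" for x y z :: 'a
    by (auto simp: field_simps)
  then show "dfun2 M (/)"
    unfolding dfun2_def dtm_def by (simp only:) (intro dfn_if dfn_eq dtm_var dtm_const dtm_mult)
qed

lemma dtm_abs: "dtm M t \<Longrightarrow> dtm M (\<lambda>e. \<bar>t e\<bar>)"
  unfolding abs_if by (intro dtm_if dfn_less dtm_const dtm_uminus)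

lemmas dfn_logic = dfn_not dfn_conj dfn_disj dfn_imp dfn_iff dfn_ex dfn_all dfn_const
lemmas dfn_rules = dfn_logic dfn_if dfn_eq dfn_less dfn_le
  dtm_var dtm_const dtm_add dtm_mult dtm_uminus dtm_diff dtm_divide dtm_abs dtm_if

definition dset :: "'a set \<Rightarrow> bool" where
  "dset A \<longleftrightarrow> dfn M (\<lambda>e. e 0 \<in> A)"

lemma dset_definable: "dset A \<longleftrightarrow> definable M 1 ((\<lambda>x. [x]) ` A)"
  by (simp add: dset_def definable_iff_dfn image_iff)

lemma dset_Collect: "dset {x. P x} \<longleftrightarrow> dfn M (\<lambda>e. P (e 0))"
  by (simp add: dset_def)

lemma dfn_dset: "dset A \<Longrightarrow> dtm M t \<Longrightarrow> dfn M (\<lambda>e. t e \<in> A)"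
  unfolding dset_def by (rule dfn_rel1[of M "\<lambda>x. x \<in> A"])

lemma dset_finite: "finite A \<Longrightarrow> dset A"
  using dfn_finite_ex[of A M "\<lambda>a e. e 0 = a", OF _ dfn_eq[OF dtm_var dtm_const]]
  by (simp add: dset_def)

subsection \<open>One-sided germs, intervals and suprema\<close>

definition rgerm :: "'a set \<Rightarrow> 'a \<Rightarrow> bool" where
  "rgerm A c \<longleftrightarrow> (\<exists>z>c. {c<..<z} \<subseteq> A)"

definition lgerm :: "'a set \<Rightarrow> 'a \<Rightarrow> bool" where
  "lgerm A c \<longleftrightarrow> (\<exists>z<c. {z<..<c} \<subseteq> A)"

lemma rgermI: "c < z \<Longrightarrow> (\<And>w. c < w \<Longrightarrow> w < z \<Longrightarrow> w \<in> A) \<Longrightarrow> rgerm A c"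
  unfolding rgerm_def by auto

lemma germ_mono: "A \<subseteq> B \<Longrightarrow> rgerm A c \<Longrightarrow> rgerm B c" "A \<subseteq> B \<Longrightarrow> lgerm A c \<Longrightarrow> lgerm B c"
  unfolding rgerm_def lgerm_def by blast+

lemma rgerm_Int: "rgerm A c \<Longrightarrow> rgerm B c \<Longrightarrow> rgerm (A \<inter> B) c"
proof -
  assume "rgerm A c" "rgerm B c"
  then obtain y z where "c < y" "c < z" "{c<..<y} \<subseteq> A" "{c<..<z} \<subseteq> B"
    unfolding rgerm_def by auto
  then show ?thesis unfolding rgerm_def by (intro exI[of _ "min y z"]) auto
qed

lemma lgerm_Int: "lgerm A c \<Longrightarrow> lgerm B c \<Longrightarrow> lgerm (A \<inter> B) c"
proof -
  assume "lgerm A c" "lgerm B c"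
  then obtain y z where "y < c" "z < c" "{y<..<c} \<subseteq> A" "{z<..<c} \<subseteq> B"
    unfolding lgerm_def by auto
  then show ?thesis unfolding lgerm_def by (intro exI[of _ "max y z"]) auto
qed

lemma germ_nonempty: "\<not> rgerm {} c" "\<not> lgerm {} c"
  unfolding rgerm_def lgerm_def using dense by auto

lemma o_minimal_union:
  assumes "dset A"
  obtains \<C> where "finite \<C>" "\<C> \<subseteq> intervals \<union> {{a} |a. True}" "A = \<Union> \<C>"
  using o_minimal assms unfolding o_minimal_def dset_definable by blast

text \<open>A point or an interval either contains a right-hand germ at c or misses it, and the
  alternative survives finite unions. So the definable sets that contain the germ form an
  ultrafilter of definable sets.\<close>

lemma rgerm_total:
  assumes "dset A"
  shows "rgerm A c \<or> rgerm (- A) c"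
proof -
  obtain \<C> where *: "finite \<C>" "\<C> \<subseteq> intervals \<union> {{a} |a. True}" "A = \<Union> \<C>"
    using o_minimal_union[OF assms] by blast
  obtain z0 where z0: "c < z0" using gt_ex by blast
  from * show ?thesis
  proof (induction arbitrary: A)
    case empty
    then show ?case using rgermI[OF z0, of "- A"] by simp
  next
    case (insert C \<C>)
    have "C \<in> intervals \<union> {{a} |a. True}" using insert.prems by auto
    then have "rgerm C c \<or> rgerm (- C) c"
    proof (elim UnE)
      assume "C \<in> {{a} |a. True}"
      then obtain a where "C = {a}" by auto
      then show ?thesis using rgermI[of c a "- C"] rgermI[of c z0 "- C"] z0
        by (cases "c < a") auto
    next
      assume "C \<in> intervals"
      then consider a b where "C = {a<..<b}" | a where "C = {a<..}" | b where "C = {..<b}" | "C = UNIV"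
        unfolding intervals_def by blast
      then show ?thesis
      proof cases
        case 1
        consider "c < a" | "a \<le> c" "c < b" | "b \<le> c" by fastforce
        then show ?thesis
        proof cases
          case 1
          then show ?thesis using rgermI[of c a "- C"] \<open>C = {a<..<b}\<close> by simp
        next
          case 2
          then show ?thesis using rgermI[of c b C] \<open>C = {a<..<b}\<close> by simp
        next
          case 3
          then show ?thesis using rgermI[OF z0, of "- C"] \<open>C = {a<..<b}\<close> by simp
        qed
      next
        case 2
        then show ?thesis using rgermI[of c a "- C"] rgermI[OF z0, of C] by (cases "c < a") auto
      next
        case 3
        then show ?thesis using rgermI[of c b C] rgermI[OF z0, of "- C"] by (cases "c < b") auto
      next
        case 4
        then show ?thesis using rgermI[OF z0, of C] by simp
      qed
    qed
    moreover have "rgerm (\<Union> \<C>) c \<or> rgerm (- \<Union> \<C>) c" using insert by auto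
    ultimately show ?case
      using rgerm_Int[of "- C" c "- \<Union> \<C>"] germ_mono(1)[of C A c] germ_mono(1)[of "\<Union> \<C>" A c]
      by (auto simp: insert.prems(2))
  qed
qed

lemma dset_Int: "dset A \<Longrightarrow> dset B \<Longrightarrow> dset (A \<inter> B)"
  by (simp add: dset_def dfn_conj)

lemma dset_uminus: "dset A \<Longrightarrow> dset {x. - x \<in> A}"
  unfolding dset_Collect by (intro dfn_dset dfn_rules)

lemma lgerm_uminus: "lgerm A c \<longleftrightarrow> rgerm {x. - x \<in> A} (- c)"
proof
  assume "lgerm A c"
  then obtain z where "z < c" "{z<..<c} \<subseteq> A" unfolding lgerm_def by auto
  then show "rgerm {x. - x \<in> A} (- c)" unfolding rgerm_def
    by (intro exI[of _ "- z"]) (auto simp: minus_less_iff less_minus_iff)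
next
  assume "rgerm {x. - x \<in> A} (- c)"
  then obtain z where z: "- c < z" "{- c<..<z} \<subseteq> {x. - x \<in> A}" unfolding rgerm_def by auto
  have "w \<in> A" if "- z < w" "w < c" for w
    using subsetD[OF z(2), of "- w"] that by (auto simp: minus_less_iff)
  then show "lgerm A c" unfolding lgerm_def using z(1)
    by (intro exI[of _ "- z"]) (auto simp: minus_less_iff)
qed

lemma lgerm_total: "dset A \<Longrightarrow> lgerm A c \<or> lgerm (- A) c"
  using rgerm_total[OF dset_uminus, of A "- c"] lgerm_uminus[of A c] lgerm_uminus[of "- A" c]
  by (auto simp: Collect_neg_eq)

lemma germ_compl:
  assumes "dset A" shows "rgerm (- A) c \<longleftrightarrow> \<not> rgerm A c" "lgerm (- A) c \<longleftrightarrow> \<not> lgerm A c"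
  using rgerm_total[OF assms, of c] rgerm_Int[of A c "- A"]
    lgerm_total[OF assms, of c] lgerm_Int[of A c "- A"] germ_nonempty by auto

lemma infinite_interval:
  assumes "dset A" "infinite A"
  obtains a b where "a < b" "{a<..<b} \<subseteq> A"
proof -
  obtain \<C> where C: "finite \<C>" "\<C> \<subseteq> intervals \<union> {{a} |a. True}" "A = \<Union> \<C>"
    using o_minimal_union[OF assms(1)] by blast
  have "\<exists>C\<in>\<C>. infinite C" using C assms(2) by auto
  then obtain C where "C \<in> \<C>" "infinite C" by auto
  then have "C \<in> intervals" using C by auto
  then have "\<exists>a b. a < b \<and> {a<..<b} \<subseteq> C"
  proof -
    obtain l u where lu: "\<And>x :: 'a. l x < x" "\<And>x :: 'a. x < u x" using gt_ex lt_ex by metis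
    consider c d where "C = {c<..<d}" "c < d" | c where "C = {c<..}" | d where "C = {..<d}"
      | "C = UNIV"
      using \<open>C \<in> intervals\<close> unfolding intervals_def by blast
    then show ?thesis
    proof cases
      case (2 c)
      then show ?thesis using lu(2) by (intro exI[of _ c] exI[of _ "u c"]) auto
    next
      case (3 d)
      then show ?thesis using lu(1) by (intro exI[of _ "l d"] exI[of _ d]) auto
    next
      case 4
      then show ?thesis using lu(2) by auto
    qed auto
  qed
  then show ?thesis using that C \<open>C \<in> \<C>\<close> by blast
qed

text \<open>A relation instead of an operator, because the field is not complete and only suprema of
  definable sets are available.\<close>

definition is_lub :: "'a set \<Rightarrow> 'a \<Rightarrow> bool" where
  "is_lub A s \<longleftrightarrow> (\<forall>x\<in>A. x \<le> s) \<and> (\<forall>y. (\<forall>x\<in>A. x \<le> y) \<longrightarrow> s \<le> y)"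

text \<open>The substitute for completeness: a bounded point or interval has its right end as
  supremum, and a finite union takes the largest of these.\<close>

lemma lub_exists:
  assumes "dset A" "A \<noteq> {}" "\<And>x. x \<in> A \<Longrightarrow> x \<le> b"
  obtains s where "is_lub A s"
proof -
  obtain \<C> where C: "finite \<C>" "\<C> \<subseteq> intervals \<union> {{a} |a. True}" "A = \<Union> \<C>"
    using o_minimal_union[OF assms(1)] by blast
  have lub1: "\<exists>s. is_lub C s" if "C \<in> \<C>" for C
  proof -
    have bd: "\<And>x. x \<in> C \<Longrightarrow> x \<le> b" using assms(3) C that by auto
    obtain b' where "b < b'" using gt_ex by blast
    have "C \<in> intervals \<union> {{a} |a. True}" using that C(2) by blast
    then consider a where "C = {a}" | c d where "C = {c<..<d}" "c < d" | a where "C = {a<..}"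
      | a where "C = {..<a}" | "C = UNIV"
      unfolding intervals_def by blast
    then show ?thesis
    proof cases
      case 1 then show ?thesis by (auto simp: is_lub_def)
    next
      case 2
      then have "is_lub C d" unfolding is_lub_def
        by (metis dense_le_bounded greaterThanLessThan_iff less_imp_le)
      then show ?thesis by blast
    next
      case 3
      have "b' \<in> C \<or> b' \<le> a" using 3 by auto
      moreover obtain a' where "a < a'" using gt_ex by blast
      ultimately show ?thesis using bd[of b'] bd[of a'] 3 \<open>b < b'\<close> by auto
    next
      case 4
      then have "is_lub C a" unfolding is_lub_def by (auto intro: dense_le)
      then show ?thesis by blast
    next
      case 5
      then show ?thesis using bd[of b'] \<open>b < b'\<close> by auto
    qed
  qed
  have "\<exists>s. is_lub (\<Union> \<C>') s" if "\<C>' \<subseteq> \<C>" "\<C>' \<noteq> {}" for \<C>'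
  proof -
    have "finite \<C>'" using C that finite_subset by blast
    then show ?thesis using that(2,1)
    proof (induction rule: finite_ne_induct)
      case (singleton C)
      then show ?case using lub1 by auto
    next
      case (insert C \<C>')
      then obtain s t where "is_lub C s" "is_lub (\<Union> \<C>') t" using lub1[of C] by blast
      then have "is_lub (\<Union> (insert C \<C>')) (max s t)" unfolding is_lub_def
        by (auto simp: ball_Un intro: max.coboundedI1 max.coboundedI2)
      then show ?case by blast
    qed
  qed
  moreover have "\<C> \<noteq> {}" using assms(2) C by auto
  ultimately show ?thesis using that C by auto
qed

lemma lub_unique: "is_lub A s \<Longrightarrow> is_lub A t \<Longrightarrow> s = t"
  unfolding is_lub_def by (meson order_antisym)

lemma lub_approx: "is_lub A s \<Longrightarrow> y < s \<Longrightarrow> \<exists>x\<in>A. y < x"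
  unfolding is_lub_def by (meson not_le)

lemma lub_upper: "is_lub A s \<Longrightarrow> x \<in> A \<Longrightarrow> x \<le> s"
  and lub_least: "is_lub A s \<Longrightarrow> (\<And>x. x \<in> A \<Longrightarrow> x \<le> y) \<Longrightarrow> s \<le> y"
  by (auto simp: is_lub_def)

text \<open>Definable connectedness of an interval: the supremum of the points up to which
  membership agrees with that of t must be u, since local constancy would otherwise push it
  further.\<close>

lemma locally_constant_interval:
  assumes A: "dset A" and tu: "t \<le> u"
    and loc: "\<And>x. t \<le> x \<Longrightarrow> x \<le> u \<Longrightarrow> \<exists>\<epsilon>>0. \<forall>w. \<bar>w - x\<bar> < \<epsilon> \<longrightarrow> (w \<in> A \<longleftrightarrow> x \<in> A)"
  shows "t \<in> A \<longleftrightarrow> u \<in> A"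
proof -
  define S where "S = {v. t \<le> v \<and> v \<le> u \<and> (\<forall>w. t \<le> w \<and> w \<le> v \<longrightarrow> (w \<in> A \<longleftrightarrow> t \<in> A))}"
  have "dset S" unfolding S_def dset_Collect by (intro dfn_rules dfn_dset A)
  moreover have "t \<in> S" using tu by (auto simp: S_def)
  moreover have Su: "x \<le> u" if "x \<in> S" for x using that by (simp add: S_def)
  ultimately obtain s where s: "is_lub S s" using lub_exists[of S u] by blast
  have "t \<le> s" "s \<le> u" using lub_upper[OF s \<open>t \<in> S\<close>] lub_least[OF s Su] by auto
  then obtain \<epsilon> where \<epsilon>: "\<epsilon> > 0" "\<And>w. \<bar>w - s\<bar> < \<epsilon> \<Longrightarrow> (w \<in> A \<longleftrightarrow> s \<in> A)"
    using loc[of s] tu by auto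
  obtain v where v: "v \<in> S" "s - \<epsilon> < v" using lub_approx[OF s, of "s - \<epsilon>"] \<epsilon> by auto
  have "v \<le> s" using lub_upper[OF s v(1)] .
  then have "\<bar>v - s\<bar> < \<epsilon>" using v(2) \<epsilon>(1) by (simp add: abs_less_iff)
  moreover have tv: "t \<le> v" and vA: "\<And>w. t \<le> w \<Longrightarrow> w \<le> v \<Longrightarrow> w \<in> A \<longleftrightarrow> t \<in> A"
    using v(1) unfolding S_def by blast+
  ultimately have "s \<in> A \<longleftrightarrow> t \<in> A" using \<epsilon>(2)[of v] vA[of v] by blast
  have in_S: "w \<in> S" if w: "t \<le> w" "w \<le> u" "w < s + \<epsilon>" for w
  proof -
    have "x \<in> A \<longleftrightarrow> t \<in> A" if x: "t \<le> x" "x \<le> w" for x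
    proof (cases "x \<le> v")
      case False
      then have "s - \<epsilon> < x" "x < s + \<epsilon>" using v(2) x(2) w by auto
      then have "\<bar>x - s\<bar> < \<epsilon>" by (simp add: abs_less_iff algebra_simps)
      then show ?thesis using \<epsilon>(2) \<open>s \<in> A \<longleftrightarrow> t \<in> A\<close> by blast
    qed (use vA x in blast)
    then show ?thesis unfolding S_def using w by blast
  qed
  have "s = u"
  proof (rule ccontr)
    assume "s \<noteq> u"
    then have "s < min u (s + \<epsilon>)" using \<open>s \<le> u\<close> \<epsilon> by auto
    then obtain w where "s < w" "w < min u (s + \<epsilon>)" using dense by blast
    then show False using lub_upper[OF s, of w] in_S[of w] \<open>t \<le> s\<close> by auto
  qed
  then show ?thesis using \<open>s \<in> A \<longleftrightarrow> t \<in> A\<close> by blast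
qed

subsection \<open>Definable choice\<close>

text \<open>
  The chosen point has least absolute value, if the infimum \<open>a\<close> of the absolute values is attained;
  otherwise its absolute value is \<open>a + d / 2\<close>, where \<open>d \<le> 1\<close> is maximal such that all elements of
  \<open>{a<..<a + d}\<close> are absolute values.
\<close>

definition skolem_rel :: "'a set \<Rightarrow> 'a \<Rightarrow> bool" where
  "skolem_rel A y \<longleftrightarrow>
    (\<exists>r. \<exists>a. ((\<forall>x\<in>A. a \<le> \<bar>x\<bar>) \<and> (\<forall>c. (\<forall>x\<in>A. c \<le> \<bar>x\<bar>) \<longrightarrow> c \<le> a)) \<and> (\<exists>x\<in>A. \<bar>x\<bar> = r) \<and>
      (if \<exists>x\<in>A. \<bar>x\<bar> = a then r = a
       else is_lub {d. 0 < d \<and> d \<le> 1 \<and> (\<forall>z. a < z \<and> z < a + d \<longrightarrow> (\<exists>x\<in>A. \<bar>x\<bar> = z))} (2 * (r - a))) \<and>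
      (if r \<in> A then y = r else y = - r))"

definition skolem :: "'a set \<Rightarrow> 'a" where
  "skolem A = the0 (skolem_rel A)"

lemma dset_abs: "dset A \<Longrightarrow> dset {z. \<exists>x\<in>A. \<bar>x\<bar> = z}"
  unfolding dset_Collect Bex_def by (intro dfn_dset dfn_rules)

lemma skolem_in:
  assumes A: "dset A" "A \<noteq> {}"
  shows "skolem A \<in> A"
proof -
  define B where "B = {z. \<exists>x\<in>A. \<bar>x\<bar> = z}"
  have B: "dset B" "B \<noteq> {}" "\<And>z. z \<in> B \<Longrightarrow> 0 \<le> z"
    using dset_abs[OF A(1)] A(2) by (auto simp: B_def)
  \<comment> \<open>The existence result concerns suprema, so the infimum of the absolute values is
    obtained as the supremum of their lower bounds.\<close>
  define L where "L = {c. \<forall>x\<in>B. c \<le> x}"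
  have "dset L" unfolding L_def dset_Collect Ball_def by (intro dfn_dset dfn_rules B)
  moreover have "0 \<in> L" using B by (auto simp: L_def)
  moreover obtain x0 where "x0 \<in> B" using B by auto
  moreover have "x \<le> x0" if "x \<in> L" for x using that \<open>x0 \<in> B\<close> by (simp add: L_def)
  ultimately obtain a where a: "is_lub L a" using lub_exists[of L x0] by blast
  have a1: "a \<le> x" if "x \<in> B" for x using lub_least[OF a, of x] that by (simp add: L_def)
  have a2: "c \<le> a" if "\<And>x. x \<in> B \<Longrightarrow> c \<le> x" for c using lub_upper[OF a, of c] that by (simp add: L_def)
  define D where "D = {d. 0 < d \<and> d \<le> 1 \<and> (\<forall>z. a < z \<and> z < a + d \<longrightarrow> z \<in> B)}"
  have *: "skolem_rel A y \<longleftrightarrow> (\<exists>r. r \<in> B \<and> (if a \<in> B then r = a else is_lub D (2 * (r - a))) \<and>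
      (if r \<in> A then y = r else y = - r))" for y
  proof -
    have lo: "\<forall>x\<in>A. a \<le> \<bar>x\<bar>" "\<forall>c. (\<forall>x\<in>A. c \<le> \<bar>x\<bar>) \<longrightarrow> c \<le> a"
      using a1 a2 by (auto simp: B_def)
    have "(\<forall>x\<in>A. a' \<le> \<bar>x\<bar>) \<and> (\<forall>c. (\<forall>x\<in>A. c \<le> \<bar>x\<bar>) \<longrightarrow> c \<le> a') \<longleftrightarrow> a' = a" for a'
      using lo by (meson order_antisym)
    then show ?thesis
      unfolding skolem_rel_def D_def B_def mem_Collect_eq by (simp only: simp_thms ex_simps)
  qed
  obtain r where r: "r \<in> B" "if a \<in> B then r = a else is_lub D (2 * (r - a))"
  proof (cases "a \<in> B")
    case False
    have "dset D" unfolding D_def dset_Collect by (intro dfn_rules dfn_dset B)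
    \<comment> \<open>When the infimum a is not attained, a gap of \<open>B\<close> to the right of
      a would produce a larger lower bound. Hence \<open>B\<close> contains the right germ at a and
      \<open>D\<close> is nonempty.\<close>
    have "\<not> rgerm (- B) a"
    proof
      assume "rgerm (- B) a"
      then obtain z where z: "a < z" "{a<..<z} \<subseteq> - B" by (auto simp: rgerm_def)
      have "z \<le> x" if "x \<in> B" for x
      proof (rule ccontr)
        assume "\<not> z \<le> x"
        then have "x \<in> {a<..<z}" using a1[OF that] False that by (auto simp: order_le_less)
        then show False using z that by auto
      qed
      then show False using a2[of z] z by auto
    qed
    then have "rgerm B a" using rgerm_total[OF B(1)] by auto
    then obtain z where z: "a < z" "{a<..<z} \<subseteq> B" by (auto simp: rgerm_def)
    define d0 where "d0 = min (z - a) 1"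
    have "0 < d0" "d0 \<le> 1" "a + d0 \<le> z" using z by (auto simp: d0_def min_def)
    then have "d0 \<in> D" using z(2) unfolding D_def by auto
    moreover have "x \<le> 1" if "x \<in> D" for x using that by (simp add: D_def)
    ultimately obtain d where d: "is_lub D d" using lub_exists[OF \<open>dset D\<close>, of 1] by blast
    have "d0 \<le> d" using d \<open>d0 \<in> D\<close> by (simp add: is_lub_def)
    then have "0 < d" using \<open>0 < d0\<close> by simp
    then obtain d' where "d' \<in> D" "d / 2 < d'" using lub_approx[OF d, of "d / 2"] by auto
    then have "a + d / 2 \<in> B" using \<open>0 < d\<close> by (auto simp: D_def)
    then show ?thesis using that[of "a + d / 2"] False d by auto
  qed (use that in auto)
  define y where "y = (if r \<in> A then r else - r)"
  have "skolem_rel A y" unfolding * y_def using r by (intro exI[of _ r]) auto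
  moreover have "x = y" if "skolem_rel A x" for x
  proof -
    obtain r' where r': "r' \<in> B" "if a \<in> B then r' = a else is_lub D (2 * (r' - a))"
      "x = (if r' \<in> A then r' else - r')"
      using \<open>skolem_rel A x\<close> unfolding * by (auto split: if_splits)
    have "r' = r" using r(2) r'(2) lub_unique by (fastforce split: if_splits)
    then show ?thesis using r' y_def by simp
  qed
  ultimately have "skolem A = y" unfolding skolem_def by (rule the0_equality)
  moreover have "y \<in> A" using r(1) by (auto simp: y_def B_def abs_if split: if_splits)
  ultimately show ?thesis by simp
qed

lemma dtm_skolem:
  assumes "dfn M (\<lambda>e. P (e 0) (\<lambda>i. e (Suc i)))"
  shows "dtm M (\<lambda>e. skolem {y. P y e})"
  unfolding skolem_def
  by (rule dtm_the0, unfold skolem_rel_def is_lub_def Bex_def Ball_def mem_Collect_eq)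
    (intro dfn_rules dfn_open[OF assms])

section \<open>Monotonicity and continuity of definable functions\<close>

lemma dfn_rgerm:
  assumes "dfn M (\<lambda>e. P (e 0) (\<lambda>i. e (Suc i)))" "dtm M t"
  shows "dfn M (\<lambda>e. rgerm {y. P y e} (t e))"
proof -
  have "rgerm {y. P y e} c \<longleftrightarrow> (\<exists>z. c < z \<and> (\<forall>w. c < w \<and> w < z \<longrightarrow> P w e))" for c e
    unfolding rgerm_def by (auto simp: subset_iff)
  then show ?thesis
    by (simp only:) (intro dfn_rules dfn_open[OF assms(1)] dtm_shift[OF assms(2)])
qed

lemma dfn_lgerm:
  assumes "dfn M (\<lambda>e. P (e 0) (\<lambda>i. e (Suc i)))" "dtm M t"
  shows "dfn M (\<lambda>e. lgerm {y. P y e} (t e))"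
proof -
  have "lgerm {y. P y e} c \<longleftrightarrow> (\<exists>z. z < c \<and> (\<forall>w. z < w \<and> w < c \<longrightarrow> P w e))" for c e
    unfolding lgerm_def by (auto simp: subset_iff)
  then show ?thesis
    by (simp only:) (intro dfn_rules dfn_open[OF assms(1)] dtm_shift[OF assms(2)])
qed

lemma subinterval_cases:
  assumes "dset A" "a < b"
  obtains c d where "a \<le> c" "c < d" "d \<le> b" "{c<..<d} \<subseteq> A \<or> {c<..<d} \<subseteq> - A"
proof -
  consider "rgerm A a" | "rgerm (- A) a" using rgerm_total[OF assms(1)] by blast
  then obtain z where "a < z" "{a<..<z} \<subseteq> A \<or> {a<..<z} \<subseteq> - A"
    unfolding rgerm_def by cases blast+
  moreover have "{a<..<min z b} \<subseteq> {a<..<z}" by auto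
  ultimately show ?thesis using that[of a "min z b"] assms(2) by fastforce
qed

text \<open>
  Choose a radius \<open>g x\<close> definably. If every set \<open>{x. \<delta> \<le> g x}\<close> with \<open>\<delta> > 0\<close> were finite, the range of
  \<open>g\<close> would contain no interval, hence be finite, and \<open>g\<close> would be bounded below after all.
\<close>

lemma uniform_radius:
  assumes Q: "dfn M (\<lambda>e. Q (e 0) (e 1))" and "a < b"
    and ex: "\<And>x. a < x \<Longrightarrow> x < b \<Longrightarrow> \<exists>\<epsilon>>0. Q x \<epsilon>"
    and mono: "\<And>x \<epsilon> \<epsilon>'. Q x \<epsilon> \<Longrightarrow> 0 < \<epsilon>' \<Longrightarrow> \<epsilon>' \<le> \<epsilon> \<Longrightarrow> Q x \<epsilon>'"
  obtains c d \<delta> where "a \<le> c" "c < d" "d \<le> b" "\<delta> > 0" "\<And>x. c < x \<Longrightarrow> x < d \<Longrightarrow> Q x \<delta>"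
proof -
  define g where "g x = skolem {\<epsilon>. 0 < \<epsilon> \<and> Q x \<epsilon>}" for x
  note Qr = dfn_rel2[OF Q]
  have g: "dfun1 M g" unfolding dfun1_def g_def by (intro dtm_skolem dfn_rules Qr)
  have gQ: "0 < g x \<and> Q x (g x)" if "a < x" "x < b" for x
  proof -
    have "dset {\<epsilon>. 0 < \<epsilon> \<and> Q x \<epsilon>}" unfolding dset_Collect by (intro dfn_rules Qr)
    then show ?thesis using skolem_in[of "{\<epsilon>. 0 < \<epsilon> \<and> Q x \<epsilon>}"] ex[OF that] unfolding g_def by blast
  qed
  define A where "A \<delta> = {x. a < x \<and> x < b \<and> \<delta> \<le> g x}" for \<delta>
  have dA: "dset (A \<delta>)" for \<delta> unfolding A_def dset_Collect by (intro dfn_rules dtm_fun1[OF g])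
  have "\<exists>\<delta>>0. infinite (A \<delta>)"
  proof (rule ccontr)
    assume "\<not> ?thesis"
    then have fin: "finite (A \<delta>)" if "\<delta> > 0" for \<delta> using that by blast
    define V where "V = {v. \<exists>x. a < x \<and> x < b \<and> v = g x}"
    have dV: "dset V" unfolding V_def dset_Collect by (intro dfn_rules dtm_fun1[OF g])
    have pos: "0 < v" if "v \<in> V" for v using that gQ by (auto simp: V_def)
    have "finite V"
    proof (rule ccontr)
      assume "infinite V"
      then obtain r s where rs: "r < s" "{r<..<s} \<subseteq> V" using infinite_interval[OF dV] by blast
      obtain m where m: "r < m" "m < s" using dense[OF rs(1)] by blast
      have "m \<in> V" using rs m by auto
      then have "finite (g ` A m)" using fin[of m] pos by auto
      \<comment> \<open>Values above m are taken only on \<open>A m\<close>, so an interval of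
        values would be covered by the image of a finite set.\<close>
      moreover have "{m<..<s} \<subseteq> g ` A m"
      proof
        fix v assume v: "v \<in> {m<..<s}"
        then have "v \<in> V" using rs m by auto
        then show "v \<in> g ` A m" using v by (auto simp: V_def A_def)
      qed
      ultimately show False using infinite_Ioo[OF m(2)] finite_subset by blast
    qed
    moreover obtain x0 where "a < x0" "x0 < b" using dense[OF assms(2)] by blast
    then have "g x0 \<in> V" by (auto simp: V_def)
    ultimately have Min: "Min V \<in> V" "\<And>v. v \<in> V \<Longrightarrow> Min V \<le> v"
      using Min_in[of V] Min_le[of V] by blast+
    have "g x \<in> V" if "a < x" "x < b" for x using that by (auto simp: V_def)
    then have "{a<..<b} \<subseteq> A (Min V)" using Min(2) by (auto simp: A_def)
    then show False using fin[OF pos[OF Min(1)]] infinite_Ioo[OF assms(2)] finite_subset by blast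
  qed
  then obtain \<delta> where \<delta>: "\<delta> > 0" "infinite (A \<delta>)" by blast
  then obtain c d where cd: "c < d" "{c<..<d} \<subseteq> A \<delta>" using infinite_interval[OF dA] by blast
  moreover have "A \<delta> \<subseteq> {a<..<b}" by (auto simp: A_def)
  ultimately have "a \<le> c" "d \<le> b" using greaterThanLessThan_subseteq_greaterThanLessThan[of c d a b] by auto
  moreover have "Q x \<delta>" if "c < x" "x < d" for x
    using cd(2) that gQ[of x] mono[of x "g x" \<delta>] \<delta>(1) by (auto simp: A_def subset_iff)
  ultimately show ?thesis using that cd(1) \<delta>(1) by blast
qed

text \<open>Once the relation holds on a right neighbourhood of uniform radius \<delta>, the
  interval is cut to length at most \<delta>. A condition on germs thereby becomes one on all pairs
  x < y.\<close>

lemma uniform_germ_relation: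
  assumes R: "dfn M (\<lambda>e. R (e 0) (e 1))" and f: "dfun1 M f" and "a < b"
    and germ: "\<And>x. a < x \<Longrightarrow> x < b \<Longrightarrow> rgerm {y. R (f x) (f y)} x"
  obtains c d where "a \<le> c" "c < d" "d \<le> b"
    "\<And>x y. c < x \<Longrightarrow> x < y \<Longrightarrow> y < d \<Longrightarrow> R (f x) (f y)"
proof -
  define Q where "Q x \<epsilon> \<longleftrightarrow> (\<forall>y. x < y \<and> y < x + \<epsilon> \<longrightarrow> R (f x) (f y))" for x \<epsilon>
  have "dfn M (\<lambda>e. Q (e 0) (e 1))" unfolding Q_def by (intro dfn_rules dfn_rel2[OF R] dtm_fun1[OF f])
  moreover have "\<exists>\<epsilon>>0. Q x \<epsilon>" if x: "a < x" "x < b" for x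
  proof -
    obtain z where "x < z" "{x<..<z} \<subseteq> {y. R (f x) (f y)}" using germ[OF x] unfolding rgerm_def by blast
    then show ?thesis unfolding Q_def by (intro exI[of _ "z - x"]) auto
  qed
  moreover have "Q x \<epsilon>'" if "Q x \<epsilon>" "0 < \<epsilon>'" "\<epsilon>' \<le> \<epsilon>" for x \<epsilon> \<epsilon>'
    using that unfolding Q_def by (meson add_left_mono less_le_trans)
  ultimately obtain c d \<delta> where cd: "a \<le> c" "c < d" "d \<le> b" "\<delta> > 0" "\<And>x. c < x \<Longrightarrow> x < d \<Longrightarrow> Q x \<delta>"
    using uniform_radius[of Q a b] \<open>a < b\<close> by blast
  have "R (f x) (f y)" if "c < x" "x < y" "y < min d (c + \<delta>)" for x y
  proof -
    have "y < x + \<delta>" using that by auto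
    then show ?thesis using cd(5)[of x] that unfolding Q_def by auto
  qed
  then show ?thesis using that[of c "min d (c + \<delta>)"] cd by auto
qed

text \<open>Along the right germ at x exactly one of f x < f y, f x = f y, f x > f y holds. Which of
  them it is depends definably on x, so it is the same one throughout a subinterval, where
  \<open>uniform_germ_relation\<close> applies.\<close>

lemma strictly_monotone_subinterval:
  assumes f: "dfun1 M f" and "a < b"
  obtains c d where "a \<le> c" "c < d" "d \<le> b"
    "(\<forall>x y. c < x \<and> x < y \<and> y < d \<longrightarrow> f x < f y) \<or> (\<forall>x y. c < x \<and> x < y \<and> y < d \<longrightarrow> f x = f y) \<or>
     (\<forall>x y. c < x \<and> x < y \<and> y < d \<longrightarrow> f y < f x)"
proof -
  define A1 where "A1 = {x. rgerm {y. f x < f y} x}"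
  define A2 where "A2 = {x. rgerm {y. f x = f y} x}"
  have d: "dset A1" "dset A2" unfolding A1_def A2_def dset_Collect
    by (intro dfn_rgerm dfn_rules dtm_fun1[OF f])+
  have dR: "dset {y. f x < f y}" "dset {y. f x = f y}" for x
    unfolding dset_Collect by (intro dfn_rules dtm_fun1[OF f])+
  obtain a1 b1 where 1: "a \<le> a1" "a1 < b1" "b1 \<le> b" "{a1<..<b1} \<subseteq> A1 \<or> {a1<..<b1} \<subseteq> - A1"
    using subinterval_cases[OF d(1) assms(2)] .
  obtain a2 b2 where 2: "a1 \<le> a2" "a2 < b2" "b2 \<le> b1" "{a2<..<b2} \<subseteq> A2 \<or> {a2<..<b2} \<subseteq> - A2"
    using subinterval_cases[OF d(2) 1(2)] .
  have sub: "{a2<..<b2} \<subseteq> {a1<..<b1}" using 2 by auto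
  have ab: "a \<le> a2" "b2 \<le> b" using 1 2 by auto
  consider "{a2<..<b2} \<subseteq> A1" | "{a2<..<b2} \<subseteq> A2" | "{a2<..<b2} \<subseteq> - A1 \<inter> - A2"
    using 1(4) 2(4) sub by blast
  then show ?thesis
  proof cases
    case 1
    then have germ: "rgerm {y. f x < f y} x" if "a2 < x" "x < b2" for x using that by (auto simp: A1_def)
    obtain c d where "a2 \<le> c" "c < d" "d \<le> b2" "\<And>x y. c < x \<Longrightarrow> x < y \<Longrightarrow> y < d \<Longrightarrow> f x < f y"
      by (rule uniform_germ_relation[of "(<)", OF dfn_less[OF dtm_var dtm_var] f 2(2)]) (erule (1) germ, rule that)
    then show ?thesis using that[of c d] ab by auto
  next
    case 2
    then have germ: "rgerm {y. f x = f y} x" if "a2 < x" "x < b2" for x using that by (auto simp: A2_def)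
    obtain c d where "a2 \<le> c" "c < d" "d \<le> b2" "\<And>x y. c < x \<Longrightarrow> x < y \<Longrightarrow> y < d \<Longrightarrow> f x = f y"
      by (rule uniform_germ_relation[of "(=)", OF dfn_eq[OF dtm_var dtm_var] f \<open>a2 < b2\<close>]) (erule (1) germ, rule that)
    then show ?thesis using that[of c d] ab by auto
  next
    case 3
    have germ: "rgerm {y. f y < f x} x" if "a2 < x" "x < b2" for x
    proof -
      have "\<not> rgerm {y. f x < f y} x" "\<not> rgerm {y. f x = f y} x"
        using 3 that by (auto simp: A1_def A2_def)
      then have "rgerm (- {y. f x < f y} \<inter> - {y. f x = f y}) x"
        using germ_compl(1)[OF dR(1)] germ_compl(1)[OF dR(2)] rgerm_Int by blast
      moreover have "- {y. f x < f y} \<inter> - {y. f x = f y} = {y. f y < f x}" by auto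
      ultimately show ?thesis by simp
    qed
    obtain c d where "a2 \<le> c" "c < d" "d \<le> b2" "\<And>x y. c < x \<Longrightarrow> x < y \<Longrightarrow> y < d \<Longrightarrow> f y < f x"
      by (rule uniform_germ_relation[of "(>)", OF dfn_less[OF dtm_var dtm_var] f \<open>a2 < b2\<close>]) (erule (1) germ, rule that)
    then show ?thesis using that[of c d] ab by auto
  qed
qed

text \<open>The \<epsilon>-\<delta> form is first-order, so the continuity points of a definable
  function form a definable set.\<close>

definition cont_at :: "('a \<Rightarrow> 'a) \<Rightarrow> 'a \<Rightarrow> bool" where
  "cont_at f x \<longleftrightarrow> (\<forall>\<epsilon>>0. \<exists>\<delta>>0. \<forall>y. \<bar>y - x\<bar> < \<delta> \<longrightarrow> \<bar>f y - f x\<bar> < \<epsilon>)"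

lemma cont_atD: "cont_at f x \<Longrightarrow> 0 < \<epsilon> \<Longrightarrow> \<exists>\<delta>>0. \<forall>y. \<bar>y - x\<bar> < \<delta> \<longrightarrow> \<bar>f y - f x\<bar> < \<epsilon>"
  unfolding cont_at_def by blast

lemma cont_at_uminus: "cont_at (\<lambda>x. - f x) x \<longleftrightarrow> cont_at f x"
proof -
  have "\<bar>- f y - - f x\<bar> = \<bar>f y - f x\<bar>" for y using abs_minus_commute[of "f y"] by simp
  then show ?thesis by (simp add: cont_at_def)
qed

text \<open>An increasing function is injective, so its values contain an interval. Between two
  points u < v whose values lie in that interval all intermediate values are attained, which
  excludes jumps.\<close>

lemma cont_at_increasing:
  assumes f: "dfun1 M f" and "a < b"
    and inc: "\<And>x y. a < x \<Longrightarrow> x < y \<Longrightarrow> y < b \<Longrightarrow> f x < f y"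
  obtains c d where "a \<le> c" "c < d" "d \<le> b" "\<And>x. c < x \<Longrightarrow> x < d \<Longrightarrow> cont_at f x"
proof -
  define V where "V = {v. \<exists>x. a < x \<and> x < b \<and> v = f x}"
  have dV: "dset V" unfolding V_def dset_Collect by (intro dfn_rules dtm_fun1[OF f])
  have lt: "f x < f y \<longleftrightarrow> x < y" if "a < x" "x < b" "a < y" "y < b" for x y
    using inc[of x y] inc[of y x] that by (cases x y rule: linorder_cases) auto
  have "inj_on f {a<..<b}"
    unfolding inj_on_def using lt by (metis greaterThanLessThan_iff less_irrefl linorder_neqE)
  moreover have "f ` {a<..<b} = V" by (auto simp: V_def)
  ultimately have "infinite V" using infinite_Ioo[OF assms(2)] finite_image_iff by blast
  then obtain r s where rs: "r < s" "{r<..<s} \<subseteq> V" using infinite_interval[OF dV] by blast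
  obtain r' where r': "r < r'" "r' < s" using dense[OF rs(1)] by blast
  obtain s' where s': "r' < s'" "s' < s" using dense[OF r'(2)] by blast
  have "r' \<in> V" "s' \<in> V" using rs r' s' by auto
  then obtain u v where uv: "a < u" "u < b" "a < v" "v < b" "r' = f u" "s' = f v" by (auto simp: V_def)
  have "u < v" using lt s' uv by auto
  moreover have "cont_at f x" if x: "u < x" "x < v" for x
    unfolding cont_at_def
  proof (intro allI impI)
    fix \<epsilon> :: 'a assume "0 < \<epsilon>"
    have xb: "a < x" "x < b" using x uv by auto
    have fx: "f u < f x" "f x < f v" using lt x uv xb by auto
    obtain y1 where y1: "max (f u) (f x - \<epsilon>) < y1" "y1 < f x"
      using dense[of "max (f u) (f x - \<epsilon>)" "f x"] fx \<open>0 < \<epsilon>\<close> by auto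
    obtain y2 where y2: "f x < y2" "y2 < min (f v) (f x + \<epsilon>)"
      using dense[of "f x" "min (f v) (f x + \<epsilon>)"] fx \<open>0 < \<epsilon>\<close> by auto
    have "y1 \<in> V" "y2 \<in> V" using rs r' s' uv fx y1 y2 by auto
    then obtain x1 x2 where x12: "a < x1" "x1 < b" "a < x2" "x2 < b" "y1 = f x1" "y2 = f x2"
      by (auto simp: V_def)
    have 12: "x1 < x" "x < x2" using lt x12 xb y1 y2 by auto
    show "\<exists>\<delta>>0. \<forall>y. \<bar>y - x\<bar> < \<delta> \<longrightarrow> \<bar>f y - f x\<bar> < \<epsilon>"
    proof (intro exI[of _ "min (x - x1) (x2 - x)"] conjI allI impI)
      fix y assume "\<bar>y - x\<bar> < min (x - x1) (x2 - x)"
      then have y: "x1 < y" "y < x2" by (auto simp: abs_less_iff)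
      then have "f x1 < f y" "f y < f x2" using lt x12 by auto
      then show "\<bar>f y - f x\<bar> < \<epsilon>" using y1 y2 x12 by (auto simp: abs_less_iff algebra_simps)
    qed (use 12 in auto)
  qed
  ultimately show ?thesis using that[of u v] uv by auto
qed

text \<open>The last property below is monotonicity without regard to the direction.\<close>

theorem monotonicity:
  assumes f: "dfun1 M f" and "a < b"
  obtains c d where "a \<le> c" "c < d" "d \<le> b" "\<And>x. c < x \<Longrightarrow> x < d \<Longrightarrow> cont_at f x"
    "\<And>x y z. c < x \<Longrightarrow> x \<le> y \<Longrightarrow> y \<le> z \<Longrightarrow> z < d \<Longrightarrow>
       f x \<le> f y \<and> f y \<le> f z \<or> f z \<le> f y \<and> f y \<le> f x"
proof -
  obtain c d where cd: "a \<le> c" "c < d" "d \<le> b"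
    "(\<forall>x y. c < x \<and> x < y \<and> y < d \<longrightarrow> f x < f y) \<or> (\<forall>x y. c < x \<and> x < y \<and> y < d \<longrightarrow> f x = f y) \<or>
     (\<forall>x y. c < x \<and> x < y \<and> y < d \<longrightarrow> f y < f x)"
    using strictly_monotone_subinterval[OF assms] by blast
  then consider "\<And>x y. c < x \<Longrightarrow> x < y \<Longrightarrow> y < d \<Longrightarrow> f x < f y"
    | "\<And>x y. c < x \<Longrightarrow> x < y \<Longrightarrow> y < d \<Longrightarrow> f x = f y"
    | "\<And>x y. c < x \<Longrightarrow> x < y \<Longrightarrow> y < d \<Longrightarrow> f y < f x" by blast
  then show ?thesis
  proof cases
    case 1
    obtain c' d' where c': "c \<le> c'" "c' < d'" "d' \<le> d" "\<And>x. c' < x \<Longrightarrow> x < d' \<Longrightarrow> cont_at f x"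
      using cont_at_increasing[OF f cd(2) 1] by blast
    have le: "f x \<le> f y" if "c' < x" "x \<le> y" "y < d'" for x y
      using 1[of x y] c' that by (cases "x = y") auto
    have "f x \<le> f y \<and> f y \<le> f z" if "c' < x" "x \<le> y" "y \<le> z" "z < d'" for x y z
      using le[of x y] le[of y z] that by auto
    then show ?thesis using c' cd by (intro that[of c' d']) auto
  next
    case 2
    have eq: "f x = f y" if "c < x" "c < y" "x < d" "y < d" for x y
      using that by (metis 2 linorder_neqE)
    have "cont_at f x" if x: "c < x" "x < d" for x
      unfolding cont_at_def
    proof (intro allI impI exI[of _ "min (x - c) (d - x)"] conjI)
      fix \<epsilon> y :: 'a assume "0 < \<epsilon>" "\<bar>y - x\<bar> < min (x - c) (d - x)"
      then show "\<bar>f y - f x\<bar> < \<epsilon>" using eq[of x y] x by (auto simp: abs_less_iff)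
    qed (use x in auto)
    moreover have "f x \<le> f y \<and> f y \<le> f z" if "c < x" "x \<le> y" "y \<le> z" "z < d" for x y z
      using eq[of x y] eq[of y z] that by auto
    ultimately show ?thesis using that[of c d] cd by blast
  next
    case 3
    have "dfun1 M (\<lambda>x. - f x)" unfolding dfun1_def by (intro dfn_rules dtm_fun1[OF f])
    then obtain c' d' where "c \<le> c'" "c' < d'" "d' \<le> d" "\<And>x. c' < x \<Longrightarrow> x < d' \<Longrightarrow> cont_at (\<lambda>x. - f x) x"
      using cont_at_increasing[of "\<lambda>x. - f x" c d] cd(2) 3 by (metis neg_less_iff_less)
    then have c': "c \<le> c'" "c' < d'" "d' \<le> d" "\<And>x. c' < x \<Longrightarrow> x < d' \<Longrightarrow> cont_at f x"
      unfolding cont_at_uminus by blast+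
    have le: "f y \<le> f x" if "c' < x" "x \<le> y" "y < d'" for x y
      using 3[of x y] c' that by (cases "x = y") auto
    have "f z \<le> f y \<and> f y \<le> f x" if "c' < x" "x \<le> y" "y \<le> z" "z < d'" for x y z
      using le[of x y] le[of y z] that by auto
    then show ?thesis using c' cd by (intro that[of c' d']) auto
  qed
qed

lemma continuous_subinterval:
  assumes "dfun1 M f" "a < b"
  obtains c d where "a \<le> c" "c < d" "d \<le> b" "\<And>x. c < x \<Longrightarrow> x < d \<Longrightarrow> cont_at f x"
  by (rule monotonicity[OF assms]) (use that in simp)

lemma common_continuity_interval:
  assumes "finite A" "\<And>i. i \<in> A \<Longrightarrow> dfun1 M (f i)" "a < b"
  obtains c d where "a \<le> c" "c < d" "d \<le> b" "\<And>x i. i \<in> A \<Longrightarrow> c < x \<Longrightarrow> x < d \<Longrightarrow> cont_at (f i) x"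
  using assms
proof (induction A arbitrary: thesis)
  case empty
  then show ?case by blast
next
  case (insert i A)
  obtain c d where cd: "a \<le> c" "c < d" "d \<le> b" "\<And>x i. i \<in> A \<Longrightarrow> c < x \<Longrightarrow> x < d \<Longrightarrow> cont_at (f i) x"
    using insert.IH insert.prems(2,3) by blast
  obtain c' d' where c': "c \<le> c'" "c' < d'" "d' \<le> d" "\<And>x. c' < x \<Longrightarrow> x < d' \<Longrightarrow> cont_at (f i) x"
    using continuous_subinterval[of "f i" c d] insert.prems(2) cd(2) by blast
  have "cont_at (f j) x" if "j \<in> insert i A" "c' < x" "x < d'" for j x
    using that cd(4)[of j x] c' by auto
  then show ?case using insert.prems(1)[of c' d'] cd c' by auto
qed

subsection \<open>Functions of two variables\<close>

text \<open>The endpoints of the intervals are chosen definably, the lower one first and the upper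
  one depending on it. Near a common continuity point t0 of both choices, an interval strictly
  inside the one at t0 stays inside all the others.\<close>

lemma uniform_box:
  assumes Q: "dfn M (\<lambda>e. Q (e 0) (e 1) (e 2))" and "a < b"
    and ex: "\<And>t. a < t \<Longrightarrow> t < b \<Longrightarrow> \<exists>c d. c < d \<and> Q t c d"
    and mono: "\<And>t c d c' d'. Q t c d \<Longrightarrow> c \<le> c' \<Longrightarrow> c' < d' \<Longrightarrow> d' \<le> d \<Longrightarrow> Q t c' d'"
  obtains a' b' p' q' where "a \<le> a'" "a' < b'" "b' \<le> b" "p' < q'"
    "\<And>t. a' < t \<Longrightarrow> t < b' \<Longrightarrow> Q t p' q'"
proof -
  note Qr = dfn_rel3[OF Q]
  define lo where "lo t = skolem {c. \<exists>d. c < d \<and> Q t c d}" for t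
  have lo: "dfun1 M lo" unfolding dfun1_def lo_def by (intro dtm_skolem dfn_rules Qr)
  define hi where "hi t = skolem {d. lo t < d \<and> Q t (lo t) d}" for t
  have hi: "dfun1 M hi" unfolding dfun1_def hi_def by (intro dtm_skolem dfn_rules Qr dtm_fun1[OF lo])
  have lohi: "lo t < hi t \<and> Q t (lo t) (hi t)" if "a < t" "t < b" for t
  proof -
    have "dset {c. \<exists>d. c < d \<and> Q t c d}"
      unfolding dset_Collect by (intro dfn_rules Qr)
    then have "\<exists>d. lo t < d \<and> Q t (lo t) d"
      using skolem_in[of "{c. \<exists>d. c < d \<and> Q t c d}"] ex[OF that] unfolding lo_def by blast
    moreover have "dset {d. lo t < d \<and> Q t (lo t) d}"
      unfolding dset_Collect by (intro dfn_rules Qr)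
    ultimately show ?thesis
      using skolem_in[of "{d. lo t < d \<and> Q t (lo t) d}"] unfolding hi_def by blast
  qed
  obtain a1 b1 where 1: "a \<le> a1" "a1 < b1" "b1 \<le> b" "\<And>x. a1 < x \<Longrightarrow> x < b1 \<Longrightarrow> cont_at lo x"
    by (rule continuous_subinterval[OF lo \<open>a < b\<close>]) (rule that)
  obtain a2 b2 where 2: "a1 \<le> a2" "a2 < b2" "b2 \<le> b1" "\<And>x. a2 < x \<Longrightarrow> x < b2 \<Longrightarrow> cont_at hi x"
    by (rule continuous_subinterval[OF hi 1(2)]) (rule that)
  obtain t0 where t0: "a2 < t0" "t0 < b2" using dense[OF 2(2)] by blast
  have t0': "a < t0" "t0 < b" "a1 < t0" "t0 < b1" using t0 1 2 by auto
  obtain p' where p': "lo t0 < p'" "p' < hi t0" using dense[of "lo t0" "hi t0"] lohi[OF t0'(1,2)] by blast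
  obtain q' where q': "p' < q'" "q' < hi t0" using dense[OF p'(2)] by blast
  obtain \<delta>1 where \<delta>1: "\<delta>1 > 0" "\<And>t. \<bar>t - t0\<bar> < \<delta>1 \<Longrightarrow> \<bar>lo t - lo t0\<bar> < p' - lo t0"
    using cont_atD[OF 1(4)[OF t0'(3,4)], of "p' - lo t0"] p' by auto
  obtain \<delta>2 where \<delta>2: "\<delta>2 > 0" "\<And>t. \<bar>t - t0\<bar> < \<delta>2 \<Longrightarrow> \<bar>hi t - hi t0\<bar> < hi t0 - q'"
    using cont_atD[OF 2(4)[OF t0(1,2)], of "hi t0 - q'"] q' by auto
  define a' where "a' = Max {a, t0 - \<delta>1, t0 - \<delta>2}"
  define b' where "b' = Min {b, t0 + \<delta>1, t0 + \<delta>2}"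
  have "a \<le> a'" "a' < t0" "t0 < b'" "b' \<le> b" using t0' \<delta>1 \<delta>2 by (auto simp: a'_def b'_def)
  moreover have "Q t p' q'" if "a' < t" "t < b'" for t
  proof -
    have "\<bar>t - t0\<bar> < \<delta>1" "\<bar>t - t0\<bar> < \<delta>2" "a < t" "t < b"
      using that by (auto simp: a'_def b'_def abs_less_iff)
    then have "lo t \<le> p'" "q' \<le> hi t" using \<delta>1(2)[of t] \<delta>2(2)[of t] by (auto simp: abs_less_iff)
    then show ?thesis using mono[of t "lo t" "hi t"] lohi[of t] q' \<open>a < t\<close> \<open>t < b\<close> by blast
  qed
  ultimately show ?thesis using that[of a' b' p' q'] q'(1) by auto
qed

definition cont2_at :: "('a \<Rightarrow> 'a \<Rightarrow> 'a) \<Rightarrow> 'a \<Rightarrow> 'a \<Rightarrow> bool" where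
  "cont2_at f t s \<longleftrightarrow>
    (\<forall>\<epsilon>>0. \<exists>\<delta>>0. \<forall>t' s'. \<bar>t' - t\<bar> < \<delta> \<and> \<bar>s' - s\<bar> < \<delta> \<longrightarrow> \<bar>f t' s' - f t s\<bar> < \<epsilon>)"

text \<open>Separate continuity does not suffice; monotonicity in the first variable traps f t' s'
  between f t1 s' and f t2 s', and both are close to f t s by continuity in the second variable at
  t1 and t2. The direction of monotonicity may vary with s', hence its direction-free form.\<close>

theorem continuity_on_box:
  assumes f: "dfun2 M f" and "a < b" "p < q"
  obtains a' b' p' q' where "a \<le> a'" "a' < b'" "b' \<le> b" "p \<le> p'" "p' < q'" "q' \<le> q"
    "\<And>t s. a' < t \<Longrightarrow> t < b' \<Longrightarrow> p' < s \<Longrightarrow> s < q' \<Longrightarrow> cont2_at f t s"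
proof -
  note fr = dtm_fun2[OF f]
  define Q1 where "Q1 t c d \<longleftrightarrow> p \<le> c \<and> d \<le> q \<and> (\<forall>s. c < s \<and> s < d \<longrightarrow> cont_at (f t) s)" for t c d
  have "dfn M (\<lambda>e. Q1 (e 0) (e 1) (e 2))"
    unfolding Q1_def cont_at_def by (intro dfn_rules fr)
  moreover have "\<exists>c d. c < d \<and> Q1 t c d" for t
  proof -
    have "dfun1 M (f t)" unfolding dfun1_def by (intro dfn_rules fr)
    then obtain c d where "p \<le> c" "c < d" "d \<le> q" "\<And>x. c < x \<Longrightarrow> x < d \<Longrightarrow> cont_at (f t) x"
      using continuous_subinterval[of "f t" p q] assms(3) by blast
    then show ?thesis unfolding Q1_def by blast
  qed
  moreover have "Q1 t c' d'" if "Q1 t c d" "c \<le> c'" "c' < d'" "d' \<le> d" for t c d c' d'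
    using that unfolding Q1_def by (meson le_less_trans less_le_trans order_trans)
  ultimately obtain a1 b1 p1 q1 where 0: "a \<le> a1" "a1 < b1" "b1 \<le> b" "p1 < q1"
    "\<And>t. a1 < t \<Longrightarrow> t < b1 \<Longrightarrow> Q1 t p1 q1"
    using uniform_box[of Q1 a b] \<open>a < b\<close> by blast
  have "p \<le> p1" "q1 \<le> q" using 0(5) dense[OF 0(2)] unfolding Q1_def by blast+
  note 1 = 0(1-3) \<open>p \<le> p1\<close> 0(4) \<open>q1 \<le> q\<close> 0(5)
  define Q2 where "Q2 s c d \<longleftrightarrow> a1 \<le> c \<and> d \<le> b1 \<and> (\<forall>x. c < x \<and> x < d \<longrightarrow> cont_at (\<lambda>t. f t s) x) \<and>
    (\<forall>x y z. c < x \<and> x \<le> y \<and> y \<le> z \<and> z < d \<longrightarrow>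
      f x s \<le> f y s \<and> f y s \<le> f z s \<or> f z s \<le> f y s \<and> f y s \<le> f x s)" for s c d
  have "dfn M (\<lambda>e. Q2 (e 0) (e 1) (e 2))"
    unfolding Q2_def cont_at_def by (intro dfn_rules fr)
  moreover have "\<exists>c d. c < d \<and> Q2 s c d" for s
  proof -
    have "dfun1 M (\<lambda>t. f t s)" unfolding dfun1_def by (intro dfn_rules fr)
    then obtain c d where "a1 \<le> c" "c < d" "d \<le> b1" "\<And>x. c < x \<Longrightarrow> x < d \<Longrightarrow> cont_at (\<lambda>t. f t s) x"
      "\<And>x y z. c < x \<Longrightarrow> x \<le> y \<Longrightarrow> y \<le> z \<Longrightarrow> z < d \<Longrightarrow>
         f x s \<le> f y s \<and> f y s \<le> f z s \<or> f z s \<le> f y s \<and> f y s \<le> f x s"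
      by (rule monotonicity[OF _ 1(2)]) (rule that)
    then show ?thesis unfolding Q2_def by blast
  qed
  moreover have "Q2 s c' d'" if "Q2 s c d" "c \<le> c'" "c' < d'" "d' \<le> d" for s c d c' d'
    using that unfolding Q2_def by (meson le_less_trans less_le_trans order_trans)
  ultimately obtain p2 q2 a2 b2 where 0: "p1 \<le> p2" "p2 < q2" "q2 \<le> q1" "a2 < b2"
    "\<And>s. p2 < s \<Longrightarrow> s < q2 \<Longrightarrow> Q2 s a2 b2"
    using uniform_box[of Q2 p1 q1] 1(5) by blast
  have "a1 \<le> a2" "b2 \<le> b1" using 0(5) dense[OF 0(2)] unfolding Q2_def by blast+
  note 2 = 0(1-3) \<open>a1 \<le> a2\<close> 0(4) \<open>b2 \<le> b1\<close> 0(5)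
  have "cont2_at f t s" if ts: "a2 < t" "t < b2" "p2 < s" "s < q2" for t s
    unfolding cont2_at_def
  proof (intro allI impI)
    fix \<epsilon> :: 'a assume "0 < \<epsilon>"
    then have \<epsilon>: "0 < \<epsilon> / 2" by simp
    have ct: "cont_at (\<lambda>t. f t s) t" using 2(7)[OF ts(3,4)] ts unfolding Q2_def by blast
    obtain \<delta> where \<delta>: "\<delta> > 0" "\<And>x. \<bar>x - t\<bar> < \<delta> \<Longrightarrow> \<bar>f x s - f t s\<bar> < \<epsilon> / 2"
      using cont_atD[OF ct \<epsilon>] by blast
    obtain t1 where t1: "max a2 (t - \<delta>) < t1" "t1 < t" using dense[of "max a2 (t - \<delta>)" t] ts \<delta> by auto
    obtain t2 where t2: "t < t2" "t2 < min b2 (t + \<delta>)" using dense[of t "min b2 (t + \<delta>)"] ts \<delta> by auto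
    have "a1 < t1" "t1 < b1" "a1 < t2" "t2 < b1" "p1 < s" "s < q1" using t1 t2 ts 2 by auto
    then have c12: "cont_at (f t1) s" "cont_at (f t2) s" using 1(7) unfolding Q1_def by auto
    obtain \<delta>1 where \<delta>1: "\<delta>1 > 0" "\<And>y. \<bar>y - s\<bar> < \<delta>1 \<Longrightarrow> \<bar>f t1 y - f t1 s\<bar> < \<epsilon> / 2"
      using cont_atD[OF c12(1) \<epsilon>] by blast
    obtain \<delta>2 where \<delta>2: "\<delta>2 > 0" "\<And>y. \<bar>y - s\<bar> < \<delta>2 \<Longrightarrow> \<bar>f t2 y - f t2 s\<bar> < \<epsilon> / 2"
      using cont_atD[OF c12(2) \<epsilon>] by blast
    define \<eta> where "\<eta> = Min {\<delta>1, \<delta>2, s - p2, q2 - s, t - t1, t2 - t}"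
    have "\<eta> > 0" using \<delta>1(1) \<delta>2(1) ts t1(2) t2(1)      unfolding \<eta>_def by (subst Min_gr_iff) simp_all
    have \<eta>: "\<eta> \<le> \<delta>1" "\<eta> \<le> \<delta>2" "\<eta> \<le> s - p2" "\<eta> \<le> q2 - s" "\<eta> \<le> t - t1" "\<eta> \<le> t2 - t"
      unfolding \<eta>_def by (intro Min_le; simp)+
    note \<open>\<eta> > 0\<close>
    moreover have "\<bar>f t' s' - f t s\<bar> < \<epsilon>" if "\<bar>t' - t\<bar> < \<eta>" "\<bar>s' - s\<bar> < \<eta>" for t' s'
    proof -
      have s': "\<bar>s' - s\<bar> < \<delta>1" "\<bar>s' - s\<bar> < \<delta>2" "p2 < s'" "s' < q2"
        and t': "t1 < t'" "t' < t2"
        using that \<eta> by linarith+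
      have "\<bar>t1 - t\<bar> < \<delta>" "\<bar>t2 - t\<bar> < \<delta>" using t1 t2 by linarith+
      then have "\<bar>f t1 s - f t s\<bar> < \<epsilon> / 2" "\<bar>f t2 s - f t s\<bar> < \<epsilon> / 2" using \<delta>(2) by auto
      then have "\<bar>f t1 s' - f t s\<bar> < \<epsilon>" "\<bar>f t2 s' - f t s\<bar> < \<epsilon>"
        using \<delta>1(2)[OF s'(1)] \<delta>2(2)[OF s'(2)] by linarith+
      moreover have "f t1 s' \<le> f t' s' \<and> f t' s' \<le> f t2 s' \<or> f t2 s' \<le> f t' s' \<and> f t' s' \<le> f t1 s'"
        using 2(7)[OF s'(3,4)] t' t1 t2 unfolding Q2_def by auto
      ultimately show ?thesis by linarith
    qed
    ultimately show "\<exists>\<delta>>0. \<forall>t' s'. \<bar>t' - t\<bar> < \<delta> \<and> \<bar>s' - s\<bar> < \<delta> \<longrightarrow> \<bar>f t' s' - f t s\<bar> < \<epsilon>" by blast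
  qed
  then show ?thesis using that[of a2 b2 p2 q2] 1 2 by auto
qed

end

section \<open>Uniform finiteness in the plane\<close>

text \<open>The pointwise hypothesis already covers all smaller positive values, so the minimum of
  finitely many bounds serves every point at once.\<close>

lemma finite_uniform_bound:
  fixes P :: "'b \<Rightarrow> 'a::linordered_field \<Rightarrow> bool"
  assumes "finite A" "\<And>x. x \<in> A \<Longrightarrow> \<exists>d>0. \<forall>\<eta>. 0 < \<eta> \<and> \<eta> \<le> d \<longrightarrow> P x \<eta>"
  obtains d where "d > 0" "\<And>x \<eta>. x \<in> A \<Longrightarrow> 0 < \<eta> \<Longrightarrow> \<eta> \<le> d \<Longrightarrow> P x \<eta>"
  using assms
proof (induction A arbitrary: thesis)
  case empty
  show ?case by (rule empty(1)[of 1]) auto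
next
  case (insert x A)
  obtain d where d: "d > 0" "\<And>x \<eta>. x \<in> A \<Longrightarrow> 0 < \<eta> \<Longrightarrow> \<eta> \<le> d \<Longrightarrow> P x \<eta>"
    using insert.IH insert.prems(2) by blast
  obtain d' where d': "d' > 0" "\<And>\<eta>. 0 < \<eta> \<Longrightarrow> \<eta> \<le> d' \<Longrightarrow> P x \<eta>"
    using insert.prems(2)[of x] by blast
  show ?case by (rule insert.prems(1)[of "min d d'"]) (use d d' in auto)
qed

context o_minimal_field
begin

text \<open>A substitute for compactness of the unit interval: a definable selection h from the
  fibres converges along the right germ at t0. Its limit L is the supremum of the values that h
  exceeds on that germ.\<close>

lemma accumulation_right:
  assumes Y: "dfn M (\<lambda>e. Y (e 0) (e 1))" and bd: "\<And>t s. Y t s \<Longrightarrow> 0 \<le> s \<and> s \<le> 1"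
    and germ: "rgerm {t. \<exists>s. Y t s} t0"
  obtains L where "0 \<le> L" "L \<le> 1" "\<And>\<eta>. \<eta> > 0 \<Longrightarrow> rgerm {t. \<exists>s. Y t s \<and> \<bar>s - L\<bar> < \<eta>} t0"
proof -
  note Yr = dfn_rel2[OF Y]
  define h where "h t = skolem {s. Y t s}" for t
  have h: "dfun1 M h" unfolding dfun1_def h_def by (intro dtm_skolem dfn_rules Yr)
  note hr = dtm_fun1[OF h]
  have Yh: "Y t (h t)" if "Y t s" for t s
  proof -
    have "dset {s. Y t s}" unfolding dset_Collect by (intro dfn_rules Yr)
    then show ?thesis using skolem_in[of "{s. Y t s}"] that unfolding h_def by blast
  qed
  define D where "D = {t. Y t (h t)}"
  have D: "rgerm D t0" by (rule germ_mono(1)[OF _ germ]) (auto simp: D_def intro: Yh)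
  define S where "S = {s. rgerm {t. Y t (h t) \<and> s < h t} t0}"
  have dS: "dset S" unfolding S_def dset_Collect by (intro dfn_rgerm dfn_rules Yr hr)
  have dY: "dset {t. Y t (h t) \<and> s < h t}" for s unfolding dset_Collect by (intro dfn_rules Yr hr)
  have "-1 \<in> S" unfolding S_def mem_Collect_eq
  proof (rule germ_mono(1)[OF _ D])
    show "D \<subseteq> {t. Y t (h t) \<and> - 1 < h t}"
      using bd unfolding D_def by (force intro: less_le_trans[of _ 0])
  qed
  moreover have "s \<le> 1" if "s \<in> S" for s
  proof (rule ccontr)
    assume "\<not> s \<le> 1"
    then have "{t. Y t (h t) \<and> s < h t} = {}" using bd by force
    moreover have "rgerm {t. Y t (h t) \<and> s < h t} t0" using that unfolding S_def mem_Collect_eq .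
    ultimately show False using germ_nonempty(1)[of t0] by (simp only:)
  qed
  ultimately obtain L where L: "is_lub S L" using lub_exists[OF dS, of 1] by blast
  have near: "rgerm {t. Y t (h t) \<and> \<bar>h t - L\<bar> < \<eta>} t0" if pos: "\<eta> > 0" for \<eta>
  proof -
    obtain s where s: "s \<in> S" "L - \<eta> < s" using lub_approx[OF L, of "L - \<eta>"] pos by auto
    have "L + \<eta> / 2 \<notin> S" using lub_upper[OF L, of "L + \<eta> / 2"] that by auto
    then have "rgerm (- {t. Y t (h t) \<and> L + \<eta> / 2 < h t}) t0"
      unfolding S_def mem_Collect_eq using germ_compl(1)[OF dY] by blast
    then have "rgerm (- {t. Y t (h t) \<and> L + \<eta> / 2 < h t} \<inter> {t. Y t (h t) \<and> s < h t}) t0"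
      using s(1) unfolding S_def by (simp add: rgerm_Int)
    moreover have "- {t. Y t (h t) \<and> L + \<eta> / 2 < h t} \<inter> {t. Y t (h t) \<and> s < h t}
        \<subseteq> {t. Y t (h t) \<and> \<bar>h t - L\<bar> < \<eta>}"
    proof
      fix t assume "t \<in> - {t. Y t (h t) \<and> L + \<eta> / 2 < h t} \<inter> {t. Y t (h t) \<and> s < h t}"
      then have *: "Y t (h t)" "h t \<le> L + \<eta> / 2" "s < h t" by auto
      have "\<eta> / 2 < \<eta>" using that by simp
      then have "h t - L < \<eta>" "L - h t < \<eta>" using * s(2) by linarith+
      then show "t \<in> {t. Y t (h t) \<and> \<bar>h t - L\<bar> < \<eta>}" using * by (simp add: abs_less_iff)
    qed
    ultimately show ?thesis using germ_mono(1) by blast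
  qed
  have ex: "\<exists>t. 0 \<le> h t \<and> h t \<le> 1 \<and> \<bar>h t - L\<bar> < \<eta>" if "\<eta> > 0" for \<eta>
  proof -
    have "{t. Y t (h t) \<and> \<bar>h t - L\<bar> < \<eta>} \<noteq> {}"
    proof
      assume "{t. Y t (h t) \<and> \<bar>h t - L\<bar> < \<eta>} = {}"
      with near[OF that] show False using germ_nonempty(1)[of t0] by (simp only:)
    qed
    then show ?thesis using bd by blast
  qed
  have "0 \<le> L"
  proof (rule ccontr)
    assume "\<not> 0 \<le> L"
    then obtain t where "0 \<le> h t" "\<bar>h t - L\<bar> < - L" using ex[of "- L"] by auto
    then show False by (simp add: abs_less_iff)
  qed
  moreover have "L \<le> 1"
  proof (rule ccontr)
    assume "\<not> L \<le> 1"
    then obtain t where "h t \<le> 1" "\<bar>h t - L\<bar> < L - 1" using ex[of "L - 1"] by auto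
    then show False by (simp add: abs_less_iff)
  qed
  moreover have "rgerm {t. \<exists>s. Y t s \<and> \<bar>s - L\<bar> < \<eta>} t0" if "\<eta> > 0" for \<eta>
    by (rule germ_mono(1)[OF _ near[OF that]]) auto
  ultimately show ?thesis using that by blast
qed

text \<open>The parameters with nonempty fibre accumulate at t0, so they contain one of the two
  germs there. The left germ is turned into a right one by the reflection t \<mapsto> - t.\<close>

lemma accumulation_point:
  assumes Y: "dfn M (\<lambda>e. Y (e 0) (e 1))" and bd: "\<And>t s. Y t s \<Longrightarrow> 0 \<le> s \<and> s \<le> 1"
    and acc: "\<And>\<epsilon>. \<epsilon> > 0 \<Longrightarrow> \<exists>t s. t \<noteq> t0 \<and> \<bar>t - t0\<bar> < \<epsilon> \<and> Y t s"
  obtains L where "0 \<le> L" "L \<le> 1"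
    "\<And>\<eta> \<epsilon>. \<eta> > 0 \<Longrightarrow> \<epsilon> > 0 \<Longrightarrow> \<exists>t s. \<bar>t - t0\<bar> < \<epsilon> \<and> \<bar>s - L\<bar> < \<eta> \<and> Y t s"
proof -
  note Yr = dfn_rel2[OF Y]
  define D where "D = {t. \<exists>s. Y t s}"
  have dD: "dset D" unfolding D_def dset_Collect by (intro dfn_rules Yr)
  have "rgerm D t0 \<or> lgerm D t0"
  proof (rule ccontr)
    assume "\<not> ?thesis"
    then have "rgerm (- D) t0" "lgerm (- D) t0" using germ_compl[OF dD] by auto
    then obtain y z where yz: "y < t0" "t0 < z" "{y<..<t0} \<subseteq> - D" "{t0<..<z} \<subseteq> - D"
      unfolding rgerm_def lgerm_def by blast
    then obtain t s where t: "t \<noteq> t0" "\<bar>t - t0\<bar> < min (t0 - y) (z - t0)" "Y t s"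
      using acc[of "min (t0 - y) (z - t0)"] by auto
    then have "t \<in> {y<..<t0} \<union> {t0<..<z}" by (auto simp: abs_less_iff)
    moreover have "t \<in> D" using t by (auto simp: D_def)
    ultimately show False using yz by blast
  qed
  then show ?thesis
  proof
    assume "rgerm D t0"
    then have D: "rgerm {t. \<exists>s. Y t s} t0" unfolding D_def .
    obtain L where L: "0 \<le> L" "L \<le> 1" "\<And>\<eta>. \<eta> > 0 \<Longrightarrow> rgerm {t. \<exists>s. Y t s \<and> \<bar>s - L\<bar> < \<eta>} t0"
      by (rule accumulation_right[of Y t0, OF Y]) (erule bd, rule D, rule that)
    have "\<exists>t s. \<bar>t - t0\<bar> < \<epsilon> \<and> \<bar>s - L\<bar> < \<eta> \<and> Y t s" if pos: "\<eta> > 0" "\<epsilon> > 0" for \<eta> \<epsilon>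
    proof -
      obtain z where z: "t0 < z" "{t0<..<z} \<subseteq> {t. \<exists>s. Y t s \<and> \<bar>s - L\<bar> < \<eta>}"
        using L(3)[OF \<open>\<eta> > 0\<close>] unfolding rgerm_def by blast
      obtain t where t: "t0 < t" "t < min z (t0 + \<epsilon>)" using dense[of t0 "min z (t0 + \<epsilon>)"] z(1) pos by auto
      then have "t \<in> {t0<..<z}" "\<bar>t - t0\<bar> < \<epsilon>" by (auto simp: abs_less_iff)
      then show ?thesis using z(2) by blast
    qed
    then show ?thesis using that L by blast
  next
    assume "lgerm D t0"
    then have g: "rgerm {t. \<exists>s. Y (- t) s} (- t0)" unfolding lgerm_uminus D_def by simp
    have Y': "dfn M (\<lambda>e. Y (- (e 0)) (e 1))" by (intro dfn_rules Yr)
    obtain L where L: "0 \<le> L" "L \<le> 1"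
      "\<And>\<eta>. \<eta> > 0 \<Longrightarrow> rgerm {t. \<exists>s. Y (- t) s \<and> \<bar>s - L\<bar> < \<eta>} (- t0)"
      by (rule accumulation_right[of "\<lambda>t s. Y (- t) s" "- t0", OF Y']) (erule bd, rule g, rule that)
    have "\<exists>t s. \<bar>t - t0\<bar> < \<epsilon> \<and> \<bar>s - L\<bar> < \<eta> \<and> Y t s" if pos: "\<eta> > 0" "\<epsilon> > 0" for \<eta> \<epsilon>
    proof -
      obtain z where z: "- t0 < z" "{- t0<..<z} \<subseteq> {t. \<exists>s. Y (- t) s \<and> \<bar>s - L\<bar> < \<eta>}"
        using L(3)[OF \<open>\<eta> > 0\<close>] unfolding rgerm_def by blast
      obtain t where t: "- t0 < t" "t < min z (- t0 + \<epsilon>)"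
        using dense[of "- t0" "min z (- t0 + \<epsilon>)"] z(1) pos by auto
      then have "t \<in> {- t0<..<z}" "\<bar>- t - t0\<bar> < \<epsilon>" by (auto simp: abs_less_iff)
      then show ?thesis using z(2) by blast
    qed
    then show ?thesis using that L by blast
  qed
qed

text \<open>
  The relation \<open>X\<close> is regular at \<open>(t, s)\<close> if near this point it is empty or the graph of
  a function that is continuous at \<open>t\<close>.
\<close>

definition regular_at :: "('a \<Rightarrow> 'a \<Rightarrow> bool) \<Rightarrow> 'a \<Rightarrow> 'a \<Rightarrow> bool" where
  "regular_at X t s \<longleftrightarrow>
    (if X t s then \<exists>d>0. \<forall>\<eta>. 0 < \<eta> \<and> \<eta> \<le> d \<longrightarrow> (\<exists>\<epsilon>>0. \<forall>t'. \<bar>t' - t\<bar> < \<epsilon> \<longrightarrow>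
        (\<exists>u. \<bar>u - s\<bar> < \<eta> \<and> X t' u) \<and>
        (\<forall>u v. \<bar>u - s\<bar> < \<eta> \<and> \<bar>v - s\<bar> < \<eta> \<and> X t' u \<and> X t' v \<longrightarrow> u = v))
     else \<exists>\<epsilon>>0. \<forall>t' u. \<bar>t' - t\<bar> < \<epsilon> \<and> \<bar>u - s\<bar> < \<epsilon> \<longrightarrow> \<not> X t' u)"

text \<open>The functions \<open>up\<close> and \<open>dn\<close> bracket the graph of \<beta> so
  that \<open>X\<close> has no other points in between. At a common continuity point of the three
  functions the bracket stays open in a neighbourhood, where \<open>X\<close> is the graph of
  \<beta> or empty.\<close>

lemma isolated_graph_regular:
  assumes "dfun1 M \<beta>" "dfun1 M up" "dfun1 M dn" "a < b"
    and gap: "\<And>t s. a < t \<Longrightarrow> t < b \<Longrightarrow> dn t < \<beta> t \<and> \<beta> t < up t"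
      "\<And>t s. a < t \<Longrightarrow> t < b \<Longrightarrow> X t s \<Longrightarrow> dn t < s \<Longrightarrow> s < up t \<Longrightarrow> s = \<beta> t"
    and alt: "(\<forall>t. a < t \<and> t < b \<longrightarrow> X t (\<beta> t)) \<or> (\<forall>t. a < t \<and> t < b \<longrightarrow> \<not> X t (\<beta> t))"
  shows "\<exists>t. a < t \<and> t < b \<and> regular_at X t (\<beta> t)"
proof -
  have "\<And>i. i \<in> {\<beta>, up, dn} \<Longrightarrow> dfun1 M i" using assms by auto
  then obtain c d where cd: "a \<le> c" "c < d" "d \<le> b"
    "\<And>x f. f \<in> {\<beta>, up, dn} \<Longrightarrow> c < x \<Longrightarrow> x < d \<Longrightarrow> cont_at f x"
    using common_continuity_interval[of "{\<beta>, up, dn}" "\<lambda>f. f" a b] \<open>a < b\<close> by blast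
  obtain t where t: "c < t" "t < d" using dense[OF cd(2)] by blast
  have tab: "a < t" "t < b" using t cd by auto
  have c: "cont_at \<beta> t" "cont_at up t" "cont_at dn t" using cd(4) t by auto
  have g: "dn t < \<beta> t" "\<beta> t < up t" using gap(1) tab by auto
  \<comment> \<open>Half of the smaller gap: one half absorbs the variation of \<open>up\<close> and
    \<open>dn\<close> near t, the other half the distance of s from \<beta> t.\<close>
  define \<eta>0 where "\<eta>0 = min (up t - \<beta> t) (\<beta> t - dn t) / 2"
  have \<eta>0: "\<eta>0 > 0" "\<beta> t + 2 * \<eta>0 \<le> up t" "dn t \<le> \<beta> t - 2 * \<eta>0"
    using g by (auto simp: \<eta>0_def min_def)
  obtain \<delta>1 where \<delta>1: "\<delta>1 > 0" "\<And>y. \<bar>y - t\<bar> < \<delta>1 \<Longrightarrow> \<bar>up y - up t\<bar> < \<eta>0"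
    using cont_atD[OF c(2) \<eta>0(1)] by blast
  obtain \<delta>2 where \<delta>2: "\<delta>2 > 0" "\<And>y. \<bar>y - t\<bar> < \<delta>2 \<Longrightarrow> \<bar>dn y - dn t\<bar> < \<eta>0"
    using cont_atD[OF c(3) \<eta>0(1)] by blast
  define \<epsilon>0 where "\<epsilon>0 = Min {\<delta>1, \<delta>2, t - a, b - t}"
  have "\<epsilon>0 > 0" using \<delta>1 \<delta>2 tab by (auto simp: \<epsilon>0_def)
  have near: "a < t' \<and> t' < b \<and> (\<forall>s. \<bar>s - \<beta> t\<bar> < \<eta>0 \<and> X t' s \<longrightarrow> s = \<beta> t')" if "\<bar>t' - t\<bar> < \<epsilon>0" for t'
  proof -
    have *: "\<bar>t' - t\<bar> < \<delta>1" "\<bar>t' - t\<bar> < \<delta>2" "a < t'" "t' < b"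
      using that by (auto simp: \<epsilon>0_def abs_less_iff)
    have "s = \<beta> t'" if s: "\<bar>s - \<beta> t\<bar> < \<eta>0" "X t' s" for s
    proof (rule gap(2)[OF *(3,4) s(2)])
      show "dn t' < s" "s < up t'"
        using \<delta>1(2)[OF *(1)] \<delta>2(2)[OF *(2)] s(1) \<eta>0 by (auto simp: abs_less_iff)
    qed
    then show ?thesis using * by blast
  qed
  show ?thesis
  proof (cases "X t (\<beta> t)")
    case True
    then have Xb: "X t' (\<beta> t')" if "a < t'" "t' < b" for t' using alt tab that by blast
    have "\<exists>\<epsilon>>0. \<forall>t'. \<bar>t' - t\<bar> < \<epsilon> \<longrightarrow> (\<exists>u. \<bar>u - \<beta> t\<bar> < \<eta> \<and> X t' u) \<and>
        (\<forall>u v. \<bar>u - \<beta> t\<bar> < \<eta> \<and> \<bar>v - \<beta> t\<bar> < \<eta> \<and> X t' u \<and> X t' v \<longrightarrow> u = v)"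
      if \<eta>: "0 < \<eta>" "\<eta> \<le> \<eta>0" for \<eta>
    proof -
      obtain \<delta> where \<delta>: "\<delta> > 0" "\<And>y. \<bar>y - t\<bar> < \<delta> \<Longrightarrow> \<bar>\<beta> y - \<beta> t\<bar> < \<eta>"
        using cont_atD[OF c(1) \<eta>(1)] by blast
      have "(\<exists>u. \<bar>u - \<beta> t\<bar> < \<eta> \<and> X t' u) \<and>
        (\<forall>u v. \<bar>u - \<beta> t\<bar> < \<eta> \<and> \<bar>v - \<beta> t\<bar> < \<eta> \<and> X t' u \<and> X t' v \<longrightarrow> u = v)"
        if t': "\<bar>t' - t\<bar> < min \<delta> \<epsilon>0" for t'
      proof -
        have n: "a < t'" "t' < b" "\<And>s. \<bar>s - \<beta> t\<bar> < \<eta>0 \<Longrightarrow> X t' s \<Longrightarrow> s = \<beta> t'"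
          using near[of t'] t' by auto
        have "\<bar>\<beta> t' - \<beta> t\<bar> < \<eta>" using \<delta>(2) t' by simp
        moreover have "X t' (\<beta> t')" using Xb n by blast
        moreover have "u = \<beta> t'" if "\<bar>u - \<beta> t\<bar> < \<eta>" "X t' u" for u
          using n(3)[of u] that \<eta>(2) by (meson less_le_trans)
        ultimately show ?thesis by blast
      qed
      then show ?thesis using \<delta>(1) \<open>\<epsilon>0 > 0\<close> by (intro exI[of _ "min \<delta> \<epsilon>0"]) auto
    qed
    then have "regular_at X t (\<beta> t)" unfolding regular_at_def using True \<eta>0(1) by auto
    then show ?thesis using tab by blast
  next
    case False
    then have Xb: "\<not> X t' (\<beta> t')" if "a < t'" "t' < b" for t' using alt tab that by blast
    have "\<not> X t' u" if "\<bar>t' - t\<bar> < min \<epsilon>0 \<eta>0" "\<bar>u - \<beta> t\<bar> < min \<epsilon>0 \<eta>0" for t' u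
    proof
      assume "X t' u"
      then have "u = \<beta> t'" "a < t'" "t' < b" using near[of t'] that by auto
      then show False using Xb \<open>X t' u\<close> by blast
    qed
    then have "regular_at X t (\<beta> t)" unfolding regular_at_def using False \<eta>0(1) \<open>\<epsilon>0 > 0\<close>
      by (auto intro!: exI[of _ "min \<epsilon>0 \<eta>0"])
    then show ?thesis using tab by blast
  qed
qed

text \<open>A finite fibre has a least point above \<beta> t, if any. Where there is none, \<beta> t
  + 1 bounds the gap instead, so that the function is total.\<close>

lemma next_fibre_point:
  assumes X: "dfn M (\<lambda>e. X (e 0) (e 1))" and fin: "\<And>t. finite {s. X t s}" and \<beta>: "dfun1 M \<beta>"
  obtains up where "dfun1 M up" "\<And>t. \<beta> t < up t" "\<And>t s. X t s \<Longrightarrow> \<beta> t < s \<Longrightarrow> up t \<le> s"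
proof -
  note Xr = dfn_rel2[OF X] and br = dtm_fun1[OF \<beta>]
  define up where "up t = (if \<exists>s. X t s \<and> \<beta> t < s
    then skolem {s. X t s \<and> \<beta> t < s \<and> (\<forall>u. X t u \<and> \<beta> t < u \<longrightarrow> s \<le> u)} else \<beta> t + 1)" for t
  have "dfun1 M up" unfolding dfun1_def up_def by (intro dfn_rules dtm_skolem Xr br)
  moreover have "\<beta> t < up t \<and> (\<forall>s. X t s \<longrightarrow> \<beta> t < s \<longrightarrow> up t \<le> s)" for t
  proof (cases "\<exists>s. X t s \<and> \<beta> t < s")
    case True
    define S where "S = {s. X t s \<and> \<beta> t < s \<and> (\<forall>u. X t u \<and> \<beta> t < u \<longrightarrow> s \<le> u)}"
    have dS: "dset S" unfolding S_def dset_Collect by (intro dfn_rules Xr)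
    define F where "F = {s. X t s \<and> \<beta> t < s}"
    have "finite F" "F \<noteq> {}" using finite_subset[OF _ fin[of t], of F] True by (auto simp: F_def)
    then have "Min F \<in> F" "\<And>u. u \<in> F \<Longrightarrow> Min F \<le> u" by auto
    then have "Min F \<in> S" unfolding S_def F_def by blast
    then have "skolem S \<in> S" using skolem_in[OF dS] by blast
    then show ?thesis using True unfolding up_def S_def[symmetric] by (auto simp: S_def)
  qed (auto simp: up_def)
  ultimately show ?thesis using that by blast
qed

text \<open>If irregular points occurred over infinitely many t, a definable \<beta> would select
  one over each point of an interval. The neighbouring fibre points, those below obtained by
  reflection, bracket \<beta>, and the bracketed graph is regular somewhere.\<close>

lemma finite_irregular:
  assumes X: "dfn M (\<lambda>e. X (e 0) (e 1))" and fin: "\<And>t. finite {s. X t s}"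
  shows "finite {t. \<exists>s. 0 \<le> s \<and> s \<le> 1 \<and> \<not> regular_at X t s}"
proof (rule ccontr)
  note Xr = dfn_rel2[OF X]
  define irr where "irr t s \<longleftrightarrow> 0 \<le> s \<and> s \<le> 1 \<and> \<not> regular_at X t s" for t s
  have irr: "dfn M (\<lambda>e. irr (e 0) (e 1))"
    unfolding irr_def regular_at_def by (intro dfn_rules Xr)
  note ir = dfn_rel2[OF irr]
  assume "infinite {t. \<exists>s. 0 \<le> s \<and> s \<le> 1 \<and> \<not> regular_at X t s}"
  then have "infinite {t. \<exists>s. irr t s}" unfolding irr_def .
  moreover have "dset {t. \<exists>s. irr t s}" unfolding dset_Collect by (intro dfn_rules ir)
  ultimately obtain a b where ab: "a < b" "{a<..<b} \<subseteq> {t. \<exists>s. irr t s}"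
    using infinite_interval by blast
  define \<beta> where "\<beta> t = skolem {s. irr t s}" for t
  have \<beta>: "dfun1 M \<beta>" unfolding dfun1_def \<beta>_def by (intro dtm_skolem ir dfn_rules)
  have irr\<beta>: "irr t (\<beta> t)" if "a < t" "t < b" for t
  proof -
    have "dset {s. irr t s}" unfolding dset_Collect by (intro dfn_rules ir)
    moreover have "{s. irr t s} \<noteq> {}" using ab(2) that by (force simp: subset_iff)
    ultimately show ?thesis using skolem_in[of "{s. irr t s}"] unfolding \<beta>_def by blast
  qed
  obtain up where up: "dfun1 M up" "\<And>t. \<beta> t < up t" "\<And>t s. X t s \<Longrightarrow> \<beta> t < s \<Longrightarrow> up t \<le> s"
    using next_fibre_point[OF X fin \<beta>] by blast
  have "dfn M (\<lambda>e. X (e 0) (- (e 1)))" by (intro dfn_rules Xr)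
  moreover have "finite {s. X t (- s)}" for t
  proof -
    have "{s. X t (- s)} = uminus ` {s. X t s}" by (force intro: image_eqI[of _ _ "- _"])
    then show ?thesis using fin by simp
  qed
  moreover have "dfun1 M (\<lambda>t. - \<beta> t)" unfolding dfun1_def by (intro dfn_rules dtm_fun1[OF \<beta>])
  ultimately obtain dn where dn: "dfun1 M dn" "\<And>t. - \<beta> t < dn t"
      "\<And>t s. X t (- s) \<Longrightarrow> - \<beta> t < s \<Longrightarrow> dn t \<le> s"
    using next_fibre_point[of "\<lambda>t s. X t (- s)" "\<lambda>t. - \<beta> t"] by blast
  have dn': "dfun1 M (\<lambda>t. - dn t)" unfolding dfun1_def by (intro dfn_rules dtm_fun1[OF dn(1)])
  have "dset {t. X t (\<beta> t)}" unfolding dset_Collect by (intro dfn_rules Xr dtm_fun1[OF \<beta>])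
  then obtain c d where cd: "a \<le> c" "c < d" "d \<le> b" "{c<..<d} \<subseteq> {t. X t (\<beta> t)} \<or> {c<..<d} \<subseteq> - {t. X t (\<beta> t)}"
    by (rule subinterval_cases[OF _ ab(1)]) (rule that)
  have "\<exists>t. c < t \<and> t < d \<and> regular_at X t (\<beta> t)"
  proof (rule isolated_graph_regular[OF \<beta> up(1) dn' cd(2)])
    show "- dn t < \<beta> t \<and> \<beta> t < up t" for t using up(2)[of t] dn(2)[of t] by auto
    show "s = \<beta> t" if "X t s" "- dn t < s" "s < up t" for t s
      using up(3)[of t s] dn(3)[of t "- s"] that by (cases s "\<beta> t" rule: linorder_cases) auto
    show "(\<forall>t. c < t \<and> t < d \<longrightarrow> X t (\<beta> t)) \<or> (\<forall>t. c < t \<and> t < d \<longrightarrow> \<not> X t (\<beta> t))"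
      using cd(4) by (auto simp: subset_iff)
  qed
  then obtain t where "c < t" "t < d" "regular_at X t (\<beta> t)" by blast
  then show False using irr\<beta>[of t] cd unfolding irr_def by auto
qed

text \<open>Around the points of the fibre at t0 there are disjoint intervals in each of which a
  nearby fibre has exactly one point. Further points of nearby fibres would accumulate at some L in
  the unit interval outside the fibre at t0, where regularity makes \<open>X\<close> locally
  empty.\<close>

lemma regular_card_locally_constant:
  assumes X: "dfn M (\<lambda>e. X (e 0) (e 1))" and fin: "finite {s. X t0 s}"
    and bd: "\<And>t s. X t s \<Longrightarrow> 0 \<le> s \<and> s \<le> 1"
    and reg: "\<And>s. 0 \<le> s \<Longrightarrow> s \<le> 1 \<Longrightarrow> regular_at X t0 s"
  obtains \<epsilon> where "\<epsilon> > 0" "\<And>t. \<bar>t - t0\<bar> < \<epsilon> \<Longrightarrow> card {s. X t s} = card {s. X t0 s}"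
proof -
  note Xr = dfn_rel2[OF X]
  define F where "F = {s. X t0 s}"
  define U where "U s \<eta> t \<longleftrightarrow> (\<exists>u. \<bar>u - s\<bar> < \<eta> \<and> X t u) \<and>
        (\<forall>u v. \<bar>u - s\<bar> < \<eta> \<and> \<bar>v - s\<bar> < \<eta> \<and> X t u \<and> X t v \<longrightarrow> u = v)" for s \<eta> t
  have F: "finite F" using fin by (simp add: F_def)
  have ex1: "\<exists>d>0. \<forall>\<eta>. 0 < \<eta> \<and> \<eta> \<le> d \<longrightarrow> (\<exists>\<epsilon>>0. \<forall>t. \<bar>t - t0\<bar> < \<epsilon> \<longrightarrow> U s \<eta> t)" if "s \<in> F" for s
    using reg[of s] bd[of t0 s] that unfolding regular_at_def F_def U_def by simp
  obtain d1 where d1: "d1 > 0"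
    "\<And>s \<eta>. s \<in> F \<Longrightarrow> 0 < \<eta> \<Longrightarrow> \<eta> \<le> d1 \<Longrightarrow> \<exists>\<epsilon>>0. \<forall>t. \<bar>t - t0\<bar> < \<epsilon> \<longrightarrow> U s \<eta> t"
    by (rule finite_uniform_bound[OF F ex1]) (assumption, rule that)
  have ex2: "\<exists>d>0. \<forall>\<eta>. 0 < \<eta> \<and> \<eta> \<le> d \<longrightarrow> fst p \<noteq> snd p \<longrightarrow> 2 * \<eta> \<le> \<bar>fst p - snd p\<bar>"
    if "p \<in> F \<times> F" for p :: "'a \<times> 'a"
    by (cases "fst p = snd p")
      (auto intro: exI[of _ 1] exI[of _ "\<bar>fst p - snd p\<bar> / 2"])
  obtain d2 where d2: "d2 > 0"
    "\<And>p \<eta>. p \<in> F \<times> F \<Longrightarrow> 0 < \<eta> \<Longrightarrow> \<eta> \<le> d2 \<Longrightarrow> fst p \<noteq> snd p \<longrightarrow> 2 * \<eta> \<le> \<bar>fst p - snd p\<bar>"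
    by (rule finite_uniform_bound[OF finite_cartesian_product[OF F F] ex2]) (assumption, rule that)
  define \<eta> where "\<eta> = min d1 d2"
  have \<eta>: "0 < \<eta>" "\<eta> \<le> d1" "\<eta> \<le> d2" using d1 d2 by (auto simp: \<eta>_def)
  have sep: "s = s'" if "s \<in> F" "s' \<in> F" "\<bar>u - s\<bar> < \<eta>" "\<bar>u - s'\<bar> < \<eta>" for s s' u
  proof (rule ccontr)
    assume "s \<noteq> s'"
    then have "2 * \<eta> \<le> \<bar>s - s'\<bar>" using d2(2)[of "(s, s')" \<eta>] \<eta> that by auto
    then show False using that by linarith
  qed
  have ex3: "\<exists>d>0. \<forall>\<epsilon>. 0 < \<epsilon> \<and> \<epsilon> \<le> d \<longrightarrow> (\<forall>t. \<bar>t - t0\<bar> < \<epsilon> \<longrightarrow> U s \<eta> t)" if "s \<in> F" for s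
    using d1(2)[OF that \<eta>(1,2)] by (meson less_le_trans)
  obtain d3 where d3: "d3 > 0" "\<And>s \<epsilon>. s \<in> F \<Longrightarrow> 0 < \<epsilon> \<Longrightarrow> \<epsilon> \<le> d3 \<Longrightarrow> \<forall>t. \<bar>t - t0\<bar> < \<epsilon> \<longrightarrow> U s \<eta> t"
    by (rule finite_uniform_bound[OF F ex3]) (assumption, rule that)
  \<comment> \<open>The points of \<open>X\<close> outside the strips of half-width \<eta> around
    \<open>F\<close>. None lies over t0 itself, so an accumulation at t0 comes from parameters
    different from t0, as \<open>accumulation_point\<close> requires.\<close>
  define Y where "Y t s \<longleftrightarrow> X t s \<and> (\<forall>s'\<in>F. \<eta> \<le> \<bar>s - s'\<bar>)" for t s
  have "\<exists>\<epsilon>>0. \<forall>t s. \<bar>t - t0\<bar> < \<epsilon> \<longrightarrow> \<not> Y t s"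
  proof (rule ccontr)
    assume "\<not> ?thesis"
    then have "\<exists>t s. t \<noteq> t0 \<and> \<bar>t - t0\<bar> < \<epsilon> \<and> Y t s" if "\<epsilon> > 0" for \<epsilon>
    proof -
      obtain t s where ts: "\<bar>t - t0\<bar> < \<epsilon>" "Y t s" using \<open>\<not> _\<close> \<open>\<epsilon> > 0\<close> by blast
      have "\<not> Y t0 s" using \<eta>(1) unfolding Y_def F_def by force
      then show ?thesis using ts by metis
    qed
    moreover have "dfn M (\<lambda>e. Y (e 0) (e 1))"
      unfolding Y_def by (intro dfn_rules Xr dfn_finite_all F)
    moreover have "0 \<le> s \<and> s \<le> 1" if "Y t s" for t s using bd that unfolding Y_def by blast
    ultimately obtain L where L: "0 \<le> L" "L \<le> 1"
      "\<And>\<eta> \<epsilon>. \<eta> > 0 \<Longrightarrow> \<epsilon> > 0 \<Longrightarrow> \<exists>t s. \<bar>t - t0\<bar> < \<epsilon> \<and> \<bar>s - L\<bar> < \<eta> \<and> Y t s"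
      using accumulation_point[of Y t0] by blast
    have "\<eta> \<le> \<bar>L - s'\<bar>" if "s' \<in> F" for s'
    proof (rule ccontr)
      assume "\<not> \<eta> \<le> \<bar>L - s'\<bar>"
      then obtain t s where "\<bar>s - L\<bar> < \<eta> - \<bar>L - s'\<bar>" "Y t s" using L(3)[of "\<eta> - \<bar>L - s'\<bar>" 1] by auto
      moreover from this have "\<eta> \<le> \<bar>s - s'\<bar>" using \<open>s' \<in> F\<close> unfolding Y_def by blast
      ultimately show False by linarith
    qed
    then have "\<not> X t0 L" using \<eta>(1) unfolding F_def by force
    then obtain \<epsilon> where "\<epsilon> > 0" "\<And>t u. \<bar>t - t0\<bar> < \<epsilon> \<Longrightarrow> \<bar>u - L\<bar> < \<epsilon> \<Longrightarrow> \<not> X t u"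
      using reg[OF L(1,2)] unfolding regular_at_def by auto
    then show False using L(3)[of \<epsilon> \<epsilon>] unfolding Y_def by blast
  qed
  then obtain d4 where d4: "d4 > 0" "\<And>t s. \<bar>t - t0\<bar> < d4 \<Longrightarrow> \<not> Y t s" by blast
  have "card {s. X t s} = card F" if t: "\<bar>t - t0\<bar> < min d3 d4" for t
  proof -
    have U: "U s \<eta> t" if "s \<in> F" for s using d3(2)[OF that d3(1)] t by auto
    have "\<exists>f. \<forall>s\<in>F. \<bar>f s - s\<bar> < \<eta> \<and> X t (f s)"
      using U unfolding U_def by (intro bchoice) blast
    then obtain f where f: "\<And>s. s \<in> F \<Longrightarrow> \<bar>f s - s\<bar> < \<eta>" "\<And>s. s \<in> F \<Longrightarrow> X t (f s)" by blast
    have "inj_on f F"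
    proof (rule inj_onI)
      fix s s' assume *: "s \<in> F" "s' \<in> F" "f s = f s'"
      show "s = s'" using sep[OF *(1,2) f(1)[OF *(1)]] f(1)[OF *(2)] *(3) by simp
    qed
    moreover have "f ` F = {s. X t s}"
    proof (intro set_eqI iffI)
      fix u assume "u \<in> {s. X t s}"
      then have Xu: "X t u" by simp
      then obtain s where s: "s \<in> F" "\<bar>u - s\<bar> < \<eta>" using d4(2)[of t u] t unfolding Y_def by auto
      then have "u = f s" using U[OF s(1)] f[OF s(1)] Xu unfolding U_def by blast
      then show "u \<in> f ` F" using s by blast
    qed (use f in auto)
    ultimately show ?thesis using card_image by metis
  qed
  moreover have "0 < min d3 d4" using d3(1) d4(1) by simp
  ultimately show ?thesis unfolding F_def by (intro that)
qed

text \<open>For a fixed k the bound says that the fibre contains k distinct points, which a block of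
  k quantifiers expresses.\<close>

lemma dset_card_fibre_ge:
  assumes X: "dfn M (\<lambda>e. X (e 0) (e 1))" and fin: "\<And>t. finite {s. X t s}"
  shows "dset {t. k \<le> card {s. X t s}}"
proof -
  have "k \<le> card {s. X t s} \<longleftrightarrow> (\<exists>b. length b = k \<and> ((\<forall>i\<in>{..<k}. X t (b ! i)) \<and>
      (\<forall>i\<in>{..<k}. \<forall>j\<in>{..<k}. i \<noteq> j \<longrightarrow> b ! i \<noteq> b ! j)))" for t
  proof
    assume "k \<le> card {s. X t s}"
    then obtain S where "S \<subseteq> {s. X t s}" "card S = k" "finite S" using obtain_subset_with_card_n by blast
    moreover then obtain b where "set b = S" "distinct b" using finite_distinct_list by blast
    ultimately show "\<exists>b. length b = k \<and> ((\<forall>i\<in>{..<k}. X t (b ! i)) \<and>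
      (\<forall>i\<in>{..<k}. \<forall>j\<in>{..<k}. i \<noteq> j \<longrightarrow> b ! i \<noteq> b ! j))"
      by (intro exI[of _ b]) (auto simp: distinct_card nth_eq_iff_index_eq)
  next
    assume "\<exists>b. length b = k \<and> ((\<forall>i\<in>{..<k}. X t (b ! i)) \<and>
      (\<forall>i\<in>{..<k}. \<forall>j\<in>{..<k}. i \<noteq> j \<longrightarrow> b ! i \<noteq> b ! j))"
    then obtain b where b: "length b = k" "\<forall>i<k. X t (b ! i)" "distinct b"
      by (auto simp: distinct_conv_nth)
    then have "set b \<subseteq> {s. X t s}" by (auto simp: in_set_conv_nth)
    then show "k \<le> card {s. X t s}" using card_mono[OF fin] distinct_card[OF b(3)] b(1) by metis
  qed
  moreover have "dfn M (\<lambda>e. \<exists>b. length b = k \<and> ((\<forall>i\<in>{..<k}. X (e 0) (b ! i)) \<and>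
      (\<forall>i\<in>{..<k}. \<forall>j\<in>{..<k}. i \<noteq> j \<longrightarrow> b ! i \<noteq> b ! j)))"
  proof (intro dfn_exlist dfn_conj dfn_finite_all finite_lessThan)
    fix i assume i: "i \<in> {..<k}"
    show "dfn M (\<lambda>e. X (e (0 + k)) (map e [0..<k] ! i))"
      using i by (intro dfn_rel2[OF X]) (auto intro: dtm_var)
    fix j assume j: "j \<in> {..<k}"
    have "dfn M (\<lambda>e. i \<noteq> j \<longrightarrow> e i \<noteq> e j)" by (intro dfn_rules)
    then show "dfn M (\<lambda>e. i \<noteq> j \<longrightarrow> map e [0..<k] ! i \<noteq> map e [0..<k] ! j)"
      using i j by simp
  qed
  ultimately show ?thesis unfolding dset_Collect by simp
qed

text \<open>Away from the finitely many parameters with irregular points the fibre size is locally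
  constant. By definable connectedness it is constant between neighbouring exceptional parameters,
  so it takes finitely many values altogether.\<close>

theorem uniform_finiteness:
  assumes X: "dfn M (\<lambda>e. X (e 0) (e 1))" and fin: "\<And>t. finite {s. X t s}"
    and bd: "\<And>t s. X t s \<Longrightarrow> 0 \<le> s \<and> s \<le> 1"
  obtains N where "\<And>t. card {s. X t s} \<le> N"
proof -
  define B where "B = {t. \<exists>s. 0 \<le> s \<and> s \<le> 1 \<and> \<not> regular_at X t s}"
  have B: "finite B" unfolding B_def by (rule finite_irregular[OF X fin])
  define c where "c t = card {s. X t s}" for t
  have loc: "\<exists>\<epsilon>>0. \<forall>u. \<bar>u - t\<bar> < \<epsilon> \<longrightarrow> c u = c t" if "t \<notin> B" for t
  proof -
    have reg: "regular_at X t s" if "0 \<le> s" "s \<le> 1" for s using that \<open>t \<notin> B\<close> unfolding B_def by blast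
    obtain \<epsilon> where "\<epsilon> > 0" "\<And>u. \<bar>u - t\<bar> < \<epsilon> \<Longrightarrow> card {s. X u s} = card {s. X t s}"
      by (rule regular_card_locally_constant[of X t, OF X fin]) (erule bd, erule (1) reg, rule that)
    then show ?thesis unfolding c_def by blast
  qed
  have le: "c t \<le> c u" "c u \<le> c t" if tu: "t \<le> u" "{t..u} \<inter> B = {}" for t u
  proof -
    have "t \<in> {t. k \<le> c t} \<longleftrightarrow> u \<in> {t. k \<le> c t}" for k
    proof (rule locally_constant_interval[OF _ tu(1)])
      show "dset {t. k \<le> c t}" unfolding c_def by (rule dset_card_fibre_ge[OF X fin])
      show "\<exists>\<epsilon>>0. \<forall>w. \<bar>w - x\<bar> < \<epsilon> \<longrightarrow> (w \<in> {t. k \<le> c t} \<longleftrightarrow> x \<in> {t. k \<le> c t})" if "t \<le> x" "x \<le> u" for x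
      proof -
        have "x \<notin> B" using that tu(2) by auto
        then obtain \<epsilon> where "\<epsilon> > 0" "\<And>w. \<bar>w - x\<bar> < \<epsilon> \<Longrightarrow> c w = c x" using loc by blast
        then have "\<forall>w. \<bar>w - x\<bar> < \<epsilon> \<longrightarrow> (w \<in> {t. k \<le> c t} \<longleftrightarrow> x \<in> {t. k \<le> c t})"
          by (metis mem_Collect_eq)
        with \<open>\<epsilon> > 0\<close> show ?thesis by blast
      qed
    qed
    from this[of "c t"] this[of "c u"] show "c t \<le> c u" "c u \<le> c t"
      unfolding mem_Collect_eq by blast+
  qed
  have "finite (c ` (- B))"
  proof (rule finite_surj)
    show "finite (Pow B)" using B by simp
    \<comment> \<open>A component of the complement of \<open>B\<close> is coded by the set of
      points of \<open>B\<close> below it; \<open>r S\<close> is a representative of the component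
      with code \<open>S\<close>.\<close>
    define r where "r S = (SOME t. t \<notin> B \<and> {x \<in> B. x < t} = S)" for S
    show "c ` (- B) \<subseteq> (\<lambda>S. c (r S)) ` Pow B"
    proof
      fix v assume "v \<in> c ` (- B)"
      then obtain t where t: "t \<notin> B" "v = c t" by auto
      define u where "u = r {x \<in> B. x < t}"
      have "u \<notin> B \<and> {x \<in> B. x < u} = {x \<in> B. x < t}" unfolding u_def r_def
        by (rule someI[of _ t]) (use t in auto)
      then have u: "u \<notin> B" "\<And>x. x \<in> B \<Longrightarrow> x < u \<longleftrightarrow> x < t" by auto
      have "c t = c u"
      proof (cases "t \<le> u")
        case True
        have "x \<notin> B" if "t \<le> x" "x \<le> u" for x
        proof
          assume "x \<in> B"
          then have "x < u" using u(1) that(2) order_le_less by metis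
          then show False using u(2)[OF \<open>x \<in> B\<close>] that(1) by simp
        qed
        then have "{t..u} \<inter> B = {}" by auto
        then show ?thesis using le[OF True] by (intro order_antisym)
      next
        case False
        then have "u \<le> t" by simp
        have "x \<notin> B" if "u \<le> x" "x \<le> t" for x
        proof
          assume "x \<in> B"
          then have "x < t" using t(1) that(2) order_le_less by metis
          then show False using u(2)[OF \<open>x \<in> B\<close>] that(1) by simp
        qed
        then have "{u..t} \<inter> B = {}" by auto
        then show ?thesis using le[OF \<open>u \<le> t\<close>] by (intro order_antisym)
      qed
      then show "v \<in> (\<lambda>S. c (r S)) ` Pow B" using t by (auto simp: u_def)
    qed
  qed
  moreover have "range c = c ` B \<union> c ` (- B)" by blast
  ultimately have "finite (range c)" using B by simp
  then have "c t \<le> Max (range c)" for t by simp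
  then show ?thesis using that unfolding c_def by blast
qed

end

section \<open>The euclidean topology in terms of the absolute value\<close>

text \<open>The class provides no real-valued metric. Balls for the absolute value of the field
  serve as neighbourhood basis in all later continuity arguments.\<close>

lemma open_abs_iff:
  fixes U :: "'a::{linordered_field, linorder_topology} set"
  shows "open U \<longleftrightarrow> (\<forall>x\<in>U. \<exists>\<epsilon>>0. \<forall>y. \<bar>y - x\<bar> < \<epsilon> \<longrightarrow> y \<in> U)"
proof (intro iffI ballI)
  fix x assume U: "open U" "x \<in> U"
  obtain u where u: "u > x" "{x..<u} \<subseteq> U" using open_right[OF U, of "x + 1"] by auto
  obtain l where l: "l < x" "{l<..x} \<subseteq> U" using open_left[OF U, of "x - 1"] by auto
  have "y \<in> U" if "\<bar>y - x\<bar> < min (u - x) (x - l)" for y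
  proof -
    have "l < y" "y < u" using that by (auto simp: abs_less_iff)
    then show ?thesis using u(2) l(2) by (cases "x \<le> y") auto
  qed
  then show "\<exists>\<epsilon>>0. \<forall>y. \<bar>y - x\<bar> < \<epsilon> \<longrightarrow> y \<in> U"
    using u(1) l(1) by (intro exI[of _ "min (u - x) (x - l)"]) auto
next
  assume *: "\<forall>x\<in>U. \<exists>\<epsilon>>0. \<forall>y. \<bar>y - x\<bar> < \<epsilon> \<longrightarrow> y \<in> U"
  show "open U"
  proof (subst open_subopen, rule ballI)
    fix x assume "x \<in> U"
    then obtain \<epsilon> where \<epsilon>: "\<epsilon> > 0" "\<And>y. \<bar>y - x\<bar> < \<epsilon> \<Longrightarrow> y \<in> U" using * by blast
    have "{x - \<epsilon><..<x + \<epsilon>} \<subseteq> U"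
    proof
      fix y assume "y \<in> {x - \<epsilon><..<x + \<epsilon>}"
      then have "\<bar>y - x\<bar> < \<epsilon>" by (auto simp: abs_less_iff)
      then show "y \<in> U" by (rule \<epsilon>(2))
    qed
    then show "\<exists>T. open T \<and> x \<in> T \<and> T \<subseteq> U"
      using \<epsilon>(1) by (intro exI[of _ "{x - \<epsilon><..<x + \<epsilon>}"]) auto
  qed
qed

lemma open_abs_ball: "open {y :: 'a::{linordered_field, linorder_topology}. \<bar>y - x\<bar> < \<epsilon>}"
proof -
  have "{y. \<bar>y - x\<bar> < \<epsilon>} = {x - \<epsilon><..<x + \<epsilon>}" by (auto simp: abs_less_iff algebra_simps)
  then show ?thesis by simp
qed

lemma topspace_euclid: "topspace (euclid n) = {xs. length xs = n}"
  by (auto simp: euclid_def topspace_pullback_topology)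

lemma openin_euclid:
  fixes U :: "'a::{linordered_field, linorder_topology} list set"
  shows "openin (euclid n) U \<longleftrightarrow> (\<forall>x\<in>U. length x = n) \<and>
    (\<forall>x\<in>U. \<exists>\<epsilon>>0. \<forall>y. length y = n \<and> (\<forall>i<n. \<bar>y ! i - x ! i\<bar> < \<epsilon>) \<longrightarrow> y \<in> U)" (is "_ \<longleftrightarrow> ?R")
proof
  assume "openin (euclid n) U"
  then obtain V where V: "openin (product_topology (\<lambda>_. euclidean :: 'a topology) {..<n}) V"
    and U: "U = (\<lambda>xs. \<lambda>i\<in>{..<n}. xs ! i) -` V \<inter> {xs. length xs = n}"
    unfolding euclid_def openin_pullback_topology by blast
  have "\<exists>\<epsilon>>0. \<forall>y. length y = n \<and> (\<forall>i<n. \<bar>y ! i - x ! i\<bar> < \<epsilon>) \<longrightarrow> y \<in> U" if x: "x \<in> U" for x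
  proof -
    have "(\<lambda>i\<in>{..<n}. x ! i) \<in> V" using x U by auto
    then obtain W where W: "\<forall>i\<in>{..<n}. openin euclidean (W i)" "(\<lambda>i\<in>{..<n}. x ! i) \<in> Pi\<^sub>E {..<n} W"
      "Pi\<^sub>E {..<n} W \<subseteq> V"
      using V[unfolded openin_product_topology_alt] by blast
    have ex: "\<exists>d>0. \<forall>\<eta>. 0 < \<eta> \<and> \<eta> \<le> d \<longrightarrow> (\<forall>y. \<bar>y - x ! i\<bar> < \<eta> \<longrightarrow> y \<in> W i)" if "i \<in> {..<n}" for i
    proof -
      have "x ! i \<in> W i" using W(2) that by auto
      then obtain d where "d > 0" "\<forall>y. \<bar>y - x ! i\<bar> < d \<longrightarrow> y \<in> W i"
        using W(1) \<open>i \<in> {..<n}\<close> unfolding open_openin[symmetric] open_abs_iff by blast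
      then show ?thesis by (meson less_le_trans)
    qed
    obtain d where d: "d > 0"
      "\<And>i \<eta>. i \<in> {..<n} \<Longrightarrow> 0 < \<eta> \<Longrightarrow> \<eta> \<le> d \<Longrightarrow> \<forall>y. \<bar>y - x ! i\<bar> < \<eta> \<longrightarrow> y \<in> W i"
      by (rule finite_uniform_bound[OF finite_lessThan ex]) (assumption, rule that)
    have "y \<in> U" if y: "length y = n" "\<And>i. i < n \<Longrightarrow> \<bar>y ! i - x ! i\<bar> < d" for y
    proof -
      have "(\<lambda>i\<in>{..<n}. y ! i) \<in> Pi\<^sub>E {..<n} W" using d(2)[OF _ d(1) order_refl] y(2) by auto
      then have "(\<lambda>i\<in>{..<n}. y ! i) \<in> V" using W(3) by blast
      then show ?thesis using y(1) U by simp
    qed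
    then show ?thesis using d(1) by blast
  qed
  then show ?R using U by blast
next
  assume R: ?R
  define V where "V = {g \<in> extensional {..<n}. map g [0..<n] \<in> U}"
  have map_x: "map (\<lambda>i\<in>{..<n}. x ! i) [0..<n] = x" if "length x = n" for x :: "'a list"
    using that by (auto intro: nth_equalityI)
  have "U = (\<lambda>xs. \<lambda>i\<in>{..<n}. xs ! i) -` V \<inter> {xs. length xs = n}"
  proof -
    have R1: "length x = n" if "x \<in> U" for x using R that by blast
    have "(\<lambda>i\<in>{..<n}. x ! i) \<in> V \<longleftrightarrow> x \<in> U" if "length x = n" for x
      unfolding V_def using map_x[OF that] by simp
    then show ?thesis using R1 by blast
  qed
  moreover have "openin (product_topology (\<lambda>_. euclidean :: 'a topology) {..<n}) V"
    unfolding openin_product_topology_alt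
  proof
    fix g assume g: "g \<in> V"
    then have "map g [0..<n] \<in> U" by (simp add: V_def)
    from bspec[OF conjunct2[OF R] this] obtain \<epsilon> where \<epsilon>: "\<epsilon> > 0"
      "\<And>y. length y = n \<Longrightarrow> (\<And>i. i < n \<Longrightarrow> \<bar>y ! i - map g [0..<n] ! i\<bar> < \<epsilon>) \<Longrightarrow> y \<in> U"
      by blast
    define W where "W i = {y. \<bar>y - g i\<bar> < \<epsilon>}" for i
    have "h \<in> V" if h: "h \<in> Pi\<^sub>E {..<n} W" for h
    proof -
      have "map h [0..<n] \<in> U" using h by (intro \<epsilon>(2)) (auto simp: W_def PiE_iff)
      then show ?thesis using h by (auto simp: V_def PiE_iff)
    qed
    then show "\<exists>U. finite {i \<in> {..<n}. U i \<noteq> topspace euclidean} \<and> (\<forall>i\<in>{..<n}. openin euclidean (U i)) \<and>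
       g \<in> Pi\<^sub>E {..<n} U \<and> Pi\<^sub>E {..<n} U \<subseteq> V"
      using g \<epsilon>(1) by (intro exI[of _ W]) (auto simp: W_def V_def PiE_iff open_abs_ball)
  qed
  ultimately show "openin (euclid n) U" unfolding euclid_def openin_pullback_topology by blast
qed

text \<open>Halving \<delta> leaves room for moving the centre. The set is the ambient open set
  whose trace on a subspace is a preimage, in \<open>definable_continuousI\<close>, or an image, in
  \<open>homeomorphic_map_into_euclid\<close>.\<close>

lemma openin_euclid_robust:
  "openin (euclid n) {x :: 'a::{linordered_field, linorder_topology} list. length x = n \<and>
    (\<exists>\<delta>>0. \<forall>y\<in>C. (\<forall>i<n. \<bar>g y ! i - x ! i\<bar> < \<delta>) \<longrightarrow> Q y)}" (is "openin _ ?V")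
  unfolding openin_euclid
proof (intro conjI ballI)
  fix x :: "'a list" assume "x \<in> ?V"
  then obtain \<delta> where \<delta>: "length x = n" "\<delta> > 0"
    "\<And>y. y \<in> C \<Longrightarrow> (\<And>i. i < n \<Longrightarrow> \<bar>g y ! i - x ! i\<bar> < \<delta>) \<Longrightarrow> Q y" by blast
  have "z \<in> ?V" if z: "length z = n" "\<And>i. i < n \<Longrightarrow> \<bar>z ! i - x ! i\<bar> < \<delta> / 2" for z
  proof -
    have "Q y" if y: "y \<in> C" "\<And>i. i < n \<Longrightarrow> \<bar>g y ! i - z ! i\<bar> < \<delta> / 2" for y
    proof (rule \<delta>(3)[OF y(1)])
      fix i assume "i < n"
      then show "\<bar>g y ! i - x ! i\<bar> < \<delta>" using y(2)[of i] z(2)[of i] by linarith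
    qed
    then show ?thesis using z(1) \<delta>(2) by (intro CollectI conjI exI[of _ "\<delta> / 2"]) auto
  qed
  then show "\<exists>\<epsilon>>0. \<forall>y. length y = n \<and> (\<forall>i<n. \<bar>y ! i - x ! i\<bar> < \<epsilon>) \<longrightarrow> y \<in> ?V"
    using \<delta>(2) by (intro exI[of _ "\<delta> / 2"]) auto
qed simp

section \<open>Curves, surfaces and embeddings into the line\<close>

context o_minimal_field
begin

definition dlfun :: "nat \<Rightarrow> ('a list \<Rightarrow> 'a) \<Rightarrow> bool" where
  "dlfun n f \<longleftrightarrow> dtm M (\<lambda>e. f (map e [0..<n]))"

lemma dtm_lfun:
  assumes f: "dlfun n f" and t: "dlist M n t"
  shows "dtm M (\<lambda>e. f (t e))"
proof -
  have "dfn M (\<lambda>e. \<exists>b. length b = n \<and> ((\<forall>i\<in>{..<n}. b ! i = t (\<lambda>i. e (Suc i)) ! i) \<and> f b = e 0))"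
  proof (intro dfn_exlist dfn_conj dfn_finite_all dfn_eq finite_lessThan dtm_var)
    fix i assume "i \<in> {..<n}"
    then show "dtm M (\<lambda>e. map e [0..<n] ! i)" "dtm M (\<lambda>e. t (\<lambda>i. e (Suc i + n)) ! i)"
      using dtm_shift[of M "\<lambda>e. t e ! i" "\<lambda>i. Suc i + n"] t by (auto simp: dtm_var dlist_def)
  qed (use f in \<open>simp add: dlfun_def\<close>)
  moreover have "(\<exists>b. length b = n \<and> ((\<forall>i\<in>{..<n}. b ! i = u ! i) \<and> f b = v)) \<longleftrightarrow> f u = v"
    if "length u = n" for u v
  proof -
    have "b = u" if "length b = n" "\<forall>i\<in>{..<n}. b ! i = u ! i" for b
      using \<open>length u = n\<close> that by (intro nth_equalityI) auto
    then show ?thesis using that by auto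
  qed
  ultimately show ?thesis using t unfolding dtm_def dlist_def by simp
qed

lemma dlist_env: "dlist M n (\<lambda>e. map (\<lambda>i. e (r i)) [0..<n])"
  by (intro dlist_vars dtm_var)

lemma dlist_id: "dlist M n (\<lambda>e. map e [0..<n])"
  using dlist_env[of n "\<lambda>i. i"] by simp

lemma definable_graph:
  assumes "definable M n X" "dlfun n f"
  shows "definable M (n + 1) ((\<lambda>x. x @ [f x]) ` X)"
proof (rule definableI[where P = "\<lambda>xs. take n xs \<in> X \<and> f (take n xs) = xs ! n"])
  have tk: "take n (map e [0..<n + 1]) = map e [0..<n]" for e :: "nat \<Rightarrow> 'a"
    by (simp add: take_map)
  have nt: "map e [0..<n + 1] ! n = e n" for e :: "nat \<Rightarrow> 'a"
    by (subst nth_map) (simp_all del: upt_Suc)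
  show "dfn M (\<lambda>e. take n (map e [0..<n + 1]) \<in> X \<and> f (take n (map e [0..<n + 1])) = map e [0..<n + 1] ! n)"
    unfolding tk nt
    by (intro dfn_rules dfn_mem[OF assms(1)] dtm_lfun[OF assms(2)] dlist_id)
  fix xs :: "'a list"
  show "xs \<in> (\<lambda>x. x @ [f x]) ` X \<longleftrightarrow> length xs = n + 1 \<and> take n xs \<in> X \<and> f (take n xs) = xs ! n"
  proof
    assume A: "length xs = n + 1 \<and> take n xs \<in> X \<and> f (take n xs) = xs ! n"
    have "take (Suc n) xs = take n xs @ [xs ! n]" using A by (intro take_Suc_conv_app_nth) simp
    then have "xs = take n xs @ [f (take n xs)]" using A by (metis Suc_eq_plus1 take_all_iff order_refl)
    then show "xs \<in> (\<lambda>x. x @ [f x]) ` X" using A by blast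
  next
    assume "xs \<in> (\<lambda>x. x @ [f x]) ` X"
    then obtain x where x: "x \<in> X" "xs = x @ [f x]" by blast
    then show "length xs = n + 1 \<and> take n xs \<in> X \<and> f (take n xs) = xs ! n"
      using definable_length[OF assms(1) x(1)] by (simp add: nth_append)
  qed
qed

lemma definable_length_eq: "definable M n {y. length y = n}"
  by (rule definableI[where P = "\<lambda>_. True", OF dfn_const]) simp

lemma definable_continuousI:
  assumes C: "definable M n C" and f: "dlfun n f"
    and cont: "\<And>x \<epsilon>. x \<in> C \<Longrightarrow> \<epsilon> > 0 \<Longrightarrow>
      \<exists>\<delta>>0. \<forall>y\<in>C. (\<forall>i<n. \<bar>y ! i - x ! i\<bar> < \<delta>) \<longrightarrow> \<bar>f y - f x\<bar> < \<epsilon>"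
  shows "definable_continuous M n C f"
  unfolding definable_continuous_def
proof
  show "definable_map M n C 1 {y. length y = 1} (\<lambda>x. [f x])"
    unfolding definable_map_def using C definable_length_eq definable_graph[OF C f] by auto
  have Cn: "C \<subseteq> topspace (euclid n)" using definable_length[OF C] by (auto simp: topspace_euclid)
  show "continuous_map (subtopology (euclid n) C) euclidean f"
    unfolding continuous_map_def
  proof (intro conjI allI impI)
    fix U :: "'a set" assume "openin euclidean U"
    then have U: "open U" by simp
    define V where "V = {x. length x = n \<and> (\<exists>\<delta>>0. \<forall>y\<in>C. (\<forall>i<n. \<bar>y ! i - x ! i\<bar> < \<delta>) \<longrightarrow> f y \<in> U)}"
    have "openin (euclid n) V"
      unfolding V_def using openin_euclid_robust[of n C "\<lambda>y. y"] .
    moreover have "{x \<in> topspace (subtopology (euclid n) C). f x \<in> U} = V \<inter> C"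
    proof (intro set_eqI iffI)
      fix x assume "x \<in> {x \<in> topspace (subtopology (euclid n) C). f x \<in> U}"
      then have x: "x \<in> C" "f x \<in> U" by auto
      obtain \<epsilon> where \<epsilon>: "\<epsilon> > 0" "\<And>v. \<bar>v - f x\<bar> < \<epsilon> \<Longrightarrow> v \<in> U" using U x(2) unfolding open_abs_iff by blast
      obtain \<delta> where "\<delta> > 0" "\<And>y. y \<in> C \<Longrightarrow> (\<forall>i<n. \<bar>y ! i - x ! i\<bar> < \<delta>) \<Longrightarrow> \<bar>f y - f x\<bar> < \<epsilon>"
        using cont[OF x(1) \<epsilon>(1)] by blast
      then show "x \<in> V \<inter> C" using \<epsilon>(2) x(1) definable_length[OF C x(1)] unfolding V_def by blast
    next
      fix x assume "x \<in> V \<inter> C"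
      then obtain \<delta> where "x \<in> C" "\<delta> > 0" "\<forall>y\<in>C. (\<forall>i<n. \<bar>y ! i - x ! i\<bar> < \<delta>) \<longrightarrow> f y \<in> U"
        unfolding V_def by blast
      then show "x \<in> {x \<in> topspace (subtopology (euclid n) C). f x \<in> U}" using Cn by auto
    qed
    ultimately show "openin (subtopology (euclid n) C) {x \<in> topspace (subtopology (euclid n) C). f x \<in> U}"
      unfolding openin_subtopology by blast
  qed simp
qed

lemma definable_continuous_const: "definable M n C \<Longrightarrow> definable_continuous M n C (\<lambda>_. c)"
  by (rule definable_continuousI) (auto simp: dlfun_def dtm_const intro: exI[of _ 1])

lemma definable_singleton:
  assumes "length x = n" shows "definable M n {x}"
proof (rule definableI[where P = "\<lambda>xs. \<forall>i\<in>{..<n}. xs ! i = x ! i"])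
  have "dfn M (\<lambda>e. \<forall>i\<in>{..<n}. e i = x ! i)" by (intro dfn_finite_all dfn_rules finite_lessThan)
  then show "dfn M (\<lambda>e. \<forall>i\<in>{..<n}. map e [0..<n] ! i = x ! i)" by simp
qed (use assms in \<open>auto simp: list_eq_iff_nth_eq\<close>)

lemma cell_point: "length x = n \<Longrightarrow> cell M n 0 {x}"
proof (induction x arbitrary: n rule: rev_induct)
  case Nil
  then show ?case using cell.origin by auto
next
  case (snoc y x)
  have "cell M (Suc (length x)) 0 {z @ [y] |z. z \<in> {x}}"
    using cell.graph[OF snoc.IH[OF refl] definable_continuous_const[OF definable_singleton]] by simp
  then show ?case using snoc.prems by simp
qed

text \<open>
  The clauses on subintervals and subboxes let the domain be shrunk to where a further coordinate
  function is continuous; coordinates \<open>p\<close> and \<open>q\<close> recover the parameters.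
\<close>

definition curve :: "nat \<Rightarrow> ('a \<Rightarrow> 'a list) \<Rightarrow> nat \<Rightarrow> 'a \<Rightarrow> 'a \<Rightarrow> bool" where
  "curve n \<phi> p a b \<longleftrightarrow> a < b \<and> p < n \<and> dlist M n (\<lambda>e. \<phi> (e 0)) \<and>
    (\<forall>t. a < t \<and> t < b \<longrightarrow> \<phi> t ! p = t) \<and>
    (\<forall>a' b'. a \<le> a' \<and> a' < b' \<and> b' \<le> b \<longrightarrow> cell M n 1 {\<phi> t |t. a' < t \<and> t < b'})"

definition surface :: "nat \<Rightarrow> ('a \<Rightarrow> 'a \<Rightarrow> 'a list) \<Rightarrow> nat \<Rightarrow> nat \<Rightarrow> 'a \<Rightarrow> 'a \<Rightarrow> 'a \<Rightarrow> 'a \<Rightarrow> bool" where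
  "surface n \<phi> p q a b c d \<longleftrightarrow> a < b \<and> c < d \<and> p < n \<and> q < n \<and> dlist M n (\<lambda>e. \<phi> (e 0) (e 1)) \<and>
    (\<forall>t s. a < t \<and> t < b \<and> c < s \<and> s < d \<longrightarrow> \<phi> t s ! p = t \<and> \<phi> t s ! q = s) \<and>
    (\<forall>a' b' c' d'. a \<le> a' \<and> a' < b' \<and> b' \<le> b \<and> c \<le> c' \<and> c' < d' \<and> d' \<le> d \<longrightarrow>
       cell M n 2 {\<phi> t s |t s. a' < t \<and> t < b' \<and> c' < s \<and> s < d'})"

lemma dlist_length1: "dlist M n (\<lambda>e. \<phi> (e 0)) \<Longrightarrow> length (\<phi> x) = n"
  by (drule conjunct1[OF iffD1[OF dlist_def]], drule spec[of _ "\<lambda>_. x"])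

lemma dlist_length2: "dlist M n (\<lambda>e. \<phi> (e 0) (e 1)) \<Longrightarrow> length (\<phi> x y) = n"
  by (drule conjunct1[OF iffD1[OF dlist_def]], drule spec[of _ "case_nat x (\<lambda>_. y)"]) simp

lemma dlist_comp1:
  assumes "dlist M n (\<lambda>e. \<phi> (e 0))" "dtm M t"
  shows "dlist M n (\<lambda>e. \<phi> (t e))"
proof -
  have "dtm M (\<lambda>e. \<phi> (t e) ! i)" if "i < n" for i
    using dtm_fun1[of M "\<lambda>x. \<phi> x ! i" t] assms that unfolding dlist_def dfun1_def by blast
  moreover have "length (\<phi> x) = n" for x by (rule dlist_length1[OF assms(1)])
  ultimately show ?thesis unfolding dlist_def by blast
qed

lemma dlist_comp2:
  assumes "dlist M n (\<lambda>e. \<phi> (e 0) (e 1))" "dtm M t" "dtm M u"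
  shows "dlist M n (\<lambda>e. \<phi> (t e) (u e))"
proof -
  have "dtm M (\<lambda>e. \<phi> (t e) (u e) ! i)" if "i < n" for i
    using dtm_fun2[of M "\<lambda>x y. \<phi> x y ! i" t u] assms that unfolding dlist_def dfun2_def by blast
  moreover have "length (\<phi> x y) = n" for x y by (rule dlist_length2[OF assms(1)])
  ultimately show ?thesis unfolding dlist_def by blast
qed

lemma definable_eq_list:
  assumes "dlist M n u"
  shows "dfn M (\<lambda>e. map (\<lambda>i. e (r i)) [0..<n] = u e)"
proof -
  have "dfn M (\<lambda>e. \<forall>i\<in>{..<n}. e (r i) = u e ! i)"
    by (intro dfn_finite_all dfn_eq finite_lessThan dtm_var dtm_nth[OF assms]) auto
  moreover have "(\<forall>i\<in>{..<n}. e (r i) = u e ! i) \<longleftrightarrow> map (\<lambda>i. e (r i)) [0..<n] = u e" for e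
    using assms by (auto simp: dlist_def list_eq_iff_nth_eq)
  ultimately show ?thesis by simp
qed

lemma curve_length: "curve n \<phi> p a b \<Longrightarrow> length (\<phi> t) = n"
  unfolding curve_def using dlist_length1 by blast

lemma surface_length: "surface n \<phi> p q a b c d \<Longrightarrow> length (\<phi> t s) = n"
  unfolding surface_def using dlist_length2 by blast

lemma definable_curve:
  assumes "dlist M n (\<lambda>e. \<phi> (e 0))"
  shows "definable M n {\<phi> t |t. a < t \<and> t < b}"
proof (rule definableI[where P = "\<lambda>xs. \<exists>t. a < t \<and> t < b \<and> xs = \<phi> t"])
  show "dfn M (\<lambda>e. \<exists>t. a < t \<and> t < b \<and> map e [0..<n] = \<phi> t)"
    by (intro dfn_rules definable_eq_list assms)
  show "xs \<in> {\<phi> t |t. a < t \<and> t < b} \<longleftrightarrow> length xs = n \<and> (\<exists>t. a < t \<and> t < b \<and> xs = \<phi> t)" for xs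
    using dlist_length1[OF assms] by blast
qed

lemma definable_surface:
  assumes "dlist M n (\<lambda>e. \<phi> (e 0) (e 1))"
  shows "definable M n {\<phi> t s |t s. a < t \<and> t < b \<and> c < s \<and> s < d}"
proof (rule definableI[where P = "\<lambda>xs. \<exists>t s. a < t \<and> t < b \<and> c < s \<and> s < d \<and> xs = \<phi> t s"])
  show "dfn M (\<lambda>e. \<exists>t s. a < t \<and> t < b \<and> c < s \<and> s < d \<and> map e [0..<n] = \<phi> t s)"
    by (intro dfn_rules definable_eq_list dlist_comp2[OF assms])
  show "xs \<in> {\<phi> t s |t s. a < t \<and> t < b \<and> c < s \<and> s < d} \<longleftrightarrow>
    length xs = n \<and> (\<exists>t s. a < t \<and> t < b \<and> c < s \<and> s < d \<and> xs = \<phi> t s)" for xs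
    using dlist_length2[OF assms] by blast
qed

text \<open>The parameter is coordinate p of the point, so h becomes a function on the cell itself.
  It is definable and continuous after the interval has been shrunk, and the graph clause for cells
  applies over every subinterval.\<close>

lemma curve_graph:
  assumes \<phi>: "curve n \<phi> p a b" and h: "dfun1 M h"
  obtains a' b' where "a \<le> a'" "b' \<le> b" "curve (Suc n) (\<lambda>t. \<phi> t @ [h t]) p a' b'"
proof -
  note \<phi>' = \<phi>[unfolded curve_def]
  obtain a1 b1 where 1: "a \<le> a1" "a1 < b1" "b1 \<le> b" "\<And>t. a1 < t \<Longrightarrow> t < b1 \<Longrightarrow> cont_at h t"
    by (rule continuous_subinterval[OF h, of a b]) (use \<phi>' in blast, rule that)
  have "cell M (Suc n) 1 {\<phi> t @ [h t] |t. a' < t \<and> t < b'}"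
    if ab: "a1 \<le> a'" "a' < b'" "b' \<le> b1" for a' b'
  proof -
    define C where "C = {\<phi> t |t. a' < t \<and> t < b'}"
    have p: "\<phi> t ! p = t" if "a' < t" "t < b'" for t using \<phi>' 1 ab that by auto
    have "a \<le> a'" "b' \<le> b" using ab 1 by auto
    then have "cell M n 1 C" using \<phi>' ab(2) unfolding C_def by blast
    moreover have "definable_continuous M n C (\<lambda>x. h (x ! p))"
    proof (rule definable_continuousI)
      show "definable M n C" unfolding C_def using \<phi>' by (intro definable_curve) blast
      show "dlfun n (\<lambda>x. h (x ! p))" unfolding dlfun_def
        by (intro dtm_fun1[OF h] dtm_nth[OF dlist_id]) (use \<phi>' in blast)
      fix x \<epsilon> assume "x \<in> C" "\<epsilon> > (0::'a)"
      then obtain t where t: "x = \<phi> t" "a' < t" "t < b'" unfolding C_def by blast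
      then have "cont_at h t" using 1(4) ab by auto
      then obtain \<delta> where \<delta>: "\<delta> > 0" "\<And>u. \<bar>u - t\<bar> < \<delta> \<Longrightarrow> \<bar>h u - h t\<bar> < \<epsilon>"
        using cont_atD[OF _ \<open>\<epsilon> > 0\<close>] by blast
      have "\<bar>h (y ! p) - h (x ! p)\<bar> < \<epsilon>" if "\<forall>i<n. \<bar>y ! i - x ! i\<bar> < \<delta>" for y
        using \<delta>(2)[of "y ! p"] that p[OF t(2,3)] \<phi>' t(1) by auto
      then show "\<exists>\<delta>>0. \<forall>y\<in>C. (\<forall>i<n. \<bar>y ! i - x ! i\<bar> < \<delta>) \<longrightarrow> \<bar>h (y ! p) - h (x ! p)\<bar> < \<epsilon>"
        using \<delta>(1) by blast
    qed
    ultimately have "cell M (Suc n) 1 {x @ [h (x ! p)] |x. x \<in> C}" by (rule cell.graph)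
    moreover have "{x @ [h (x ! p)] |x. x \<in> C} = {\<phi> t @ [h t] |t. a' < t \<and> t < b'}"
      unfolding C_def using p by fastforce
    ultimately show ?thesis by simp
  qed
  moreover have "(\<phi> t @ [h t]) ! p = t" if "a1 < t" "t < b1" for t
  proof -
    have "\<phi> t ! p = t" "p < n" using \<phi>' 1 that by auto
    then show ?thesis by (simp add: nth_append curve_length[OF \<phi>])
  qed
  moreover have "dlist M (Suc n) (\<lambda>e. \<phi> (e 0) @ [h (e 0)])"
    using \<phi>' by (intro dlist_snoc dtm_fun1[OF h] dtm_var) blast
  moreover have "p < Suc n" using \<phi>' by auto
  ultimately have "curve (Suc n) (\<lambda>t. \<phi> t @ [h t]) p a1 b1" unfolding curve_def using 1(2) by blast
  then show ?thesis using that[of a1 b1] 1 by blast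
qed

text \<open>As for curves, with \<open>continuity_on_box\<close> providing the subbox on which the
  new coordinate is jointly continuous.\<close>

lemma surface_graph:
  assumes \<phi>: "surface n \<phi> p q a b c d" and h: "dfun2 M h"
  obtains a' b' c' d' where "a \<le> a'" "b' \<le> b" "c \<le> c'" "d' \<le> d"
    "surface (Suc n) (\<lambda>t s. \<phi> t s @ [h t s]) p q a' b' c' d'"
proof -
  note \<phi>' = \<phi>[unfolded surface_def]
  have dl: "dlist M n (\<lambda>e. \<phi> (e 0) (e 1))" and pq: "p < n" "q < n" using \<phi>' by blast+
  obtain a1 b1 c1 d1 where 1: "a \<le> a1" "a1 < b1" "b1 \<le> b" "c \<le> c1" "c1 < d1" "d1 \<le> d"
    "\<And>t s. a1 < t \<Longrightarrow> t < b1 \<Longrightarrow> c1 < s \<Longrightarrow> s < d1 \<Longrightarrow> cont2_at h t s"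
    by (rule continuity_on_box[OF h, of a b c d]) (use \<phi>' in blast, use \<phi>' in blast, rule that)
  have pt: "\<phi> t s ! p = t" "\<phi> t s ! q = s" if "a1 < t" "t < b1" "c1 < s" "s < d1" for t s
  proof -
    have "a < t" "t < b" "c < s" "s < d" using that 1(1,3,4,6) by auto
    then show "\<phi> t s ! p = t" "\<phi> t s ! q = s" using \<phi>' by blast+
  qed
  have "cell M (Suc n) 2 {\<phi> t s @ [h t s] |t s. a' < t \<and> t < b' \<and> c' < s \<and> s < d'}"
    if ab: "a1 \<le> a'" "a' < b'" "b' \<le> b1" "c1 \<le> c'" "c' < d'" "d' \<le> d1" for a' b' c' d'
  proof -
    define C where "C = {\<phi> t s |t s. a' < t \<and> t < b' \<and> c' < s \<and> s < d'}"
    have bd: "a1 < t" "t < b1" "c1 < s" "s < d1" if "a' < t" "t < b'" "c' < s" "s < d'" for t s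
      using that ab by auto
    have "a \<le> a'" "b' \<le> b" "c \<le> c'" "d' \<le> d" using ab 1(1,3,4,6) by auto
    then have "cell M n 2 C" using \<phi>' ab(2,5) unfolding C_def by blast
    moreover have "definable_continuous M n C (\<lambda>x. h (x ! p) (x ! q))"
    proof (rule definable_continuousI)
      show "definable M n C" unfolding C_def by (rule definable_surface[OF dl])
      show "dlfun n (\<lambda>x. h (x ! p) (x ! q))" unfolding dlfun_def
        by (intro dtm_fun2[OF h] dtm_nth[OF dlist_id] pq)
      fix x \<epsilon> assume "x \<in> C" "\<epsilon> > (0::'a)"
      then obtain t s where t: "x = \<phi> t s" "a' < t" "t < b'" "c' < s" "s < d'" unfolding C_def by blast
      have x: "x ! p = t" "x ! q = s" using pt[OF bd[OF t(2-5)]] t(1) by auto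
      have "cont2_at h t s" by (rule 1(7)[OF bd[OF t(2-5)]])
      then obtain \<delta> where \<delta>: "\<delta> > 0"
        "\<And>t' s'. \<bar>t' - t\<bar> < \<delta> \<Longrightarrow> \<bar>s' - s\<bar> < \<delta> \<Longrightarrow> \<bar>h t' s' - h t s\<bar> < \<epsilon>"
        unfolding cont2_at_def using \<open>\<epsilon> > 0\<close> by blast
      have "\<bar>h (y ! p) (y ! q) - h (x ! p) (x ! q)\<bar> < \<epsilon>" if "\<forall>i<n. \<bar>y ! i - x ! i\<bar> < \<delta>" for y
        unfolding x by (rule \<delta>(2)) (use that pq x in auto)
      then show "\<exists>\<delta>>0. \<forall>y\<in>C. (\<forall>i<n. \<bar>y ! i - x ! i\<bar> < \<delta>) \<longrightarrow>
          \<bar>h (y ! p) (y ! q) - h (x ! p) (x ! q)\<bar> < \<epsilon>"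
        using \<delta>(1) by blast
    qed
    ultimately have "cell M (Suc n) 2 {x @ [h (x ! p) (x ! q)] |x. x \<in> C}" by (rule cell.graph)
    moreover have "{x @ [h (x ! p) (x ! q)] |x. x \<in> C} =
        {\<phi> t s @ [h t s] |t s. a' < t \<and> t < b' \<and> c' < s \<and> s < d'}" (is "?L = ?R")
    proof (intro set_eqI iffI)
      fix z assume "z \<in> ?L"
      then obtain t s where *: "z = \<phi> t s @ [h (\<phi> t s ! p) (\<phi> t s ! q)]" "a' < t" "t < b'" "c' < s" "s < d'"
        unfolding C_def by blast
      then have "z = \<phi> t s @ [h t s]" using pt[OF bd[OF *(2-5)]] by simp
      then show "z \<in> ?R" using *(2-5) by blast
    next
      fix z assume "z \<in> ?R"
      then obtain t s where *: "z = \<phi> t s @ [h t s]" "a' < t" "t < b'" "c' < s" "s < d'"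
        by blast
      then have "z = \<phi> t s @ [h (\<phi> t s ! p) (\<phi> t s ! q)]" using pt[OF bd[OF *(2-5)]] by simp
      then show "z \<in> ?L" using *(2-5) unfolding C_def by blast
    qed
    ultimately show ?thesis by simp
  qed
  moreover have "(\<phi> t s @ [h t s]) ! p = t \<and> (\<phi> t s @ [h t s]) ! q = s"
    if "a1 < t" "t < b1" "c1 < s" "s < d1" for t s
    using pt[OF that] pq by (simp add: nth_append surface_length[OF \<phi>])
  moreover have "dlist M (Suc n) (\<lambda>e. \<phi> (e 0) (e 1) @ [h (e 0) (e 1)])"
    by (intro dlist_snoc dl dtm_fun2[OF h] dtm_var)
  moreover have "p < Suc n" "q < Suc n" using pq by auto
  ultimately have "surface (Suc n) (\<lambda>t s. \<phi> t s @ [h t s]) p q a1 b1 c1 d1"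
    unfolding surface_def using 1(2,5) by blast
  then show ?thesis using that[of a1 b1 c1 d1] 1(1,3,4,6) by blast
qed

lemma cell_product:
  assumes "cell M n k C" "definable M n C" "c < d"
  shows "cell M (Suc n) (Suc k) {x @ [y] |x y. x \<in> C \<and> c < y \<and> y < d}"
  using cell.band[OF assms(1), of "Some (\<lambda>_. c)" "Some (\<lambda>_. d)"] definable_continuous_const[OF assms(2)]
    assms(3) by simp

lemma curve_over_point:
  assumes "length x = n" "c < d"
  shows "curve (Suc n) (\<lambda>t. x @ [t]) n c d"
  unfolding curve_def
proof (intro conjI allI impI)
  show "dlist M (Suc n) (\<lambda>e. x @ [e 0])" by (intro dlist_snoc dlist_const assms dtm_var)
  fix a' b' assume *: "c \<le> a' \<and> a' < b' \<and> b' \<le> d"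
  have "cell M (Suc n) (Suc 0) {z @ [y] |z y. z \<in> {x} \<and> a' < y \<and> y < b'}"
    by (rule cell_product[OF cell_point[OF assms(1)] definable_singleton[OF assms(1)]]) (use * in blast)
  then show "cell M (Suc n) 1 {x @ [t] |t. a' < t \<and> t < b'}" by simp
qed (use assms in \<open>auto simp: nth_append\<close>)

lemma surface_over_curve:
  assumes \<phi>: "curve n \<phi> p a b" and "c < d"
  shows "surface (Suc n) (\<lambda>t s. \<phi> t @ [s]) p n a b c d"
  unfolding surface_def
proof (intro conjI allI impI)
  note \<phi>' = \<phi>[unfolded curve_def]
  have dl: "dlist M n (\<lambda>e. \<phi> (e 0))" using \<phi>' by blast
  show "dlist M (Suc n) (\<lambda>e. \<phi> (e 0) @ [e 1])" by (intro dlist_snoc dl dtm_var)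
  show "a < b" "p < Suc n" "n < Suc n" "c < d" using \<phi>' assms by auto
  show "(\<phi> t @ [s]) ! p = t" "(\<phi> t @ [s]) ! n = s" if "a < t \<and> t < b \<and> c < s \<and> s < d" for t s
    using \<phi>' that curve_length[OF \<phi>, of t] by (auto simp: nth_append)
  fix a' b' c' d' assume *: "a \<le> a' \<and> a' < b' \<and> b' \<le> b \<and> c \<le> c' \<and> c' < d' \<and> d' \<le> d"
  have "cell M n 1 {\<phi> t |t. a' < t \<and> t < b'}" using \<phi>' * by blast
  then have "cell M (Suc n) (Suc 1) {x @ [y] |x y. x \<in> {\<phi> t |t. a' < t \<and> t < b'} \<and> c' < y \<and> y < d'}"
    by (rule cell_product[OF _ definable_curve[OF dl]]) (use * in blast)
  moreover have "{x @ [y] |x y. x \<in> {\<phi> t |t. a' < t \<and> t < b'} \<and> c' < y \<and> y < d'} =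
     {\<phi> t @ [s] |t s. a' < t \<and> t < b' \<and> c' < s \<and> s < d'}" by blast
  ultimately show "cell M (Suc n) 2 {\<phi> t @ [s] |t s. a' < t \<and> t < b' \<and> c' < s \<and> s < d'}"
    by (simp add: numeral_2_eq_2)
qed

section \<open>Definable injections into the unit interval\<close>

definition squash :: "'a \<Rightarrow> 'a" where
  "squash x = (x / (1 + \<bar>x\<bar>) + 1) / 2"

lemma squash_range: "0 < squash x" "squash x < 1"
proof -
  have "\<bar>x / (1 + \<bar>x\<bar>)\<bar> < 1" by (simp add: abs_divide divide_less_eq)
  moreover have "0 < (q + 1) / 2" "(q + 1) / 2 < 1" if "\<bar>q\<bar> < 1" for q :: 'a
  proof -
    have "0 < q + 1" using that by linarith
    moreover have "q + 1 < 2" using that by linarith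
    ultimately show "0 < (q + 1) / 2" "(q + 1) / 2 < 1" by simp_all
  qed
  ultimately show "0 < squash x" "squash x < 1" unfolding squash_def by blast+
qed

lemma squash_inject: "squash x = squash y \<longleftrightarrow> x = y"
proof
  \<comment> \<open>The inverse of x \<mapsto> x / (1 + |x|) is q \<mapsto> q / (1 - |q|).\<close>
  have inv: "(x / (1 + \<bar>x\<bar>)) / (1 - \<bar>x / (1 + \<bar>x\<bar>)\<bar>) = x" for x :: 'a
  proof -
    have "1 + \<bar>x\<bar> > 0" by (simp add: add_pos_nonneg)
    then have "1 - \<bar>x / (1 + \<bar>x\<bar>)\<bar> = 1 / (1 + \<bar>x\<bar>)" by (simp add: abs_divide field_simps)
    then show ?thesis using \<open>1 + \<bar>x\<bar> > 0\<close> by simp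
  qed
  assume "squash x = squash y"
  moreover have "u = v" if "(u + 1) / 2 = (v + 1) / 2" for u v :: 'a using that by simp
  ultimately have "x / (1 + \<bar>x\<bar>) = y / (1 + \<bar>y\<bar>)" unfolding squash_def by blast
  then show "x = y" using inv[of x] inv[of y] by simp
qed simp

lemma dtm_squash: "dtm M t \<Longrightarrow> dtm M (\<lambda>e. squash (t e))"
  unfolding squash_def by (intro dfn_rules)

definition embeddable :: "nat \<Rightarrow> 'a list set \<Rightarrow> bool" where
  "embeddable n X \<longleftrightarrow> (\<exists>g. dlfun n g \<and> inj_on g X \<and> (\<forall>x\<in>X. 0 < g x \<and> g x < 1))"

lemma embeddable_subset: "embeddable n X \<Longrightarrow> Y \<subseteq> X \<Longrightarrow> embeddable n Y"
  unfolding embeddable_def using inj_on_subset by blast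

lemma embeddable_empty: "embeddable n {}"
  unfolding embeddable_def by (intro exI[of _ "\<lambda>_. 0"]) (simp add: dlfun_def dtm_const)

text \<open>The two halves of the unit interval keep the values apart: \<open>X\<close> goes to the
  lower half, the points of \<open>Y\<close> outside \<open>X\<close> to the upper half.\<close>

lemma embeddable_Un:
  assumes "definable M n X" "embeddable n X" "embeddable n Y"
  shows "embeddable n (X \<union> Y)"
proof -
  obtain g h where g: "dlfun n g" "inj_on g X" "\<And>x. x \<in> X \<Longrightarrow> 0 < g x \<and> g x < 1"
    and h: "dlfun n h" "inj_on h Y" "\<And>x. x \<in> Y \<Longrightarrow> 0 < h x \<and> h x < 1"
    using assms(2,3) unfolding embeddable_def by blast
  define k where "k x = (if x \<in> X then g x / 2 else (1 + h x) / 2)" for x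
  have "dlfun n k" using g(1) h(1) unfolding dlfun_def k_def
    by (intro dfn_rules dfn_mem[OF assms(1)] dlist_id)
  moreover have "x = y" if xy: "x \<in> X \<union> Y" "y \<in> X \<union> Y" "k x = k y" for x y
  proof -
    have *: "False" if "u \<in> X" "v \<in> Y" "v \<notin> X" "k u = k v" for u v
      using that g(3)[of u] h(3)[of v] unfolding k_def by auto
    consider "x \<in> X" "y \<in> X" | "x \<notin> X" "y \<notin> X" | "x \<in> X" "y \<notin> X" | "x \<notin> X" "y \<in> X" by blast
    then show ?thesis
    proof cases
      case 1
      then show ?thesis using xy(3) g(2) by (simp add: k_def inj_on_eq_iff)
    next
      case 2
      then have "x \<in> Y" "y \<in> Y" using xy by auto
      then show ?thesis using 2 xy(3) h(2) by (simp add: k_def inj_on_eq_iff)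
    qed (use * xy in blast, use *[of y x] xy in auto)
  qed
  moreover have "0 < k x \<and> k x < 1" if "x \<in> X \<union> Y" for x
    using that g(3)[of x] h(3)[of x] unfolding k_def by auto
  ultimately show ?thesis unfolding embeddable_def inj_on_def by blast
qed

lemma embeddable_fibre:
  assumes "length a = n"
  shows "embeddable (Suc n) {a @ [y] |y. True}"
  unfolding embeddable_def
proof (intro exI[of _ "\<lambda>x. squash (x ! n)"] conjI)
  show "dlfun (Suc n) (\<lambda>x. squash (x ! n))"
    unfolding dlfun_def by (intro dtm_squash dtm_nth[OF dlist_id]) simp
  show "inj_on (\<lambda>x. squash (x ! n)) {a @ [y] |y. True}"
    using assms by (auto simp: inj_on_def squash_inject nth_append)
qed (use squash_range in auto)

lemma embeddable_UN:
  assumes "finite A" "\<And>a. a \<in> A \<Longrightarrow> definable M n (X a) \<and> embeddable n (X a)"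
  shows "embeddable n (\<Union>a\<in>A. X a)"
  using assms by induction (auto intro: embeddable_empty embeddable_Un)

text \<open>Induction on the bound for the fibres: the least point of the fibre over t is coded by t
  itself in the lower half of the unit interval, and the remaining points go recursively to the
  upper half.\<close>

lemma planar_injection:
  assumes "dfn M (\<lambda>e. Y (e 0) (e 1))" "\<And>t. finite {s. Y t s} \<and> card {s. Y t s} \<le> N"
  shows "\<exists>g. dfun2 M g \<and> (\<forall>t s t' s'. Y t s \<and> Y t' s' \<and> g t s = g t' s' \<longrightarrow> t = t' \<and> s = s') \<and>
    (\<forall>t s. Y t s \<longrightarrow> 0 < g t s \<and> g t s < 1)"
  using assms
proof (induction N arbitrary: Y)
  case 0
  then have "\<not> Y t s" for t s using card_0_eq by fastforce
  moreover have "dfun2 M (\<lambda>_ _. 0)" unfolding dfun2_def by (rule dtm_const)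
  ultimately show ?case by blast
next
  case (Suc N)
  note Yr = dfn_rel2[OF Suc.prems(1)]
  define m where "m t = skolem {s. Y t s \<and> (\<forall>u. Y t u \<longrightarrow> s \<le> u)}" for t
  have m: "dfun1 M m" unfolding dfun1_def m_def by (intro dtm_skolem dfn_rules Yr)
  have mY: "Y t (m t)" if "Y t s" for t s
  proof -
    define S where "S = {s. Y t s \<and> (\<forall>u. Y t u \<longrightarrow> s \<le> u)}"
    have "dset S" unfolding S_def dset_Collect by (intro dfn_rules Yr)
    moreover have "Min {s. Y t s} \<in> {s. Y t s}" using Suc.prems(2) that by (intro Min_in) auto
    then have "Min {s. Y t s} \<in> S" using Suc.prems(2)[of t] unfolding S_def by auto
    ultimately have "skolem S \<in> S" using skolem_in by blast
    then show ?thesis unfolding m_def S_def by blast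
  qed
  define Y' where "Y' t s \<longleftrightarrow> Y t s \<and> s \<noteq> m t" for t s
  have dY': "dfn M (\<lambda>e. Y' (e 0) (e 1))" unfolding Y'_def by (intro dfn_rules Yr dtm_fun1[OF m])
  have "finite {s. Y' t s} \<and> card {s. Y' t s} \<le> N" for t
  proof (cases "\<exists>s. Y t s")
    case True
    then have "m t \<in> {s. Y t s}" using mY by auto
    moreover have "{s. Y' t s} = {s. Y t s} - {m t}" by (auto simp: Y'_def)
    ultimately have "finite {s. Y' t s}" "card {s. Y' t s} = card {s. Y t s} - 1"
      using conjunct1[OF Suc.prems(2)[of t]] by (simp_all only: finite_Diff card_Diff_singleton)
    then show ?thesis using conjunct2[OF Suc.prems(2)[of t]] by linarith
  qed (simp add: Y'_def)
  from Suc.IH[OF dY' this] obtain g where g: "dfun2 M g"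
    "\<And>t s t' s'. Y' t s \<Longrightarrow> Y' t' s' \<Longrightarrow> g t s = g t' s' \<Longrightarrow> t = t' \<and> s = s'"
    "\<And>t s. Y' t s \<Longrightarrow> 0 < g t s \<and> g t s < 1"
    by blast
  define h where "h t s = (if s = m t then squash t / 2 else (1 + g t s) / 2)" for t s
  have "dfun2 M h" unfolding dfun2_def h_def
    by (intro dfn_rules dtm_squash dtm_fun1[OF m] dtm_fun2[OF g(1)])
  moreover have "t = t' \<and> s = s'" if *: "Y t s" "Y t' s'" "h t s = h t' s'" for t s t' s'
  proof -
    have no: False if "u = m v" "u' \<noteq> m v'" "Y v' u'" "h v u = h v' u'" for u v u' v'
    proof -
      have "squash v / 2 = (1 + g v' u') / 2" using that unfolding h_def by simp
      moreover have "0 < g v' u'" using g(3) that unfolding Y'_def by blast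
      ultimately show False using squash_range(2)[of v] by auto
    qed
    consider "s = m t" "s' = m t'" | "s = m t" "s' \<noteq> m t'" | "s \<noteq> m t" "s' = m t'"
      | "s \<noteq> m t" "s' \<noteq> m t'" by blast
    then show ?thesis
    proof cases
      case 1
      then have "squash t = squash t'" using *(3) unfolding h_def by simp
      then show ?thesis using 1 squash_inject by simp
    next
      case 2
      then show ?thesis using no[OF 2 *(2,3)] by blast
    next
      case 3
      then show ?thesis using no[OF 3(2,1) *(1) *(3)[symmetric]] by blast
    next
      case 4
      then have "g t s = g t' s'" using *(3) unfolding h_def by simp
      then show ?thesis using g(2)[of t s t' s'] 4 * unfolding Y'_def by blast
    qed
  qed
  moreover have "0 < h t s \<and> h t s < 1" if "Y t s" for t s
  proof (cases "s = m t")
    case True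
    then show ?thesis using squash_range[of t] unfolding h_def by auto
  next
    case False
    then have "0 < g t s" "g t s < 1" using g(3)[of t s] that unfolding Y'_def by blast+
    then show ?thesis using False unfolding h_def by auto
  qed
  ultimately show ?case by blast
qed

lemma definable_projection:
  assumes "definable M (Suc n) X"
  shows "definable M n {a. length a = n \<and> (\<exists>y. a @ [y] \<in> X)}"
proof (rule definableI[where P = "\<lambda>a. \<exists>y. a @ [y] \<in> X"])
  show "dfn M (\<lambda>e. \<exists>y. map e [0..<n] @ [y] \<in> X)"
    by (intro dfn_ex dfn_mem[OF assms] dlist_snoc dlist_env dtm_var)
qed simp

lemma dset_fibre_list:
  assumes "definable M (Suc n) X" "length a = n"
  shows "dset {y. a @ [y] \<in> X}"
  unfolding dset_Collect by (intro dfn_mem[OF assms(1)] dlist_snoc dlist_const dtm_var assms(2))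

text \<open>If the projection is finite, some vertical fibre is infinite and contains an interval.
  Otherwise the projection contains a curve by induction, and definable choice of the last
  coordinate lifts it, after shrinking the interval.\<close>

lemma infinite_contains_curve:
  "definable M n X \<Longrightarrow> infinite X \<Longrightarrow> \<exists>\<phi> p a b. curve n \<phi> p a b \<and> (\<forall>t. a < t \<and> t < b \<longrightarrow> \<phi> t \<in> X)"
proof (induction n arbitrary: X)
  case 0
  then have "X \<subseteq> {[]}" using definable_length by fastforce
  then show ?case using 0 finite_subset by blast
next
  case (Suc n)
  define A where "A = {a. length a = n \<and> (\<exists>y. a @ [y] \<in> X)}"
  have A: "definable M n A" unfolding A_def by (rule definable_projection[OF Suc.prems(1)])
  show ?case
  proof (cases "finite A")
    case True
    have "X \<subseteq> (\<Union>a\<in>A. (\<lambda>y. a @ [y]) ` {y. a @ [y] \<in> X})"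
    proof
      fix x assume "x \<in> X"
      moreover then obtain a y where "x = a @ [y]" "length a = n"
        using definable_length[OF Suc.prems(1)] by (metis length_Suc_conv_rev)
      ultimately show "x \<in> (\<Union>a\<in>A. (\<lambda>y. a @ [y]) ` {y. a @ [y] \<in> X})" unfolding A_def by blast
    qed
    then have "\<exists>a\<in>A. infinite {y. a @ [y] \<in> X}"
      using Suc.prems(2) True finite_subset finite_UN finite_imageI by (metis (no_types, lifting))
    then obtain a where a: "length a = n" "infinite {y. a @ [y] \<in> X}" unfolding A_def by blast
    obtain c d where cd: "c < d" "{c<..<d} \<subseteq> {y. a @ [y] \<in> X}"
      by (rule infinite_interval[OF dset_fibre_list[OF Suc.prems(1) a(1)] a(2)]) (rule that)
    have "curve (Suc n) (\<lambda>t. a @ [t]) n c d" by (rule curve_over_point[OF a(1) cd(1)])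
    then show ?thesis using cd(2) by (intro exI conjI) auto
  next
    case False
    obtain \<phi> p a b where \<phi>: "curve n \<phi> p a b" "\<And>t. a < t \<Longrightarrow> t < b \<Longrightarrow> \<phi> t \<in> A"
      using Suc.IH[OF A False] by blast
    have dl: "dlist M n (\<lambda>e. \<phi> (e 0))" using \<phi>(1) unfolding curve_def by blast
    define h where "h t = skolem {y. \<phi> t @ [y] \<in> X}" for t
    have h: "dfun1 M h" unfolding dfun1_def h_def
      by (intro dtm_skolem dfn_mem[OF Suc.prems(1)] dlist_snoc dlist_comp1[OF dl] dtm_var)
    have hX: "\<phi> t @ [h t] \<in> X" if "a < t" "t < b" for t
    proof -
      have "{y. \<phi> t @ [y] \<in> X} \<noteq> {}" using \<phi>(2)[OF that] unfolding A_def by blast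
      then show ?thesis
        using skolem_in[OF dset_fibre_list[OF Suc.prems(1) curve_length[OF \<phi>(1)]]] unfolding h_def by blast
    qed
    obtain a' b' where "a \<le> a'" "b' \<le> b" "curve (Suc n) (\<lambda>t. \<phi> t @ [h t]) p a' b'"
      by (rule curve_graph[OF \<phi>(1) h]) (rule that)
    then show ?thesis using hX by (meson le_less_trans less_le_trans)
  qed
qed

text \<open>The embedding of the projection replaces the first n coordinates by one parameter and
  \<open>squash\<close> bounds the last coordinate. This leaves a planar relation with finite fibres
  in the unit interval, to which uniform finiteness and \<open>planar_injection\<close>
  apply.\<close>

lemma embeddable_finite_fibres:
  assumes X: "definable M (Suc n) X" and fin: "\<And>a. length a = n \<Longrightarrow> finite {y. a @ [y] \<in> X}"
    and "embeddable n {a. length a = n \<and> (\<exists>y. a @ [y] \<in> X)}"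
  shows "embeddable (Suc n) X"
proof -
  define A where "A = {a. length a = n \<and> (\<exists>y. a @ [y] \<in> X)}"
  have A: "definable M n A" unfolding A_def by (rule definable_projection[OF X])
  obtain g where g: "dlfun n g" "inj_on g A"
    using assms(3) unfolding embeddable_def A_def by blast
  define Y where "Y t s \<longleftrightarrow> (\<exists>a. length a = n \<and> (a \<in> A \<and> g a = t \<and> (\<exists>y. a @ [y] \<in> X \<and> squash y = s)))" for t s
  have Y: "dfn M (\<lambda>e. Y (e 0) (e 1))"
    unfolding Y_def
    by (intro dfn_exlist dfn_rules dfn_mem[OF A] dfn_mem[OF X] dlist_id dlist_snoc dlist_env
        dtm_squash dtm_lfun[OF g(1)])
  have finY: "finite {s. Y t s}" for t
  proof (cases "\<exists>a\<in>A. g a = t")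
    case True
    then obtain a where a: "a \<in> A" "g a = t" by blast
    have "{s. Y t s} \<subseteq> squash ` {y. a @ [y] \<in> X}"
      using a g(2) unfolding Y_def by (auto dest: inj_onD)
    moreover have "length a = n" using a(1) by (simp add: A_def)
    ultimately show ?thesis using fin finite_subset by blast
  next
    case False
    then have "{s. Y t s} = {}" unfolding Y_def by blast
    then show ?thesis by simp
  qed
  have bd: "0 \<le> s \<and> s \<le> 1" if "Y t s" for t s
    using that squash_range unfolding Y_def by (metis less_imp_le)
  obtain N where "\<And>t. card {s. Y t s} \<le> N"
    by (rule uniform_finiteness[OF Y finY]) (erule bd, rule that)
  then have "finite {s. Y t s} \<and> card {s. Y t s} \<le> N" for t using finY by blast
  from planar_injection[OF Y this] obtain h where h: "dfun2 M h"
    "\<And>t s t' s'. Y t s \<Longrightarrow> Y t' s' \<Longrightarrow> h t s = h t' s' \<Longrightarrow> t = t' \<and> s = s'"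
    "\<And>t s. Y t s \<Longrightarrow> 0 < h t s \<and> h t s < 1"
    by blast
  define k where "k x = h (g (take n x)) (squash (x ! n))" for x
  have tk: "take n (map e [0..<Suc n]) = map e [0..<n]" for e :: "nat \<Rightarrow> 'a" by (simp add: take_map)
  have "dlfun (Suc n) k" unfolding dlfun_def k_def tk
    by (intro dtm_fun2[OF h(1)] dtm_squash dtm_nth[OF dlist_id] dtm_lfun[OF g(1)] dlist_id) simp
  moreover have split: "\<exists>a y. x = a @ [y] \<and> a \<in> A \<and> k x = h (g a) (squash y) \<and> Y (g a) (squash y)"
    if x: "x \<in> X" for x
  proof -
    obtain a y where ay: "x = a @ [y]" "length a = n"
      using definable_length[OF X x] by (metis length_Suc_conv_rev)
    then have "a \<in> A" using x unfolding A_def by blast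
    then have "Y (g a) (squash y)" using ay x unfolding Y_def by blast
    then show ?thesis using ay \<open>a \<in> A\<close> by (auto simp: k_def nth_append)
  qed
  moreover have "x = x'" if xx: "x \<in> X" "x' \<in> X" "k x = k x'" for x x'
  proof -
    obtain a y where 1: "x = a @ [y]" "a \<in> A" "k x = h (g a) (squash y)" "Y (g a) (squash y)"
      using split[OF xx(1)] by blast
    obtain a' y' where 2: "x' = a' @ [y']" "a' \<in> A" "k x' = h (g a') (squash y')" "Y (g a') (squash y')"
      using split[OF xx(2)] by blast
    have "g a = g a'" "squash y = squash y'" using h(2)[OF 1(4) 2(4)] 1(3) 2(3) xx(3) by auto
    then have "a = a'" "y = y'" using inj_onD[OF g(2) _ 1(2) 2(2)] squash_inject by auto
    then show ?thesis using 1 2 by simp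
  qed
  moreover have "0 < k x \<and> k x < 1" if "x \<in> X" for x using split[OF that] h(3) by metis
  ultimately show ?thesis unfolding embeddable_def inj_on_def by blast
qed

text \<open>Since infinite definable subsets of the line contain intervals, infinitude of a fibre
  becomes a first-order condition on its base point.\<close>

lemma infinite_fibre_iff:
  assumes "definable M (Suc n) X" "length a = n"
  shows "infinite {y. a @ [y] \<in> X} \<longleftrightarrow> (\<exists>c d. c < d \<and> (\<forall>y. c < y \<and> y < d \<longrightarrow> a @ [y] \<in> X))"
proof
  assume "infinite {y. a @ [y] \<in> X}"
  then obtain c d where "c < d" "{c<..<d} \<subseteq> {y. a @ [y] \<in> X}"
    using infinite_interval[OF dset_fibre_list[OF assms]] by blast
  then show "\<exists>c d. c < d \<and> (\<forall>y. c < y \<and> y < d \<longrightarrow> a @ [y] \<in> X)" by (auto simp: subset_iff)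
next
  assume "\<exists>c d. c < d \<and> (\<forall>y. c < y \<and> y < d \<longrightarrow> a @ [y] \<in> X)"
  then obtain c d where cd: "c < d" "\<forall>y. c < y \<and> y < d \<longrightarrow> a @ [y] \<in> X" by blast
  then have "{c<..<d} \<subseteq> {y. a @ [y] \<in> X}" by auto
  then show "infinite {y. a @ [y] \<in> X}" using infinite_Ioo[OF cd(1)] finite_subset by blast
qed

text \<open>Let \<open>B\<close> collect the base points over which \<open>X\<close> contains a
  vertical interval. An infinite \<open>B\<close> would contain a curve, and
  \<open>uniform_box\<close> would produce a surface in \<open>X\<close>. For finite
  \<open>B\<close> the vertical lines embed separately; over the other base points the fibres are
  finite, and the projection contains no surface, because definable choice would lift it to one in
  \<open>X\<close>.\<close>

theorem no_surface_embeddable: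
  "definable M n X \<Longrightarrow>
    (\<And>\<phi> p q a b c d. surface n \<phi> p q a b c d \<Longrightarrow> \<exists>t s. a < t \<and> t < b \<and> c < s \<and> s < d \<and> \<phi> t s \<notin> X) \<Longrightarrow>
    embeddable n X"
proof (induction n arbitrary: X)
  case 0
  then have "X \<subseteq> {[]}" using definable_length by fastforce
  moreover have "embeddable 0 {[]}"
    unfolding embeddable_def by (intro exI[of _ "\<lambda>_. 1/2"]) (simp add: dlfun_def dtm_const)
  ultimately show ?case using embeddable_subset by blast
next
  case (Suc n)
  note X = Suc.prems(1)
  note Xr = dfn_mem[OF X]
  define B where "B = {a. length a = n \<and> (\<exists>c d. c < d \<and> (\<forall>y. c < y \<and> y < d \<longrightarrow> a @ [y] \<in> X))}"
  have B: "definable M n B"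
    by (rule definableI[where P = "\<lambda>a. \<exists>c d. c < d \<and> (\<forall>y. c < y \<and> y < d \<longrightarrow> a @ [y] \<in> X)"])
      (intro dfn_rules Xr dlist_snoc dlist_env, simp add: B_def)
  have "finite B"
  proof (rule ccontr)
    assume "infinite B"
    then obtain \<phi> p a b where \<phi>: "curve n \<phi> p a b" "\<And>t. a < t \<Longrightarrow> t < b \<Longrightarrow> \<phi> t \<in> B"
      using infinite_contains_curve[OF B] by blast
    have dl: "dlist M n (\<lambda>e. \<phi> (e 0))" and "a < b" using \<phi>(1) unfolding curve_def by blast+
    define Q where "Q t c d \<longleftrightarrow> (\<forall>y. c < y \<and> y < d \<longrightarrow> \<phi> t @ [y] \<in> X)" for t c d
    have "dfn M (\<lambda>e. Q (e 0) (e 1) (e 2))"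
      unfolding Q_def by (intro dfn_rules Xr dlist_snoc dlist_comp1[OF dl])
    moreover have "\<exists>c d. c < d \<and> Q t c d" if "a < t" "t < b" for t
      using \<phi>(2)[OF that] unfolding B_def Q_def by blast
    moreover have "Q t c' d'" if "Q t c d" "c \<le> c'" "c' < d'" "d' \<le> d" for t c d c' d'
      using that unfolding Q_def by (meson le_less_trans less_le_trans)
    ultimately obtain a' b' c d where 1: "a \<le> a'" "a' < b'" "b' \<le> b" "c < d"
      "\<And>t. a' < t \<Longrightarrow> t < b' \<Longrightarrow> Q t c d"
      using uniform_box[of Q a b] \<open>a < b\<close> by blast
    have "surface (Suc n) (\<lambda>t s. \<phi> t @ [s]) p n a b c d" by (rule surface_over_curve[OF \<phi>(1) 1(4)])
    then have "surface (Suc n) (\<lambda>t s. \<phi> t @ [s]) p n a' b' c d"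
      unfolding surface_def using 1(1-3) by (meson le_less_trans less_le_trans order_trans)
    from Suc.prems(2)[OF this] show False using 1(5) unfolding Q_def by blast
  qed
  define X1 where "X1 = (\<Union>a\<in>B. {a @ [y] |y. True} \<inter> X)"
  have dX1: "definable M (Suc n) ({a @ [y] |y. True} \<inter> X)" if "a \<in> B" for a
  proof (rule definableI[where P = "\<lambda>x. (\<exists>y. x = a @ [y]) \<and> x \<in> X"])
    have len: "length a = n" using that by (simp add: B_def)
    show "dfn M (\<lambda>e. (\<exists>y. map e [0..<Suc n] = a @ [y]) \<and> map e [0..<Suc n] \<in> X)"
      by (intro dfn_conj dfn_ex definable_eq_list Xr dlist_id dlist_snoc dlist_const len dtm_var)
  qed (use definable_length[OF X] in auto)
  have "embeddable (Suc n) X1" unfolding X1_def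
  proof (rule embeddable_UN[OF \<open>finite B\<close>])
    fix a assume a: "a \<in> B"
    then have "embeddable (Suc n) {a @ [y] |y. True}" by (intro embeddable_fibre) (simp add: B_def)
    then show "definable M (Suc n) ({a @ [y] |y. True} \<inter> X) \<and> embeddable (Suc n) ({a @ [y] |y. True} \<inter> X)"
      using dX1[OF a] embeddable_subset[OF _ Int_lower1] by blast
  qed
  define X2 where "X2 = {x \<in> X. take n x \<notin> B}"
  have tk: "take n (map e [0..<Suc n]) = map e [0..<n]" for e :: "nat \<Rightarrow> 'a" by (simp add: take_map)
  have dX2: "definable M (Suc n) X2"
  proof (rule definableI[where P = "\<lambda>x. x \<in> X \<and> take n x \<notin> B"])
    show "dfn M (\<lambda>e. map e [0..<Suc n] \<in> X \<and> take n (map e [0..<Suc n]) \<notin> B)"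
      unfolding tk by (intro dfn_conj dfn_not Xr dfn_mem[OF B] dlist_id)
  qed (use definable_length[OF X] in \<open>auto simp: X2_def\<close>)
  have fib: "a @ [y] \<in> X2 \<longleftrightarrow> a @ [y] \<in> X \<and> a \<notin> B" if "length a = n" for a y
    using that by (simp add: X2_def)
  have "embeddable (Suc n) X2"
  proof (rule embeddable_finite_fibres[OF dX2])
    show "finite {y. a @ [y] \<in> X2}" if "length a = n" for a
    proof (cases "a \<in> B")
      case False
      then have "finite {y. a @ [y] \<in> X}" using infinite_fibre_iff[OF X that] that unfolding B_def by blast
      then show ?thesis using False fib[OF that] by simp
    qed (use fib[OF that] in simp)
    define A where "A = {a. length a = n \<and> (\<exists>y. a @ [y] \<in> X2)}"
    have "embeddable n A"
    proof (rule Suc.IH)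
      show "definable M n A" unfolding A_def by (rule definable_projection[OF dX2])
      fix \<phi> p q a b c d assume \<phi>: "surface n \<phi> p q a b c d"
      have dl: "dlist M n (\<lambda>e. \<phi> (e 0) (e 1))" using \<phi> unfolding surface_def by blast
      show "\<exists>t s. a < t \<and> t < b \<and> c < s \<and> s < d \<and> \<phi> t s \<notin> A"
      proof (rule ccontr)
        assume "\<not> ?thesis"
        then have inA: "\<phi> t s \<in> A" if "a < t" "t < b" "c < s" "s < d" for t s using that by blast
        define h where "h t s = skolem {y. \<phi> t s @ [y] \<in> X2}" for t s
        have h: "dfun2 M h" unfolding dfun2_def h_def
          by (intro dtm_skolem dfn_mem[OF dX2] dlist_snoc dlist_comp2[OF dl] dtm_var)
        have hX: "\<phi> t s @ [h t s] \<in> X" if "a < t" "t < b" "c < s" "s < d" for t s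
        proof -
          have "{y. \<phi> t s @ [y] \<in> X2} \<noteq> {}" using inA[OF that] unfolding A_def by blast
          then have "\<phi> t s @ [h t s] \<in> X2"
            using skolem_in[OF dset_fibre_list[OF dX2 surface_length[OF \<phi>]]] unfolding h_def by blast
          then show ?thesis unfolding X2_def by blast
        qed
        obtain a' b' c' d' where 1: "a \<le> a'" "b' \<le> b" "c \<le> c'" "d' \<le> d"
          "surface (Suc n) (\<lambda>t s. \<phi> t s @ [h t s]) p q a' b' c' d'"
          by (rule surface_graph[OF \<phi> h]) (rule that)
        obtain t s where "a' < t" "t < b'" "c' < s" "s < d'" "\<phi> t s @ [h t s] \<notin> X"
          using Suc.prems(2)[OF 1(5)] by blast
        then show False using hX[of t s] 1(1-4) by auto
      qed
    qed
    then show "embeddable n {a. length a = n \<and> (\<exists>y. a @ [y] \<in> X2)}" unfolding A_def .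
  qed
  then have "embeddable (Suc n) (X2 \<union> X1)"
    using embeddable_Un[OF dX2] \<open>embeddable (Suc n) X1\<close> by blast
  moreover have "X \<subseteq> X2 \<union> X1"
  proof
    fix x assume x: "x \<in> X"
    then obtain a y where "x = a @ [y]" "length a = n"
      using definable_length[OF X] by (metis length_Suc_conv_rev)
    then show "x \<in> X2 \<union> X1" using x unfolding X1_def X2_def by auto
  qed
  ultimately show ?case using embeddable_subset by blast
qed

theorem o_dim_le_1_embeddable:
  assumes "definable M n X" "o_dim M n X \<le> 1"
  shows "embeddable n X"
proof (rule no_surface_embeddable[OF assms(1)])
  fix \<phi> p q a b c d assume \<phi>: "surface n \<phi> p q a b c d"
  show "\<exists>t s. a < t \<and> t < b \<and> c < s \<and> s < d \<and> \<phi> t s \<notin> X"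
  proof (rule ccontr)
    assume "\<not> ?thesis"
    then have sub: "{\<phi> t s |t s. a < t \<and> t < b \<and> c < s \<and> s < d} \<subseteq> X" by blast
    have "cell M n 2 {\<phi> t s |t s. a < t \<and> t < b \<and> c < s \<and> s < d}"
      using \<phi> unfolding surface_def by blast
    then have "ereal (real 2) \<le> o_dim M n X"
      unfolding o_dim_def using sub by (intro Sup_upper) blast
    then have "ereal (real 2) \<le> 1" using assms(2) by (rule order_trans)
    then show False by (simp add: one_ereal_def)
  qed
qed

end

section \<open>Hausdorff definable topologies on subsets of the line\<close>

text \<open>The fibre of \<open>W\<close> over a parameter b in \<open>P\<close> is a basic open
  set. The bounds 0 and 1, which come from the embedding, keep the suprema below finite.\<close>

locale definable_line_space = o_minimal_field M
  for M :: "('a::{linordered_field, linorder_topology}, 'f, 'r) fo_structure" +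
  fixes T :: "'a topology" and k :: nat and P W :: "'a list set"
  assumes P: "definable M k P" and W: "definable M (Suc k) W"
    and openin_iff: "openin T U \<longleftrightarrow> (\<forall>x\<in>U. \<exists>b\<in>P. b @ [x] \<in> W \<and> {y. b @ [y] \<in> W} \<subseteq> U)"
    and open_basic: "b \<in> P \<Longrightarrow> openin T {y. b @ [y] \<in> W}"
    and hausdorff: "Hausdorff_space T"
    and definable_topspace: "dset (topspace T)"
    and topspace_range: "x \<in> topspace T \<Longrightarrow> 0 < x \<and> x < 1"
begin

text \<open>
  \<open>rlim y x\<close> says that \<open>z\<close> converges to \<open>x\<close> in the topology \<open>T\<close> as \<open>z\<close> tends to \<open>y\<close> from the right
  in the order topology.
\<close>

definition rlim :: "'a \<Rightarrow> 'a \<Rightarrow> bool" where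
  "rlim y x \<longleftrightarrow> x \<in> topspace T \<and> (\<forall>V. openin T V \<and> x \<in> V \<longrightarrow> rgerm V y)"

definition llim :: "'a \<Rightarrow> 'a \<Rightarrow> bool" where
  "llim y x \<longleftrightarrow> x \<in> topspace T \<and> (\<forall>V. openin T V \<and> x \<in> V \<longrightarrow> lgerm V y)"

text \<open>Quantification over open sets is not first-order. A condition that is monotone in the
  set need only be tested on basic sets, which turns the quantifier into one over
  parameters.\<close>

lemma all_open_iff:
  assumes "\<And>U V. U \<subseteq> V \<Longrightarrow> Q U \<Longrightarrow> Q V"
  shows "(\<forall>V. openin T V \<and> x \<in> V \<longrightarrow> Q V) \<longleftrightarrow>
    (\<forall>b. length b = k \<longrightarrow> (b \<in> P \<and> b @ [x] \<in> W \<longrightarrow> Q {y. b @ [y] \<in> W}))"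
proof
  assume *: "\<forall>V. openin T V \<and> x \<in> V \<longrightarrow> Q V"
  show "\<forall>b. length b = k \<longrightarrow> (b \<in> P \<and> b @ [x] \<in> W \<longrightarrow> Q {y. b @ [y] \<in> W})"
    using * open_basic by blast
next
  assume *: "\<forall>b. length b = k \<longrightarrow> (b \<in> P \<and> b @ [x] \<in> W \<longrightarrow> Q {y. b @ [y] \<in> W})"
  show "\<forall>V. openin T V \<and> x \<in> V \<longrightarrow> Q V"
  proof (intro allI impI, elim conjE)
    fix V assume "openin T V" "x \<in> V"
    then obtain b where b: "b \<in> P" "b @ [x] \<in> W" "{y. b @ [y] \<in> W} \<subseteq> V" unfolding openin_iff by blast
    have "Q {y. b @ [y] \<in> W}" using * b definable_length[OF P b(1)] by blast
    then show "Q V" by (rule assms[OF b(3)])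
  qed
qed

lemma dfn_rlim: "dfn M (\<lambda>e. rlim (e 0) (e 1))"
proof -
  have "dfn M (\<lambda>e. e 1 \<in> topspace T \<and>
    (\<forall>b. length b = k \<longrightarrow> (b \<in> P \<and> b @ [e 1] \<in> W \<longrightarrow> rgerm {y. b @ [y] \<in> W} (e 0))))"
    by (intro dfn_conj dfn_imp dfn_alllist dfn_rgerm dfn_mem[OF P] dfn_mem[OF W] dlist_id dlist_snoc
        dlist_env dtm_var dfn_dset[OF definable_topspace])
  then show ?thesis unfolding rlim_def by (subst all_open_iff) (auto intro: germ_mono)
qed

lemma dfn_llim: "dfn M (\<lambda>e. llim (e 0) (e 1))"
proof -
  have "dfn M (\<lambda>e. e 1 \<in> topspace T \<and>
    (\<forall>b. length b = k \<longrightarrow> (b \<in> P \<and> b @ [e 1] \<in> W \<longrightarrow> lgerm {y. b @ [y] \<in> W} (e 0))))"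
    by (intro dfn_conj dfn_imp dfn_alllist dfn_lgerm dfn_mem[OF P] dfn_mem[OF W] dlist_id dlist_snoc
        dlist_env dtm_var dfn_dset[OF definable_topspace])
  then show ?thesis unfolding llim_def by (subst all_open_iff) (auto intro: germ_mono)
qed

lemmas dfn_lim = dfn_rel2[OF dfn_rlim] dfn_rel2[OF dfn_llim]

section \<open>Uniqueness of limits and neighbourhoods that avoid a definable set\<close>

lemma separation:
  assumes "x \<in> topspace T" "x' \<in> topspace T" "x \<noteq> x'"
  obtains U V where "openin T U" "openin T V" "x \<in> U" "x' \<in> V" "U \<inter> V = {}"
  using hausdorff assms unfolding Hausdorff_space_def disjnt_def by metis

lemma rlim_unique: "rlim y x \<Longrightarrow> rlim y x' \<Longrightarrow> x = x'"
proof (rule ccontr)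
  assume *: "rlim y x" "rlim y x'" "x \<noteq> x'"
  then obtain U V where UV: "openin T U" "openin T V" "x \<in> U" "x' \<in> V" "U \<inter> V = {}"
    using separation[of x x'] unfolding rlim_def by blast
  then have "rgerm U y" "rgerm V y" using * unfolding rlim_def by blast+
  then have "rgerm (U \<inter> V) y" by (rule rgerm_Int)
  then show False using UV(5) germ_nonempty(1)[of y] by simp
qed

lemma llim_unique: "llim y x \<Longrightarrow> llim y x' \<Longrightarrow> x = x'"
proof (rule ccontr)
  assume *: "llim y x" "llim y x'" "x \<noteq> x'"
  then obtain U V where UV: "openin T U" "openin T V" "x \<in> U" "x' \<in> V" "U \<inter> V = {}"
    using separation[of x x'] unfolding llim_def by blast
  then have "lgerm U y" "lgerm V y" using * unfolding llim_def by blast+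
  then have "lgerm (U \<inter> V) y" by (rule lgerm_Int)
  then show False using UV(5) germ_nonempty(2)[of y] by simp
qed

lemma lim_germ: "rlim y x \<Longrightarrow> rgerm (topspace T) y" "llim y x \<Longrightarrow> lgerm (topspace T) y"
  unfolding rlim_def llim_def by auto

lemma open_definable_nbhd:
  assumes "openin T V" "x \<in> V"
  obtains U where "openin T U" "x \<in> U" "U \<subseteq> V" "dset U"
proof -
  obtain b where b: "b \<in> P" "b @ [x] \<in> W" "{y. b @ [y] \<in> W} \<subseteq> V"
    using assms unfolding openin_iff by blast
  have "dset {y. b @ [y] \<in> W}" by (rule dset_fibre_list[OF W definable_length[OF P b(1)]])
  then show ?thesis using that b open_basic by blast
qed

lemma finite_iff_no_interval:
  assumes "dset S"
  shows "finite S \<longleftrightarrow> \<not> (\<exists>u v. u < v \<and> (\<forall>w. u < w \<and> w < v \<longrightarrow> w \<in> S))"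
proof -
  have "infinite S" if "u < v" "{u<..<v} \<subseteq> S" for u v
    by (rule infinite_super[OF that(2) infinite_Ioo[OF that(1)]])
  moreover have "\<exists>u v. u < v \<and> {u<..<v} \<subseteq> S" if inf: "infinite S"
  proof -
    obtain u v where "u < v" "{u<..<v} \<subseteq> S" by (rule infinite_interval[OF assms inf])
    then show ?thesis by blast
  qed
  moreover have "(\<exists>u v. u < v \<and> (\<forall>w. u < w \<and> w < v \<longrightarrow> w \<in> S)) \<longleftrightarrow> (\<exists>u v. u < v \<and> {u<..<v} \<subseteq> S)"
    by (simp add: subset_iff)
  ultimately show ?thesis by blast
qed

text \<open>
  Definable compactness in dimension one: the infinite traces on \<open>Q\<close> of the neighbourhoods
  of \<open>x\<close> accumulate at a common one-sided germ, located by a supremum.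
\<close>

lemma clinging_germ:
  assumes x: "x \<in> topspace T" and Q: "dset Q" and Qr: "\<And>w. w \<in> Q \<Longrightarrow> 0 < w \<and> w < 1"
    and inf: "\<And>V. openin T V \<Longrightarrow> x \<in> V \<Longrightarrow> infinite (V \<inter> Q)"
  obtains y where "(rlim y x \<and> rgerm Q y) \<or> (llim y x \<and> lgerm Q y)"
proof -
  define nb where "nb V \<longleftrightarrow> openin T V \<and> x \<in> V \<and> dset V" for V
  have nbV: "openin T V" "x \<in> V" "dset V" "dset (V \<inter> Q)" if "nb V" for V
    using that Q unfolding nb_def by (auto intro: dset_Int)
  have dir: "\<exists>V. nb V \<and> V \<subseteq> V1 \<inter> V2" if "nb V1" "nb V2" for V1 V2
  proof -
    have "openin T (V1 \<inter> V2)" "x \<in> V1 \<inter> V2"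
      using nbV(1,2)[OF that(1)] nbV(1,2)[OF that(2)] by auto
    then obtain U where "openin T U" "x \<in> U" "U \<subseteq> V1 \<inter> V2" "dset U" by (rule open_definable_nbhd)
    then show ?thesis unfolding nb_def by blast
  qed
  have nb_ex: "\<exists>U. nb U \<and> U \<subseteq> V" if V: "openin T V" "x \<in> V" for V
  proof -
    obtain U where "openin T U" "x \<in> U" "U \<subseteq> V" "dset U" by (rule open_definable_nbhd[OF V])
    then show ?thesis unfolding nb_def by blast
  qed
  \<comment> \<open>Initial segments of the line on which some neighbourhood of x has a finite
    trace; the supremum is the place where infinite traces must begin.\<close>
  define Z where "Z = {z. \<exists>V. nb V \<and> finite (V \<inter> Q \<inter> {..<z})}"
  \<comment> \<open>The definable form of \<open>Z\<close>: neighbourhoods are replaced by basic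
    ones, and a finite trace by a trace without an interval.\<close>
  have "Z = {z. \<exists>b. length b = k \<and> ((b \<in> P \<and> b @ [x] \<in> W) \<and>
    \<not> (\<exists>u v. u < v \<and> (\<forall>w. u < w \<and> w < v \<longrightarrow> b @ [w] \<in> W \<and> w \<in> Q \<and> w < z)))}" (is "_ = ?Z")
  proof (intro set_eqI iffI)
    fix z assume "z \<in> Z"
    then obtain V where V: "nb V" "finite (V \<inter> Q \<inter> {..<z})" unfolding Z_def by blast
    then obtain b where b: "b \<in> P" "b @ [x] \<in> W" "{y. b @ [y] \<in> W} \<subseteq> V"
      unfolding nb_def openin_iff by blast
    have "finite ({y. b @ [y] \<in> W} \<inter> Q \<inter> {..<z})" by (rule finite_subset[OF _ V(2)]) (use b(3) in blast)
    moreover have "dset ({y. b @ [y] \<in> W} \<inter> Q \<inter> {..<z})"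
      using definable_length[OF P b(1)]
      by (intro dset_Int dset_fibre_list[OF W] Q) (simp_all add: dset_def dfn_less dtm_var dtm_const)
    ultimately show "z \<in> ?Z" using b definable_length[OF P b(1)] finite_iff_no_interval by auto
  next
    fix z assume "z \<in> ?Z"
    then obtain b where b: "length b = k" "b \<in> P" "b @ [x] \<in> W"
      "\<not> (\<exists>u v. u < v \<and> (\<forall>w. u < w \<and> w < v \<longrightarrow> b @ [w] \<in> W \<and> w \<in> Q \<and> w < z))" by blast
    have d: "dset {y. b @ [y] \<in> W}" by (rule dset_fibre_list[OF W b(1)])
    moreover have "dset ({y. b @ [y] \<in> W} \<inter> Q \<inter> {..<z})"
      by (intro dset_Int d Q) (simp add: dset_def dfn_less dtm_var dtm_const)
    ultimately have "finite ({y. b @ [y] \<in> W} \<inter> Q \<inter> {..<z})"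
      using b(4) finite_iff_no_interval by auto
    moreover have "nb {y. b @ [y] \<in> W}" using d b open_basic unfolding nb_def by auto
    ultimately show "z \<in> Z" unfolding Z_def by blast
  qed
  moreover have "dset ?Z"
    unfolding dset_Collect
    by (intro dfn_exlist dfn_conj dfn_not dfn_ex dfn_all dfn_imp dfn_less dfn_dset[OF Q]
        dfn_mem[OF P] dfn_mem[OF W] dlist_id dlist_env dlist_snoc dtm_var dtm_const)
  ultimately have "dset Z" by simp
  obtain V0 where "nb V0" using nb_ex[of "topspace T"] x by blast
  moreover have "V0 \<inter> Q \<inter> {..<0} = {}" using Qr by force
  ultimately have "0 \<in> Z" unfolding Z_def by (metis (mono_tags) finite.emptyI mem_Collect_eq)
  moreover have "z \<le> 1" if "z \<in> Z" for z
  proof (rule ccontr)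
    assume "\<not> z \<le> 1"
    then have "V \<inter> Q \<inter> {..<z} = V \<inter> Q" for V using Qr by force
    then show False using that inf nbV(1,2) unfolding Z_def by auto
  qed
  ultimately obtain c where c: "is_lub Z c" using lub_exists[OF \<open>dset Z\<close>, of 1] by blast
  \<comment> \<open>A neighbourhood with finite trace near c could be intersected with one whose
    trace below some z > c - \<epsilon> is finite. The trace of the result would be finite up to c +
    \<epsilon>, beyond the supremum.\<close>
  have near: "infinite (V \<inter> Q \<inter> {c - \<epsilon><..<c + \<epsilon>})" if V: "nb V" and \<epsilon>: "\<epsilon> > 0" for V \<epsilon>
  proof
    assume fin: "finite (V \<inter> Q \<inter> {c - \<epsilon><..<c + \<epsilon>})"
    obtain z where z: "z \<in> Z" "c - \<epsilon> < z" using lub_approx[OF c, of "c - \<epsilon>"] \<epsilon> by auto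
    then obtain V1 where V1: "nb V1" "finite (V1 \<inter> Q \<inter> {..<z})" unfolding Z_def by blast
    obtain V2 where V2: "nb V2" "V2 \<subseteq> V \<inter> V1" using dir[OF V V1(1)] by blast
    have "V2 \<inter> Q \<inter> {..<c + \<epsilon>} \<subseteq> V1 \<inter> Q \<inter> {..<z} \<union> V \<inter> Q \<inter> {c - \<epsilon><..<c + \<epsilon>}"
      using V2(2) z(2) by fastforce
    then have "finite (V2 \<inter> Q \<inter> {..<c + \<epsilon>})" using V1(2) fin finite_subset by blast
    then have "c + \<epsilon> \<in> Z" using V2(1) unfolding Z_def by blast
    then show False using lub_upper[OF c, of "c + \<epsilon>"] \<epsilon> by simp
  qed
  have germ: "rgerm (V \<inter> Q) c \<or> lgerm (V \<inter> Q) c" if "nb V" for V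
  proof (rule ccontr)
    assume "\<not> ?thesis"
    then have "rgerm (- (V \<inter> Q)) c" "lgerm (- (V \<inter> Q)) c" using germ_compl[OF nbV(4)[OF that]] by blast+
    then obtain u v where uv: "u < c" "c < v" "{u<..<c} \<subseteq> - (V \<inter> Q)" "{c<..<v} \<subseteq> - (V \<inter> Q)"
      unfolding rgerm_def lgerm_def by blast
    define \<epsilon> where "\<epsilon> = min (c - u) (v - c)"
    have "V \<inter> Q \<inter> {c - \<epsilon><..<c + \<epsilon>} \<subseteq> {c}"
    proof
      fix w assume w: "w \<in> V \<inter> Q \<inter> {c - \<epsilon><..<c + \<epsilon>}"
      have "c - \<epsilon> \<ge> u" "c + \<epsilon> \<le> v" unfolding \<epsilon>_def by linarith+
      then have "u < w" "w < v" using w by auto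
      then show "w \<in> {c}" using w uv(3,4) by (cases w c rule: linorder_cases) auto
    qed
    then have "finite (V \<inter> Q \<inter> {c - \<epsilon><..<c + \<epsilon>})" using finite_subset by blast
    moreover have "\<epsilon> > 0" using uv unfolding \<epsilon>_def by simp
    ultimately show False using near[OF that] by blast
  qed
  \<comment> \<open>One side serves all neighbourhoods: counterexamples for the two sides have a
    common refinement, and this refinement contains a germ on neither side.\<close>
  have "(\<forall>V. nb V \<longrightarrow> rgerm (V \<inter> Q) c) \<or> (\<forall>V. nb V \<longrightarrow> lgerm (V \<inter> Q) c)"
  proof (rule ccontr)
    assume "\<not> ?thesis"
    then obtain V1 V2 where 12: "nb V1" "nb V2" "\<not> rgerm (V1 \<inter> Q) c" "\<not> lgerm (V2 \<inter> Q) c" by blast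
    then obtain V where V: "nb V" "V \<subseteq> V1 \<inter> V2" using dir by blast
    have "V \<inter> Q \<subseteq> V1 \<inter> Q" "V \<inter> Q \<subseteq> V2 \<inter> Q" using V(2) by auto
    then show False using germ[OF V(1)] 12 germ_mono by blast
  qed
  then show ?thesis
  proof
    assume *: "\<forall>V. nb V \<longrightarrow> rgerm (V \<inter> Q) c"
    have "rgerm V c" if V: "openin T V" "x \<in> V" for V
    proof -
      obtain U where "nb U" "U \<subseteq> V" using nb_ex[OF V] by blast
      then show ?thesis using * germ_mono(1)[of "U \<inter> Q" V c] by blast
    qed
    moreover have "rgerm Q c" using * \<open>nb V0\<close> germ_mono(1)[OF Int_lower2] by blast
    ultimately show ?thesis using that x unfolding rlim_def by blast
  next
    assume *: "\<forall>V. nb V \<longrightarrow> lgerm (V \<inter> Q) c"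
    have "lgerm V c" if V: "openin T V" "x \<in> V" for V
    proof -
      obtain U where "nb U" "U \<subseteq> V" using nb_ex[OF V] by blast
      then show ?thesis using * germ_mono(2)[of "U \<inter> Q" V c] by blast
    qed
    moreover have "lgerm Q c" using * \<open>nb V0\<close> germ_mono(2)[OF Int_lower2] by blast
    ultimately show ?thesis using that x unfolding llim_def by blast
  qed
qed

text \<open>By \<open>clinging_germ\<close> some neighbourhood of x has a finite trace on
  \<open>Q\<close>. Finite sets are closed in a Hausdorff space, so the trace points other than x
  can be removed.\<close>

lemma avoiding_nbhd:
  assumes x: "x \<in> topspace T" and Q: "dset Q" "Q \<subseteq> topspace T"
    and no: "\<And>y. rlim y x \<Longrightarrow> \<not> rgerm Q y" "\<And>y. llim y x \<Longrightarrow> \<not> lgerm Q y"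
  obtains V where "openin T V" "x \<in> V" "V \<inter> Q \<subseteq> {x}"
proof -
  have "\<exists>V. openin T V \<and> x \<in> V \<and> finite (V \<inter> Q)"
  proof (rule ccontr)
    assume fin: "\<not> ?thesis"
    obtain y where "(rlim y x \<and> rgerm Q y) \<or> (llim y x \<and> lgerm Q y)"
    proof (rule clinging_germ[OF x Q(1)])
      show "0 < w \<and> w < 1" if "w \<in> Q" for w using topspace_range Q(2) that by blast
      show "infinite (V \<inter> Q)" if "openin T V" "x \<in> V" for V using fin that by blast
    qed (rule that)
    then show False using no by blast
  qed
  then obtain V where V: "openin T V" "x \<in> V" "finite (V \<inter> Q)" by blast
  define F where "F = V \<inter> Q - {x}"
  have "finite F" "F \<subseteq> topspace T" using V(3) Q(2) by (auto simp: F_def)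
  then have "closedin T F" using closedin_Hausdorff_finite[OF hausdorff] by blast
  then have "openin T (V - F)" using V(1) by (rule openin_diff[rotated])
  moreover have "x \<in> V - F" "(V - F) \<inter> Q \<subseteq> {x}" using V(2) by (auto simp: F_def)
  ultimately show ?thesis using that by blast
qed

text \<open>If related values different from y exist on a whole interval, they form a definable
  function l that is continuous at some y0. Near y0 its values stay close to l y0 and hence away
  from y0, so a short interval around y0 contains no value of l over its own points.\<close>

lemma subinterval_fixing:
  assumes R: "dfn M (\<lambda>e. R (e 0) (e 1))" and uniq: "\<And>y x x'. R y x \<Longrightarrow> R y x' \<Longrightarrow> x = x'" and "a < b"
  obtains c d where "a \<le> c" "c < d" "d \<le> b"
    "\<And>y x. c < y \<Longrightarrow> y < d \<Longrightarrow> c < x \<Longrightarrow> x < d \<Longrightarrow> R y x \<Longrightarrow> x = y"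
proof -
  note Rr = dfn_rel2[OF R]
  define A where "A = {y. \<exists>x. R y x \<and> x \<noteq> y}"
  have "dset A" unfolding A_def dset_Collect by (intro dfn_rules Rr)
  then obtain a1 b1 where 1: "a \<le> a1" "a1 < b1" "b1 \<le> b" "{a1<..<b1} \<subseteq> A \<or> {a1<..<b1} \<subseteq> - A"
    by (rule subinterval_cases[OF _ \<open>a < b\<close>]) (rule that)
  from 1(4) show ?thesis
  proof
    assume *: "{a1<..<b1} \<subseteq> - A"
    have "x = y" if "a1 < y" "y < b1" "R y x" for x y
      using subsetD[OF *, of y] that unfolding A_def by auto
    then show ?thesis using that[of a1 b1] 1 by blast
  next
    assume *: "{a1<..<b1} \<subseteq> A"
    define l where "l y = skolem {x. R y x \<and> x \<noteq> y}" for y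
    have l: "dfun1 M l" unfolding dfun1_def l_def by (intro dtm_skolem dfn_rules Rr)
    have lR: "R y (l y) \<and> l y \<noteq> y" if "a1 < y" "y < b1" for y
    proof -
      have "dset {x. R y x \<and> x \<noteq> y}" unfolding dset_Collect by (intro dfn_rules Rr)
      moreover have "{x. R y x \<and> x \<noteq> y} \<noteq> {}" using subsetD[OF *, of y] that unfolding A_def by auto
      ultimately show ?thesis using skolem_in unfolding l_def by blast
    qed
    obtain a2 b2 where 2: "a1 \<le> a2" "a2 < b2" "b2 \<le> b1" "\<And>y. a2 < y \<Longrightarrow> y < b2 \<Longrightarrow> cont_at l y"
      by (rule continuous_subinterval[OF l 1(2)]) (rule that)
    obtain y0 where y0: "a2 < y0" "y0 < b2" using dense[OF 2(2)] by blast
    \<comment> \<open>Half the distance from y0 to l y0: a point closer than \<epsilon> to both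
      would contradict the triangle inequality, and that contradiction closes the case.\<close>
    define \<epsilon> where "\<epsilon> = \<bar>l y0 - y0\<bar> / 2"
    have "l y0 \<noteq> y0" using lR[of y0] y0 2 by auto
    then have "\<epsilon> > 0" unfolding \<epsilon>_def by simp
    then obtain \<delta> where \<delta>: "\<delta> > 0" "\<And>y. \<bar>y - y0\<bar> < \<delta> \<Longrightarrow> \<bar>l y - l y0\<bar> < \<epsilon>"
      using cont_atD[OF 2(4)[OF y0]] by blast
    define c where "c = max a2 (y0 - min \<delta> \<epsilon>)"
    define d where "d = min b2 (y0 + min \<delta> \<epsilon>)"
    have cd: "a2 \<le> c" "d \<le> b2" "y0 - \<delta> \<le> c" "d \<le> y0 + \<delta>" "y0 - \<epsilon> \<le> c" "d \<le> y0 + \<epsilon>"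
      unfolding c_def d_def by linarith+
    have "c < y0" "y0 < d" using y0 \<open>\<epsilon> > 0\<close> \<delta>(1) unfolding c_def d_def by simp_all
    then have "c < d" by simp
    moreover have "x = y" if "c < y" "y < d" "c < x" "x < d" "R y x" for y x
    proof -
      have "a1 < y" "y < b1" using that cd 2 by auto
      then have "x = l y" using uniq[OF that(5)] lR by blast
      have "\<bar>y - y0\<bar> < \<delta>" "\<bar>x - y0\<bar> < \<epsilon>" using that cd by (auto simp: abs_less_iff)
      then have "\<bar>x - l y0\<bar> < \<epsilon>" "\<bar>x - y0\<bar> < \<epsilon>" using \<delta>(2) \<open>x = l y\<close> by auto
      moreover have "2 * \<epsilon> = \<bar>l y0 - y0\<bar>" unfolding \<epsilon>_def by simp
      ultimately show ?thesis by linarith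
    qed
    ultimately show ?thesis using that[of c d] 1 2 cd by auto
  qed
qed

text \<open>
  With both flags false, the topology on \<open>{c<..<d}\<close> is discrete; with exactly one of them true, it is
  generated by right or by left half-open intervals.
\<close>

definition sorgenfrey_interval :: "'a \<Rightarrow> 'a \<Rightarrow> bool \<Rightarrow> bool \<Rightarrow> bool" where
  "sorgenfrey_interval c d right left \<longleftrightarrow> c < d \<and> {c<..<d} \<subseteq> topspace T \<and> (\<forall>x. c < x \<and> x < d \<longrightarrow>
    (\<forall>u<x. \<forall>v>x. \<exists>V. openin T V \<and> x \<in> V \<and>
      V \<inter> {c<..<d} \<subseteq> {w. w = x \<or> right \<and> x < w \<and> w < v \<or> left \<and> u < w \<and> w < x}) \<and>
    (\<forall>V. openin T V \<and> x \<in> V \<longrightarrow> (right \<longrightarrow> rgerm V x) \<and> (left \<longrightarrow> lgerm V x)))"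

text \<open>Successive shrinking makes the truth values of \<open>rlim y y\<close> and
  \<open>llim y y\<close> constant and lets no germ based in the interval converge to another of its
  points. The neighbourhoods of x are then controlled by the germs at x alone, which the two flags
  record; both cannot be true since the interval consists of exceptional points.\<close>

lemma non_euclidean_interval:
  assumes "infinite {y \<in> topspace T. \<not> (rlim y y \<and> llim y y)}"
  obtains c d where "sorgenfrey_interval c d False False \<or> sorgenfrey_interval c d True False \<or>
    sorgenfrey_interval c d False True"
proof -
  have "dset {y \<in> topspace T. \<not> (rlim y y \<and> llim y y)}"
    unfolding dset_Collect by (intro dfn_rules dfn_lim dfn_dset[OF definable_topspace])
  then obtain a0 b0 where 0: "a0 < b0" "{a0<..<b0} \<subseteq> {y \<in> topspace T. \<not> (rlim y y \<and> llim y y)}"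
    by (rule infinite_interval[OF _ assms]) (rule that)
  have dr: "dset {y. rlim y y}" and dl: "dset {y. llim y y}"
    unfolding dset_Collect by (intro dfn_rules dfn_lim)+
  obtain a1 b1 where
    1: "a0 \<le> a1" "a1 < b1" "b1 \<le> b0" "{a1<..<b1} \<subseteq> {y. rlim y y} \<or> {a1<..<b1} \<subseteq> - {y. rlim y y}"
    by (rule subinterval_cases[OF dr 0(1)]) (rule that)
  obtain a2 b2 where
    2: "a1 \<le> a2" "a2 < b2" "b2 \<le> b1" "{a2<..<b2} \<subseteq> {y. llim y y} \<or> {a2<..<b2} \<subseteq> - {y. llim y y}"
    by (rule subinterval_cases[OF dl 1(2)]) (rule that)
  obtain a3 b3 where 3: "a2 \<le> a3" "a3 < b3" "b3 \<le> b2"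
    "\<And>y x. a3 < y \<Longrightarrow> y < b3 \<Longrightarrow> a3 < x \<Longrightarrow> x < b3 \<Longrightarrow> rlim y x \<Longrightarrow> x = y"
    by (rule subinterval_fixing[OF dfn_rlim rlim_unique 2(2)]) (assumption+, rule that)
  obtain a4 b4 where 4: "a3 \<le> a4" "a4 < b4" "b4 \<le> b3"
    "\<And>y x. a4 < y \<Longrightarrow> y < b4 \<Longrightarrow> a4 < x \<Longrightarrow> x < b4 \<Longrightarrow> llim y x \<Longrightarrow> x = y"
    by (rule subinterval_fixing[OF dfn_llim llim_unique 3(2)]) (assumption+, rule that)
  \<comment> \<open>A germ contained in the final interval may be based at one of its endpoints, so
    c and d are taken strictly inside the interval where the fixing properties hold.\<close>
  obtain c where c: "a4 < c" "c < b4" using dense[OF 4(2)] by blast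
  obtain d where d: "c < d" "d < b4" using dense[OF c(2)] by blast
  have sub: "a0 < y" "y < b0" "a1 < y" "y < b1" "a2 < y" "y < b2" "a3 < y" "y < b3"
    if "a4 < y" "y < b4" for y
    using that 1(1,3) 2(1,3) 3(1,3) 4(1,3) by auto
  have X: "{c<..<d} \<subseteq> topspace T"
  proof
    fix x assume "x \<in> {c<..<d}"
    then have "x \<in> {a0<..<b0}" using sub[of x] c d by auto
    then show "x \<in> topspace T" using 0(2) by blast
  qed
  have rfix: "y = x" if "c < x" "x < d" "rlim y x" "rgerm Q y" "Q \<subseteq> {c<..<d}" for x y Q
  proof -
    have "rgerm {c<..<d} y" using that germ_mono by blast
    then have "c \<le> y" "y < d"
      unfolding rgerm_def using greaterThanLessThan_subseteq_greaterThanLessThan[of y _ c d]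
      by (auto dest: less_le_trans)
    then have "a4 < y" "y < b4" "a4 < x" "x < b4" using that(1,2) c d by auto
    then show ?thesis using 3(4)[OF sub(7,8) sub(7,8) that(3)] by simp
  qed
  have lfix: "y = x" if "c < x" "x < d" "llim y x" "lgerm Q y" "Q \<subseteq> {c<..<d}" for x y Q
  proof -
    have "lgerm {c<..<d} y" using that germ_mono by blast
    then have "c < y" "y \<le> d"
      unfolding lgerm_def using greaterThanLessThan_subseteq_greaterThanLessThan[of _ y c d]
      by (auto dest: le_less_trans)
    then have "a4 < y" "y < b4" "a4 < x" "x < b4" using that(1,2) c d by auto
    then show ?thesis using 4(4)[OF _ _ _ _ that(3)] by simp
  qed
  define right left where "right \<longleftrightarrow> {a1<..<b1} \<subseteq> {y. rlim y y}" and "left \<longleftrightarrow> {a2<..<b2} \<subseteq> {y. llim y y}"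
  have rl: "rlim x x \<longleftrightarrow> right" "llim x x \<longleftrightarrow> left" if "a4 < x" "x < b4" for x
  proof -
    have "x \<in> {a1<..<b1}" "x \<in> {a2<..<b2}" using sub[OF that] by auto
    then show "rlim x x \<longleftrightarrow> right" "llim x x \<longleftrightarrow> left"
      using 1(4) 2(4) unfolding right_def left_def by blast+
  qed
  have nbhd: "\<exists>V. openin T V \<and> x \<in> V \<and>
      V \<inter> {c<..<d} \<subseteq> {w. w = x \<or> right \<and> x < w \<and> w < v \<or> left \<and> u < w \<and> w < x}"
    if x: "c < x" "x < d" and uv: "u < x" "x < v" for x u v
  proof -
    have x4: "a4 < x" "x < b4" using x c d by auto
    have xT: "x \<in> topspace T" using X x by auto
    define Q where "Q = {w. c < w \<and> w < d \<and> \<not> (w = x \<or> right \<and> x < w \<and> w < v \<or> left \<and> u < w \<and> w < x)}"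
    have Q: "dset Q" unfolding Q_def dset_Collect by (intro dfn_rules)
    have Qs: "Q \<subseteq> {c<..<d}" unfolding Q_def by auto
    obtain V where V: "openin T V" "x \<in> V" "V \<inter> Q \<subseteq> {x}"
    proof (rule avoiding_nbhd[OF xT Q])
      show "Q \<subseteq> topspace T" using Qs X by blast
      show "\<not> rgerm Q y" if y: "rlim y x" for y
      proof
        assume g: "rgerm Q y"
        then have "y = x" by (rule rfix[OF x y _ Qs])
        then have right using rl(1)[OF x4] y by simp
        have "rgerm {x<..<v} x" using uv(2) unfolding rgerm_def by blast
        then have "rgerm (Q \<inter> {x<..<v}) x" using g \<open>y = x\<close> rgerm_Int by blast
        moreover have "Q \<inter> {x<..<v} = {}" using \<open>right\<close> unfolding Q_def by auto
        ultimately show False using germ_nonempty(1)[of x] by simp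
      qed
      show "\<not> lgerm Q y" if y: "llim y x" for y
      proof
        assume g: "lgerm Q y"
        then have "y = x" by (rule lfix[OF x y _ Qs])
        then have left using rl(2)[OF x4] y by simp
        have "lgerm {u<..<x} x" using uv(1) unfolding lgerm_def by blast
        then have "lgerm (Q \<inter> {u<..<x}) x" using g \<open>y = x\<close> lgerm_Int by blast
        moreover have "Q \<inter> {u<..<x} = {}" using \<open>left\<close> unfolding Q_def by auto
        ultimately show False using germ_nonempty(2)[of x] by simp
      qed
    qed (rule that)
    have "V \<inter> {c<..<d} \<subseteq> {w. w = x \<or> right \<and> x < w \<and> w < v \<or> left \<and> u < w \<and> w < x}"
      using V(3) unfolding Q_def by auto
    then show ?thesis using V(1,2) by blast
  qed
  have germs: "(right \<longrightarrow> rgerm V x) \<and> (left \<longrightarrow> lgerm V x)"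
    if "c < x" "x < d" and V: "openin T V" "x \<in> V" for x V
  proof -
    have "a4 < x" "x < b4" using that(1,2) c d by auto
    then show ?thesis using rl[of x] V unfolding rlim_def llim_def by blast
  qed
  have "sorgenfrey_interval c d right left"
    unfolding sorgenfrey_interval_def using d(1) X nbhd germs by simp
  moreover have "\<not> (right \<and> left)"
  proof -
    have "c \<in> {a0<..<b0}" using sub[OF c] by auto
    then have "\<not> (rlim c c \<and> llim c c)" using 0(2) by blast
    then show ?thesis using rl[OF c] by blast
  qed
  ultimately show ?thesis using that[of c d] by (cases right; cases left) simp_all
qed

end

text \<open>The two hypotheses express continuity of each coordinate and that finitely many
  coordinates detect neighbourhoods. Injectivity follows from the second one, since Hausdorff
  neighbourhoods separate points.\<close>

lemma homeomorphic_map_into_euclid: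
  fixes us :: "('b \<Rightarrow> 'a::{linordered_field, linorder_topology}) list"
  assumes cont: "\<And>u y \<epsilon>. u \<in> set us \<Longrightarrow> y \<in> topspace T \<Longrightarrow> \<epsilon> > 0 \<Longrightarrow>
      \<exists>V. openin T V \<and> y \<in> V \<and> (\<forall>w\<in>V. \<bar>u w - u y\<bar> < \<epsilon>)"
    and inv: "\<And>y V. openin T V \<Longrightarrow> y \<in> V \<Longrightarrow>
      \<exists>\<eta>>0. \<forall>w\<in>topspace T. (\<forall>u\<in>set us. \<bar>u w - u y\<bar> < \<eta>) \<longrightarrow> w \<in> V"
    and T: "Hausdorff_space T"
  shows "homeomorphic_map T (subtopology (euclid (length us)) ((\<lambda>y. map (\<lambda>u. u y) us) ` topspace T))
    (\<lambda>y. map (\<lambda>u. u y) us)" (is "homeomorphic_map T (subtopology ?E (?f ` _)) ?f")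
proof (rule bijective_open_imp_homeomorphic_map)
  let ?n = "length us"
  have all_u: "(\<forall>u\<in>set us. R (u w) (u y)) \<longleftrightarrow> (\<forall>i<?n. R (?f w ! i) (?f y ! i))" for R w y
    by (auto simp: all_set_conv_all_nth)
  have "openin T {x \<in> topspace T. ?f x \<in> U}" if U: "openin ?E U" for U
  proof (subst openin_subopen, rule ballI)
    fix y assume "y \<in> {x \<in> topspace T. ?f x \<in> U}"
    then have y: "y \<in> topspace T" "?f y \<in> U" by auto
    obtain \<epsilon> where \<epsilon>: "\<epsilon> > 0" "\<And>z. length z = ?n \<Longrightarrow> (\<forall>i<?n. \<bar>z ! i - ?f y ! i\<bar> < \<epsilon>) \<Longrightarrow> z \<in> U"
      using U y(2) unfolding openin_euclid by blast
    have "\<exists>V. openin T V \<and> y \<in> V \<and> (\<forall>u\<in>A. \<forall>w\<in>V. \<bar>u w - u y\<bar> < \<epsilon>)" if "finite A" "A \<subseteq> set us" for A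
      using that
    proof induction
      case (insert u A)
      then obtain V1 V2 where "openin T V1" "y \<in> V1" "\<forall>u\<in>A. \<forall>w\<in>V1. \<bar>u w - u y\<bar> < \<epsilon>"
        "openin T V2" "y \<in> V2" "\<forall>w\<in>V2. \<bar>u w - u y\<bar> < \<epsilon>"
        using cont[of u y \<epsilon>] y(1) \<epsilon>(1) by (metis insert_subset)
      then show ?case by (intro exI[of _ "V1 \<inter> V2"]) auto
    qed (use y in auto)
    then obtain V where V: "openin T V" "y \<in> V" "\<And>u w. u \<in> set us \<Longrightarrow> w \<in> V \<Longrightarrow> \<bar>u w - u y\<bar> < \<epsilon>"
      by (metis finite_set order_refl)
    have "V \<subseteq> {x \<in> topspace T. ?f x \<in> U}"
    proof
      fix w assume w: "w \<in> V"
      have "?f w \<in> U" by (rule \<epsilon>(2)) (use V(3) w in auto)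
      then show "w \<in> {x \<in> topspace T. ?f x \<in> U}" using w openin_subset[OF V(1)] by blast
    qed
    then show "\<exists>V. openin T V \<and> y \<in> V \<and> V \<subseteq> {x \<in> topspace T. ?f x \<in> U}" using V by blast
  qed
  then have "continuous_map T ?E ?f" unfolding continuous_map_def by (auto simp: topspace_euclid)
  then show "continuous_map T (subtopology ?E (?f ` topspace T)) ?f"
    by (auto simp: continuous_map_in_subtopology)
  show "open_map T (subtopology ?E (?f ` topspace T)) ?f"
    unfolding open_map_def
  proof (intro allI impI)
    fix U assume U: "openin T U"
    define O' where "O' = {x. length x = ?n \<and> (\<exists>\<delta>>0. \<forall>y\<in>topspace T. (\<forall>i<?n. \<bar>?f y ! i - x ! i\<bar> < \<delta>) \<longrightarrow> y \<in> U)}"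
    have "openin ?E O'" unfolding O'_def by (rule openin_euclid_robust)
    moreover have "?f ` U = O' \<inter> ?f ` topspace T"
    proof (intro set_eqI iffI)
      fix z assume "z \<in> ?f ` U"
      then obtain y where y: "y \<in> U" "z = ?f y" by blast
      obtain \<eta> where "\<eta> > 0" "\<And>w. w \<in> topspace T \<Longrightarrow> \<forall>u\<in>set us. \<bar>u w - u y\<bar> < \<eta> \<Longrightarrow> w \<in> U"
        using inv[OF U y(1)] by blast
      then have "z \<in> O'" unfolding O'_def y(2) all_u[of "\<lambda>a b. \<bar>a - b\<bar> < \<eta>"] by auto
      then show "z \<in> O' \<inter> ?f ` topspace T" using y openin_subset[OF U] by blast
    next
      fix z assume "z \<in> O' \<inter> ?f ` topspace T"
      then obtain x \<delta> where "x \<in> topspace T" "z = ?f x" "\<delta> > 0"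
        "\<forall>y\<in>topspace T. (\<forall>i<?n. \<bar>?f y ! i - z ! i\<bar> < \<delta>) \<longrightarrow> y \<in> U" unfolding O'_def by blast
      then show "z \<in> ?f ` U" by auto
    qed
    ultimately show "openin (subtopology ?E (?f ` topspace T)) (?f ` U)"
      unfolding openin_subtopology by blast
  qed
  show "?f ` topspace T = topspace (subtopology ?E (?f ` topspace T))" by (auto simp: topspace_euclid)
  show "inj_on ?f (topspace T)"
  proof (rule inj_onI, rule ccontr)
    fix x y assume xy: "x \<in> topspace T" "y \<in> topspace T" "?f x = ?f y" "x \<noteq> y"
    then obtain V where V: "openin T V" "y \<in> V" "x \<notin> V"
      using T unfolding Hausdorff_space_def disjnt_def by blast
    have "\<forall>u\<in>set us. u x = u y" using xy(3) by simp
    then show False using inv[OF V(1,2)] xy(1) V(3) by force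
  qed
qed

context o_minimal_field
begin

lemma rgerm_interval: "u \<le> y \<Longrightarrow> y < v \<Longrightarrow> rgerm {u<..<v} y"
  unfolding rgerm_def by (rule exI[of _ v]) auto

lemma lgerm_interval: "u < y \<Longrightarrow> y \<le> v \<Longrightarrow> lgerm {u<..<v} y"
  unfolding lgerm_def by (rule exI[of _ u]) auto

end

section \<open>Explicit embedding of a space with finitely many exceptional points\<close>

context definable_line_space
begin

text \<open>
  \<open>F\<close> consists of the points of the space without the usual neighbourhoods, its boundary points outside
  it, the limits of the one-sided germs at all these points, and \<open>2\<close>, which makes \<open>F\<close> nonempty. The coordinates of the embedding are the distance \<open>\<phi>\<close> to \<open>F\<close>, the function \<open>\<psi> y = y * \<phi> y\<close>,
  which recovers \<open>y\<close> outside \<open>F\<close>, and for each \<open>x\<close> in \<open>F\<close> a function \<open>bump x\<close> that distinguishes the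
  ends converging to \<open>x\<close> from the other ends.
\<close>

lemma euclidean_case:
  assumes fin: "finite {y \<in> topspace T. \<not> (rlim y y \<and> llim y y)}"
  obtains us where "\<And>u. u \<in> set us \<Longrightarrow> dfun1 M u"
    "homeomorphic_map T (subtopology (euclid (length us)) ((\<lambda>y. map (\<lambda>u. u y) us) ` topspace T))
      (\<lambda>y. map (\<lambda>u. u y) us)"
proof -
  define B where "B = {y. y \<notin> topspace T \<and> (rgerm (topspace T) y \<or> lgerm (topspace T) y)}"
  have "finite B"
  \<comment> \<open>An interval inside \<open>B\<close> would be disjoint from the space, so at its
    points neither germ could lie in the space.\<close>
  proof (rule ccontr)
    assume inf: "infinite B"
    have "dset B" unfolding B_def dset_Collect
      by (intro dfn_rules dfn_dset[OF definable_topspace]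
          dfn_rgerm[of "\<lambda>y e. y \<in> topspace T", simplified] dfn_lgerm[of "\<lambda>y e. y \<in> topspace T", simplified])
    then obtain u v where uv: "u < v" "{u<..<v} \<subseteq> B" by (rule infinite_interval[OF _ inf]) (rule that)
    obtain y where y: "u < y" "y < v" using dense[OF uv(1)] by blast
    have "rgerm {u<..<v} y" "lgerm {u<..<v} y" using y by (simp_all add: rgerm_interval lgerm_interval)
    moreover have "rgerm (topspace T) y \<or> lgerm (topspace T) y" using uv(2) y unfolding B_def by auto
    moreover have "{u<..<v} \<inter> topspace T = {}" using uv(2) unfolding B_def by auto
    ultimately show False
      using rgerm_Int[of "{u<..<v}" y "topspace T"] lgerm_Int[of "{u<..<v}" y "topspace T"] germ_nonempty[of y] by auto
  qed
  define F0 where "F0 = insert 2 ({y \<in> topspace T. \<not> (rlim y y \<and> llim y y)} \<union> B)"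
  have F0: "finite F0" using fin \<open>finite B\<close> unfolding F0_def by simp
  define F where "F = F0 \<union> (\<Union>p\<in>F0. {x. rlim p x}) \<union> (\<Union>p\<in>F0. {x. llim p x})"
  have "finite {x. rlim p x}" "finite {x. llim p x}" for p
  proof -
    have "{x. rlim p x} \<subseteq> {SOME x. rlim p x}" using rlim_unique by (auto intro: someI)
    then show "finite {x. rlim p x}" using finite_subset by blast
    have "{x. llim p x} \<subseteq> {SOME x. llim p x}" using llim_unique by (auto intro: someI)
    then show "finite {x. llim p x}" using finite_subset by blast
  qed
  then have F: "finite F" using F0 unfolding F_def by simp
  have F2: "2 \<in> F" "F0 \<subseteq> F" unfolding F_def F0_def by auto
  \<comment> \<open>The base point of a convergent germ lies in the space or in \<open>B\<close>.
    Outside \<open>F0\<close> it is therefore a point of the space that is the limit of its own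
    germs, and uniqueness leaves no other limit.\<close>
  have r_end: "y \<in> F0 \<or> y = x" if "rlim y x" for y x
    using lim_germ(1)[OF that] rlim_unique[OF that, of y] unfolding F0_def B_def by blast
  have l_end: "y \<in> F0 \<or> y = x" if "llim y x" for y x
    using lim_germ(2)[OF that] llim_unique[OF that, of y] unfolding F0_def B_def by blast
  have r_out: "y = x" if "rlim y x" "x \<notin> F" for y x
    using r_end[OF that(1)] that unfolding F_def by blast
  have l_out: "y = x" if "llim y x" "x \<notin> F" for y x
    using l_end[OF that(1)] that unfolding F_def by blast
  have r_in: "y \<in> F" if "rlim y x" "x \<in> F" for y x
    using r_end[OF that(1)] that F2(2) by blast
  have l_in: "y \<in> F" if "llim y x" "x \<in> F" for y x
    using l_end[OF that(1)] that F2(2) by blast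
  have dF: "dset F" by (rule dset_finite[OF F])
  \<comment> \<open>The punctured basic neighbourhoods of a point x of \<open>F\<close>: all
    one-sided intervals of length \<epsilon> at points of \<open>F\<close> whose germs converge to
    x.\<close>
  define N where "N x \<epsilon> = {w. \<exists>p. p \<in> F \<and> (rlim p x \<and> p < w \<and> w < p + \<epsilon> \<or> llim p x \<and> p - \<epsilon> < w \<and> w < p)}" for x \<epsilon>
  have N_cases: "\<exists>p\<in>F. \<bar>w - p\<bar> < \<epsilon> \<and> (rlim p x \<and> p < w \<or> llim p x \<and> w < p)" if "w \<in> N x \<epsilon>" for w x \<epsilon>
  proof -
    obtain p where p: "p \<in> F" "rlim p x \<and> p < w \<and> w < p + \<epsilon> \<or> llim p x \<and> p - \<epsilon> < w \<and> w < p"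
      using \<open>w \<in> N x \<epsilon>\<close> unfolding N_def by blast
    have "\<bar>w - p\<bar> < \<epsilon>" using p(2) by (elim disjE conjE) linarith+
    then show ?thesis using p by blast
  qed

  have open_out: "\<exists>V. openin T V \<and> x \<in> V \<and> (\<forall>w\<in>V. \<bar>w - x\<bar> < \<epsilon>)"
    if x: "x \<in> topspace T" "x \<notin> F" and \<epsilon>: "\<epsilon> > 0" for x \<epsilon>
  proof -
    define Q where "Q = {w. w \<in> topspace T \<and> \<not> \<bar>w - x\<bar> < \<epsilon>}"
    have dQ: "dset Q" unfolding Q_def dset_Collect by (intro dfn_rules dfn_dset[OF definable_topspace])
    have disj: "Q \<inter> {x<..<x + \<epsilon>} = {}" "Q \<inter> {x - \<epsilon><..<x} = {}"
      unfolding Q_def by (auto simp: abs_less_iff algebra_simps)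
    have gx: "rgerm {x<..<x + \<epsilon>} x" "lgerm {x - \<epsilon><..<x} x" using \<epsilon> by (simp_all add: rgerm_interval lgerm_interval)
    obtain V where V: "openin T V" "x \<in> V" "V \<inter> Q \<subseteq> {x}"
    proof (rule avoiding_nbhd[OF x(1) dQ])
      show "\<not> rgerm Q y" if "rlim y x" for y
        using r_out[OF that x(2)] rgerm_Int[OF _ gx(1), of Q] disj(1) germ_nonempty(1)[of x] by auto
      show "\<not> lgerm Q y" if "llim y x" for y
        using l_out[OF that x(2)] lgerm_Int[OF _ gx(2), of Q] disj(2) germ_nonempty(2)[of x] by auto
    qed (auto simp: Q_def intro: that)
    have "x \<notin> Q" using \<epsilon> by (simp add: Q_def)
    then have "\<bar>w - x\<bar> < \<epsilon>" if "w \<in> V" for w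
      using V(3) that openin_subset[OF V(1)] unfolding Q_def by blast
    then show ?thesis using V by blast
  qed
  have out_nbhd: "\<exists>\<epsilon>>0. \<forall>w. \<bar>w - x\<bar> < \<epsilon> \<longrightarrow> w \<in> V" if x: "x \<notin> F" and V: "openin T V" "x \<in> V" for x V
  proof -
    have "x \<in> topspace T" using openin_subset[OF V(1)] V(2) by blast
    then have "rlim x x" "llim x x" using x F2(2) unfolding F0_def by blast+
    then have "rgerm V x" "lgerm V x" using V unfolding rlim_def llim_def by blast+
    then obtain u v where uv: "u < x" "x < v" "{u<..<x} \<subseteq> V" "{x<..<v} \<subseteq> V"
      unfolding rgerm_def lgerm_def by blast
    have "w \<in> V" if "\<bar>w - x\<bar> < min (x - u) (v - x)" for w
    proof -
      have "u < w" "w < v" using that by (auto simp: abs_less_iff)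
      then show ?thesis using uv(3,4) V(2) by (cases w x rule: linorder_cases) auto
    qed
    then show ?thesis using uv(1,2) by (intro exI[of _ "min (x - u) (v - x)"]) auto
  qed
  have open_in: "\<exists>V. openin T V \<and> x \<in> V \<and> V \<subseteq> insert x (N x \<epsilon>)"
    if x: "x \<in> topspace T" "x \<in> F" and \<epsilon>: "\<epsilon> > 0" for x \<epsilon>
  proof -
    define Q where "Q = {w. w \<in> topspace T \<and> w \<notin> N x \<epsilon>}"
    have dQ: "dset Q" unfolding Q_def N_def mem_Collect_eq dset_Collect
      by (intro dfn_rules dfn_dset[OF definable_topspace] dfn_dset[OF dF] dfn_lim)
    obtain V where V: "openin T V" "x \<in> V" "V \<inter> Q \<subseteq> {x}"
    proof (rule avoiding_nbhd[OF x(1) dQ])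
      show "\<not> rgerm Q y" if y: "rlim y x" for y
      proof
        assume g: "rgerm Q y"
        have "rgerm {y<..<y + \<epsilon>} y" using \<epsilon> unfolding rgerm_def by (intro exI[of _ "y + \<epsilon>"]) simp
        then have "rgerm (Q \<inter> {y<..<y + \<epsilon>}) y" using g rgerm_Int by blast
        moreover have "{y<..<y + \<epsilon>} \<subseteq> N x \<epsilon>" using r_in[OF y x(2)] y unfolding N_def by auto
        then have "Q \<inter> {y<..<y + \<epsilon>} = {}" unfolding Q_def by blast
        ultimately show False using germ_nonempty(1)[of y] by simp
      qed
      show "\<not> lgerm Q y" if y: "llim y x" for y
      proof
        assume g: "lgerm Q y"
        have "lgerm {y - \<epsilon><..<y} y" using \<epsilon> unfolding lgerm_def by (intro exI[of _ "y - \<epsilon>"]) simp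
        then have "lgerm (Q \<inter> {y - \<epsilon><..<y}) y" using g lgerm_Int by blast
        moreover have "{y - \<epsilon><..<y} \<subseteq> N x \<epsilon>" using l_in[OF y x(2)] y unfolding N_def by auto
        then have "Q \<inter> {y - \<epsilon><..<y} = {}" unfolding Q_def by blast
        ultimately show False using germ_nonempty(2)[of y] by simp
      qed
    qed (auto simp: Q_def intro: that)
    have "V \<subseteq> insert x (N x \<epsilon>)" using V(3) openin_subset[OF V(1)] unfolding Q_def by blast
    then show ?thesis using V by blast
  qed
  have in_nbhd: "\<exists>\<epsilon>>0. N x \<epsilon> \<subseteq> V" if V: "openin T V" "x \<in> V" for x V
  proof -
    have ex: "\<exists>d>0. \<forall>\<eta>. 0 < \<eta> \<and> \<eta> \<le> d \<longrightarrow>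
        (rlim p x \<longrightarrow> {p<..<p + \<eta>} \<subseteq> V) \<and> (llim p x \<longrightarrow> {p - \<eta><..<p} \<subseteq> V)" if "p \<in> F" for p
    proof -
      have "\<exists>v>p. rlim p x \<longrightarrow> {p<..<v} \<subseteq> V"
        using V gt_ex[of p] unfolding rlim_def rgerm_def by (cases "rlim p x") (auto simp: rlim_def rgerm_def)
      then obtain v where v: "p < v" "rlim p x \<longrightarrow> {p<..<v} \<subseteq> V" by blast
      have "\<exists>u<p. llim p x \<longrightarrow> {u<..<p} \<subseteq> V"
        using V lt_ex[of p] by (cases "llim p x") (auto simp: llim_def lgerm_def)
      then obtain u where u: "u < p" "llim p x \<longrightarrow> {u<..<p} \<subseteq> V" by blast
      have "(rlim p x \<longrightarrow> {p<..<p + \<eta>} \<subseteq> V) \<and> (llim p x \<longrightarrow> {p - \<eta><..<p} \<subseteq> V)"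
        if "0 < \<eta>" "\<eta> \<le> min (v - p) (p - u)" for \<eta>
      proof -
        have "p + \<eta> \<le> v" "u \<le> p - \<eta>" using that(2) by linarith+
        then have "{p<..<p + \<eta>} \<subseteq> {p<..<v}" "{p - \<eta><..<p} \<subseteq> {u<..<p}" by auto
        then show ?thesis using u(2) v(2) by blast
      qed
      then show ?thesis using u(1) v(1) by (intro exI[of _ "min (v - p) (p - u)"]) auto
    qed
    obtain d where d: "d > 0" "\<And>p \<eta>. p \<in> F \<Longrightarrow> 0 < \<eta> \<Longrightarrow> \<eta> \<le> d \<Longrightarrow>
        (rlim p x \<longrightarrow> {p<..<p + \<eta>} \<subseteq> V) \<and> (llim p x \<longrightarrow> {p - \<eta><..<p} \<subseteq> V)"
      by (rule finite_uniform_bound[OF F ex]) (assumption, rule that)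
    have "N x d \<subseteq> V"
    proof
      fix w assume "w \<in> N x d"
      then obtain p where "p \<in> F" "rlim p x \<and> w \<in> {p<..<p + d} \<or> llim p x \<and> w \<in> {p - d<..<p}"
        unfolding N_def by auto
      then show "w \<in> V" using d(2)[OF _ d(1) order_refl, of p] by blast
    qed
    then show ?thesis using d(1) by blast
  qed

  have "\<exists>d>0. \<forall>\<eta>. 0 < \<eta> \<and> \<eta> \<le> d \<longrightarrow> fst z \<noteq> snd z \<longrightarrow> 2 * \<eta> \<le> \<bar>fst z - snd z\<bar>"
    for z :: "'a \<times> 'a"
    by (cases "fst z = snd z")
      (auto intro: exI[of _ 1] exI[of _ "\<bar>fst z - snd z\<bar> / 2"])
  \<comment> \<open>Balls of radius \<delta> about distinct points of \<open>F\<close> are disjoint.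
    An end of length \<delta> thus has a well-defined base point, and by uniqueness of limits the
    sets \<open>N x \<delta>\<close> for distinct x are disjoint.\<close>
  then obtain \<delta> where \<delta>: "\<delta> > 0"
    and \<delta>2: "\<And>z \<eta>. z \<in> F \<times> F \<Longrightarrow> 0 < \<eta> \<Longrightarrow> \<eta> \<le> \<delta> \<Longrightarrow> fst z \<noteq> snd z \<longrightarrow> 2 * \<eta> \<le> \<bar>fst z - snd z\<bar>"
    by (rule finite_uniform_bound[OF finite_cartesian_product[OF F F]]) (rule that)
  have gap: "p = q" if "p \<in> F" "q \<in> F" "\<bar>w - p\<bar> < \<delta>" "\<bar>w - q\<bar> < \<delta>" for p q w
  proof (rule ccontr)
    assume "p \<noteq> q"
    then have "2 * \<delta> \<le> \<bar>p - q\<bar>" using \<delta>2[of "(p, q)" \<delta>] \<delta> that by auto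
    then show False using that by linarith
  qed
  have N_F: "w \<notin> F" if w: "w \<in> N x \<delta>" for x w
  proof
    assume "w \<in> F"
    obtain p where p: "p \<in> F" "\<bar>w - p\<bar> < \<delta>" "p < w \<or> w < p" using N_cases[OF w] by blast
    then have "w = p" using gap[OF \<open>w \<in> F\<close> p(1), of w] \<delta> by simp
    then show False using p(3) by simp
  qed
  have N_disj: "x = x'" if w: "w \<in> N x \<delta>" "w \<in> N x' \<delta>" for x x' w
  proof -
    obtain p where p: "p \<in> F" "\<bar>w - p\<bar> < \<delta>" "rlim p x \<and> p < w \<or> llim p x \<and> w < p"
      using N_cases[OF w(1)] by blast
    obtain q where q: "q \<in> F" "\<bar>w - q\<bar> < \<delta>" "rlim q x' \<and> q < w \<or> llim q x' \<and> w < q"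
      using N_cases[OF w(2)] by blast
    have "p = q" by (rule gap[OF p(1) q(1) p(2) q(2)])
    then show ?thesis using p(3) q(3) rlim_unique llim_unique less_asym by blast
  qed

  define \<phi> where "\<phi> y = Min ((\<lambda>p. \<bar>y - p\<bar>) ` F)" for y
  have \<phi>_le: "\<phi> y \<le> \<bar>y - p\<bar>" if "p \<in> F" for y p unfolding \<phi>_def using F that by simp
  have \<phi>_ex: "\<exists>p\<in>F. \<phi> y = \<bar>y - p\<bar>" for y
  proof -
    have "\<phi> y \<in> (\<lambda>p. \<bar>y - p\<bar>) ` F" unfolding \<phi>_def using F F2(1) by (intro Min_in) auto
    then show ?thesis by blast
  qed
  have \<phi>0: "0 \<le> \<phi> y" for y using \<phi>_ex[of y] by auto
  have \<phi>_pos: "0 < \<phi> y" if "y \<notin> F" for y using \<phi>_ex[of y] that by auto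
  have \<phi>_zero: "\<phi> y = 0" if "y \<in> F" for y using \<phi>_le[OF that, of y] \<phi>0[of y] by simp
  have \<phi>_lip1: "\<phi> w \<le> \<phi> y + \<bar>w - y\<bar>" for w y
  proof -
    obtain p where p: "p \<in> F" "\<phi> y = \<bar>y - p\<bar>" using \<phi>_ex by blast
    show ?thesis using \<phi>_le[OF p(1), of w] p(2) by linarith
  qed
  have \<phi>_lip: "\<bar>\<phi> w - \<phi> y\<bar> \<le> \<bar>w - y\<bar>" for w y
    using \<phi>_lip1[of w y] \<phi>_lip1[of y w] by linarith
  \<comment> \<open>The minimum over the finite set \<open>F\<close> in terms of finite quantifiers,
    which makes the graph of \<phi> definable.\<close>
  have \<phi>_eq: "\<phi> y = v \<longleftrightarrow> (\<exists>p\<in>F. v = \<bar>y - p\<bar>) \<and> (\<forall>p\<in>F. v \<le> \<bar>y - p\<bar>)" for y v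
    using \<phi>_ex[of y] \<phi>_le[of _ y] by (auto intro: antisym)
  have d\<phi>: "dfun1 M \<phi>" unfolding dfun1_def dtm_def \<phi>_eq
    by (intro dfn_rules dfn_finite_ex dfn_finite_all F)
  define \<psi> where "\<psi> y = y * \<phi> y" for y
  have d\<psi>: "dfun1 M \<psi>" unfolding dfun1_def \<psi>_def by (intro dfn_rules dtm_fun1[OF d\<phi>])
  \<comment> \<open>On an end of length \<delta>, \<phi> is the distance to the base point. The
    value therefore falls linearly from \<delta> at the base to 0 at the far edge, where it
    continues as 0.\<close>
  define bump where "bump x y = (if y = x then \<delta> else if y \<in> N x \<delta> then \<delta> - \<phi> y else 0)" for x y
  have dbump: "dfun1 M (bump x)" for x unfolding dfun1_def bump_def N_def mem_Collect_eq
    by (intro dfn_rules dtm_fun1[OF d\<phi>] dfn_dset[OF dF] dfn_lim)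

  \<comment> \<open>The estimate across the far edge of an end, with a inside and b outside and no
    point of \<open>F\<close> between them.\<close>
  have edge: "\<bar>\<delta> - \<phi> a\<bar> \<le> \<bar>b - a\<bar>"
    if a: "a \<in> N x \<delta>" and b: "b \<notin> N x \<delta>" "b \<notin> F" and side: "\<And>p. p \<in> F \<Longrightarrow> a < p \<longleftrightarrow> b < p" for a b x
  proof -
    obtain p where p: "p \<in> F" "\<bar>a - p\<bar> < \<delta>" "rlim p x \<and> p < a \<or> llim p x \<and> a < p"
      using N_cases[OF a] by blast
    obtain q where q: "q \<in> F" "\<phi> a = \<bar>a - q\<bar>" using \<phi>_ex by blast
    have "\<phi> a \<le> \<bar>a - p\<bar>" by (rule \<phi>_le[OF p(1)])
    then have "q = p" using gap[OF q(1) p(1), of a] p(2) q(2) by simp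
    then have \<phi>a: "\<phi> a = \<bar>a - p\<bar>" using q(2) by simp
    from p(3) show ?thesis
    proof
      assume r: "rlim p x \<and> p < a"
      then have "p < b" using side[OF p(1)] b(2) p(1) by (metis linorder_neqE less_asym)
      then have "p + \<delta> \<le> b" using b(1) r p(1) unfolding N_def by auto
      then show ?thesis using r \<phi>a p(2) by linarith
    next
      assume l: "llim p x \<and> a < p"
      then have "b < p" using side[OF p(1)] by blast
      then have "b \<le> p - \<delta>" using b(1) l p(1) unfolding N_def by auto
      then show ?thesis using l \<phi>a p(2) by linarith
    qed
  qed
  \<comment> \<open>As a function on the line \<open>bump x\<close> may jump at points of
    \<open>F\<close>. The condition |w - y| < \<phi> y keeps w and y on the same side of each of
    them.\<close>
  have bump_lip: "\<bar>bump x w - bump x y\<bar> \<le> \<bar>w - y\<bar>" if x: "x \<in> F" and y: "y \<notin> F" and wy: "\<bar>w - y\<bar> < \<phi> y" for x y w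
  proof -
    have w: "w \<notin> F" using \<phi>_le[of w y] wy abs_minus_commute[of w y] by auto
    have side: "y < p \<longleftrightarrow> w < p" if "p \<in> F" for p
    proof -
      have "\<bar>w - y\<bar> < \<bar>y - p\<bar>" using \<phi>_le[OF that, of y] wy by simp
      then show ?thesis by linarith
    qed
    have ne: "w \<noteq> x" "y \<noteq> x" using x y w by auto
    consider "w \<in> N x \<delta>" "y \<in> N x \<delta>" | "w \<in> N x \<delta>" "y \<notin> N x \<delta>" | "w \<notin> N x \<delta>" "y \<in> N x \<delta>"
      | "w \<notin> N x \<delta>" "y \<notin> N x \<delta>" by blast
    then show ?thesis
    proof cases
      case 1
      then show ?thesis using ne \<phi>_lip[of w y] unfolding bump_def by simp
    next
      case 2
      have "\<bar>\<delta> - \<phi> w\<bar> \<le> \<bar>y - w\<bar>" by (rule edge[OF 2 y]) (use side in blast)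
      then show ?thesis using 2 ne unfolding bump_def by (simp add: abs_minus_commute)
    next
      case 3
      have "\<bar>\<delta> - \<phi> y\<bar> \<le> \<bar>w - y\<bar>" by (rule edge[OF 3(2,1) w]) (use side in blast)
      then show ?thesis using 3 ne unfolding bump_def by (simp add: abs_minus_commute)
    next
      case 4
      then show ?thesis using ne unfolding bump_def by simp
    qed
  qed

  have mult_topspace: "\<bar>w * z\<bar> \<le> \<bar>z\<bar>" if "w \<in> topspace T" for w z
  proof -
    have "\<bar>w\<bar> * \<bar>z\<bar> \<le> 1 * \<bar>z\<bar>" using topspace_range[OF that] by (intro mult_right_mono) auto
    then show ?thesis by (simp only: abs_mult mult_1)
  qed
  obtain xs where xs: "set xs = F \<inter> topspace T" using F finite_list[of "F \<inter> topspace T"] by auto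
  define us where "us = \<phi> # \<psi> # map bump xs"
  have us: "u \<in> set us \<longleftrightarrow> u = \<phi> \<or> u = \<psi> \<or> (\<exists>x\<in>F \<inter> topspace T. u = bump x)" for u
    unfolding us_def using xs by auto
  have "homeomorphic_map T (subtopology (euclid (length us)) ((\<lambda>y. map (\<lambda>u. u y) us) ` topspace T))
      (\<lambda>y. map (\<lambda>u. u y) us)"
  proof (rule homeomorphic_map_into_euclid[OF _ _ hausdorff])
    fix u y \<epsilon> assume u: "u \<in> set us" and y: "y \<in> topspace T" and \<epsilon>: "\<epsilon> > (0::'a)"
    show "\<exists>V. openin T V \<and> y \<in> V \<and> (\<forall>w\<in>V. \<bar>u w - u y\<bar> < \<epsilon>)"
    proof (cases "y \<in> F")
      case False
      \<comment> \<open>The factor 3 is 1 + 2: the change of \<psi> is at most |w| times that of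
        \<phi> plus |w - y| times \<phi> y. Here |w| is below 1, and \<phi> y is at most 2 because 2
        belongs to \<open>F\<close> and y to the unit interval.\<close>
      define \<rho> where "\<rho> = min (\<phi> y) (\<epsilon> / 3)"
      have "\<rho> > 0" using \<phi>_pos[OF False] \<epsilon> by (simp add: \<rho>_def)
      have \<rho>: "\<rho> \<le> \<phi> y" "3 * \<rho> \<le> \<epsilon>" unfolding \<rho>_def by linarith+
      obtain V where V: "openin T V" "y \<in> V" "\<And>w. w \<in> V \<Longrightarrow> \<bar>w - y\<bar> < \<rho>"
        using open_out[OF y False \<open>\<rho> > 0\<close>] by blast
      have "\<bar>u w - u y\<bar> < \<epsilon>" if w: "w \<in> V" for w
      proof -
        have wy: "\<bar>w - y\<bar> < \<rho>" by (rule V(3)[OF w])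
        have wT: "w \<in> topspace T" using w openin_subset[OF V(1)] by blast
        have "\<bar>\<phi> w - \<phi> y\<bar> < \<epsilon>" using \<phi>_lip[of w y] wy \<rho> \<open>\<rho> > 0\<close> by linarith
        moreover have "\<bar>\<psi> w - \<psi> y\<bar> < \<epsilon>"
        proof -
          have 1: "\<bar>w * (\<phi> w - \<phi> y)\<bar> \<le> \<bar>\<phi> w - \<phi> y\<bar>" by (rule mult_topspace[OF wT])
          have "\<phi> y \<le> 2" using \<phi>_le[OF F2(1), of y] topspace_range[OF y] by simp
          then have 2: "\<bar>(w - y) * \<phi> y\<bar> \<le> \<bar>w - y\<bar> * 2"
            unfolding abs_mult using \<phi>0[of y] by (intro mult_left_mono) auto
          have "\<psi> w - \<psi> y = w * (\<phi> w - \<phi> y) + (w - y) * \<phi> y"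
            unfolding \<psi>_def by (simp add: algebra_simps)
          then have 3: "\<bar>\<psi> w - \<psi> y\<bar> \<le> \<bar>w * (\<phi> w - \<phi> y)\<bar> + \<bar>(w - y) * \<phi> y\<bar>"
            by (simp only: abs_triangle_ineq)
          have "\<bar>\<psi> w - \<psi> y\<bar> \<le> \<bar>\<phi> w - \<phi> y\<bar> + \<bar>w - y\<bar> * 2"
            by (rule order_trans[OF 3 add_mono[OF 1 2]])
          also have "\<dots> \<le> \<bar>w - y\<bar> + \<bar>w - y\<bar> * 2" by (rule add_right_mono[OF \<phi>_lip])
          also have "\<dots> = 3 * \<bar>w - y\<bar>" by simp
          also have "\<dots> < 3 * \<rho>" using wy by simp
          also have "\<dots> \<le> \<epsilon>" by (rule \<rho>(2))
          finally show ?thesis .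
        qed
        moreover have "\<bar>bump x w - bump x y\<bar> < \<epsilon>" if "x \<in> F" for x
          using bump_lip[OF that False, of w] wy \<rho> \<open>\<rho> > 0\<close> by linarith
        ultimately show ?thesis using u unfolding us by blast
      qed
      then show ?thesis using V by blast
    next
      case True
      define \<rho> where "\<rho> = min \<epsilon> \<delta>"
      have "\<rho> > 0" using \<epsilon> \<delta> by (simp add: \<rho>_def)
      have \<rho>: "\<rho> \<le> \<epsilon>" "\<rho> \<le> \<delta>" unfolding \<rho>_def by simp_all
      obtain V where V: "openin T V" "y \<in> V" "V \<subseteq> insert y (N y \<rho>)"
        using open_in[OF y True \<open>\<rho> > 0\<close>] by blast
      have "\<bar>u w - u y\<bar> < \<epsilon>" if w: "w \<in> V" for w
      proof (cases "w = y")
        case False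
        have wT: "w \<in> topspace T" using w openin_subset[OF V(1)] by blast
        have wN: "w \<in> N y \<rho>" using V(3) w False by blast
        then have wN\<delta>: "w \<in> N y \<delta>" using \<rho>(2) unfolding N_def by fastforce
        obtain p where p: "p \<in> F" "\<bar>w - p\<bar> < \<rho>" using N_cases[OF wN] by blast
        have \<phi>w: "\<phi> w < \<epsilon>" "0 \<le> \<phi> w" "\<phi> y = 0"
          using \<phi>_le[OF p(1), of w] p(2) \<rho>(1) \<phi>0 \<phi>_zero[OF True] by auto
        have "\<bar>\<phi> w - \<phi> y\<bar> < \<epsilon>" using \<phi>w by simp
        moreover have "\<bar>\<psi> w - \<psi> y\<bar> < \<epsilon>"
        proof -
          have "w * \<phi> w \<le> 1 * \<phi> w" "0 \<le> w * \<phi> w"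
            using topspace_range[OF wT] \<phi>w(2) by (intro mult_right_mono, auto)
          then show ?thesis using \<phi>w unfolding \<psi>_def by simp
        qed
        moreover have "\<bar>bump x w - bump x y\<bar> < \<epsilon>" if x: "x \<in> F" for x
        proof (cases "x = y")
          case True
          then show ?thesis using wN\<delta> False \<phi>w unfolding bump_def by simp
        next
          case xy: False
          then have "w \<notin> N x \<delta>" using N_disj[OF wN\<delta>] by blast
          moreover have "w \<noteq> x" using N_F[OF wN\<delta>] x by blast
          moreover have "y \<notin> N x \<delta>" using N_F True by blast
          ultimately show ?thesis using xy \<epsilon> unfolding bump_def by simp
        qed
        ultimately show ?thesis using u unfolding us by blast
      qed (use \<epsilon> in simp)
      then show ?thesis using V by blast
    qed
  next
    fix y V assume V: "openin T V" "y \<in> V"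
    have y: "y \<in> topspace T" using V openin_subset by blast
    show "\<exists>\<eta>>0. \<forall>w\<in>topspace T. (\<forall>u\<in>set us. \<bar>u w - u y\<bar> < \<eta>) \<longrightarrow> w \<in> V"
    proof (cases "y \<in> F")
      case False
      obtain \<epsilon> where \<epsilon>: "\<epsilon> > 0" "\<And>w. \<bar>w - y\<bar> < \<epsilon> \<Longrightarrow> w \<in> V" using out_nbhd[OF False V] by blast
      have m: "\<phi> y > 0" by (rule \<phi>_pos[OF False])
      have "w \<in> V" if w: "w \<in> topspace T" "\<bar>\<phi> w - \<phi> y\<bar> < \<epsilon> * \<phi> y / 2" "\<bar>\<psi> w - \<psi> y\<bar> < \<epsilon> * \<phi> y / 2" for w
      proof (rule \<epsilon>(2))
        \<comment> \<open>Recovering y from \<phi> and \<psi>: the two coordinate differences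
          control (w - y) * \<phi> y, and \<phi> y is positive. This explains the bound \<epsilon> *
          \<phi> y / 2.\<close>
        have "(w - y) * \<phi> y = (\<psi> w - \<psi> y) - w * (\<phi> w - \<phi> y)"
          unfolding \<psi>_def by (simp add: algebra_simps)
        then have 1: "\<bar>(w - y) * \<phi> y\<bar> \<le> \<bar>\<psi> w - \<psi> y\<bar> + \<bar>w * (\<phi> w - \<phi> y)\<bar>"
          by (simp only: abs_triangle_ineq4)
        have "\<bar>(w - y) * \<phi> y\<bar> \<le> \<bar>\<psi> w - \<psi> y\<bar> + \<bar>\<phi> w - \<phi> y\<bar>"
          by (rule order_trans[OF 1 add_left_mono[OF mult_topspace[OF w(1)]]])
        also have "\<dots> < \<epsilon> * \<phi> y / 2 + \<epsilon> * \<phi> y / 2" using w(2,3) by (intro add_strict_mono)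
        finally have "\<bar>(w - y) * \<phi> y\<bar> < \<epsilon> * \<phi> y" by simp
        then show "\<bar>w - y\<bar> < \<epsilon>" using m by (simp add: abs_mult)
      qed
      then show ?thesis using \<epsilon>(1) m us by (intro exI[of _ "\<epsilon> * \<phi> y / 2"]) auto
    next
      case True
      obtain \<epsilon> where \<epsilon>: "\<epsilon> > 0" "N y \<epsilon> \<subseteq> V" using in_nbhd[OF V] by blast
      \<comment> \<open>With \<eta> < \<delta> the bump coordinate stays positive, which puts w on
        an end converging to y. The coordinate \<phi> then puts w within \<eta> of a point of
        \<open>F\<close>, necessarily the base of that end.\<close>
      define \<eta> where "\<eta> = min \<epsilon> (\<delta> / 2)"
      have \<eta>: "\<eta> > 0" "\<eta> \<le> \<epsilon>" "\<eta> < \<delta>" using \<epsilon> \<delta> by (auto simp: \<eta>_def min_less_iff_disj)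
      have "w \<in> V" if w: "\<bar>\<phi> w - \<phi> y\<bar> < \<eta>" "\<bar>bump y w - bump y y\<bar> < \<eta>" for w
      proof (cases "w = y")
        case False
        have "bump y y = \<delta>" unfolding bump_def by simp
        then have "bump y w > 0" using w(2) \<eta>(3) by linarith
        then have wN: "w \<in> N y \<delta>" using False unfolding bump_def by (auto split: if_splits)
        then obtain p where p: "p \<in> F" "rlim p y \<and> p < w \<and> w < p + \<delta> \<or> llim p y \<and> p - \<delta> < w \<and> w < p"
          unfolding N_def by blast
        have "\<bar>w - p\<bar> < \<delta>" using p(2) by (auto simp: abs_less_iff)
        moreover obtain q where q: "q \<in> F" "\<phi> w = \<bar>w - q\<bar>" using \<phi>_ex by blast
        moreover have "\<phi> w < \<eta>" using w(1) \<phi>_zero[OF True] \<phi>0[of w] by simp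
        ultimately have "p = q" using gap[OF p(1) q(1), of w] \<eta>(3) by simp
        then have "\<bar>w - p\<bar> < \<epsilon>" using q(2) \<open>\<phi> w < \<eta>\<close> \<eta>(2) by simp
        then have "w < p + \<epsilon>" "p - \<epsilon> < w" by (auto simp: abs_less_iff)
        then have "w \<in> N y \<epsilon>" using p unfolding N_def by blast
        then show ?thesis using \<epsilon>(2) by blast
      qed (use V in simp)
      moreover have "bump y \<in> set us" "\<phi> \<in> set us" using us True y by blast+
      ultimately show ?thesis using \<eta>(1) by blast
    qed
  qed
  moreover have "dfun1 M u" if "u \<in> set us" for u using that d\<phi> d\<psi> dbump unfolding us by blast
  ultimately show ?thesis using that by blast
qed

end

section \<open>The right half-open interval topology\<close>

text \<open>An interval has no greatest element; hence the sets [x, y) with both endpoints in it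
  cover it.\<close>

lemma intervals_above:
  fixes I :: "'a::linordered_field set"
  assumes "I \<in> intervals" "x \<in> I"
  shows "\<exists>y\<in>I. x < y"
proof -
  consider a b where "I = {a<..<b}" | a where "I = {a<..}" | b where "I = {..<b}" | "I = UNIV"
    using assms(1) unfolding intervals_def by blast
  then show ?thesis using assms(2) dense[of x] gt_ex[of x] by cases force+
qed

lemma intervals_convex:
  fixes I :: "'a::linordered_field set"
  assumes "I \<in> intervals" "x \<in> I" "y \<in> I" "x \<le> z" "z \<le> y"
  shows "z \<in> I"
proof -
  consider a b where "I = {a<..<b}" | a where "I = {a<..}" | b where "I = {..<b}" | "I = UNIV"
    using assms(1) unfolding intervals_def by blast
  then show ?thesis using assms(2-) by cases auto
qed

lemma intervals_bounded_subset:
  fixes I :: "'a::linordered_field set"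
  assumes "I \<in> intervals"
  obtains a b where "a < b" "{a<..<b} \<subseteq> I"
proof -
  consider a b where "I = {a<..<b}" "a < b" | a where "I = {a<..}" | b where "I = {..<b}" | "I = UNIV"
    using assms(1) unfolding intervals_def by blast
  then show ?thesis
  proof cases
    case 1
    then show ?thesis using that by simp
  next
    case (2 a)
    have "{a<..<a + 1} \<subseteq> {a<..}" by auto
    then show ?thesis using that[of a "a + 1"] 2 by simp
  next
    case (3 b)
    have "{b - 1<..<b} \<subseteq> {..<b}" by auto
    then show ?thesis using that[of "b - 1" b] 3 by simp
  next
    case 4
    then show ?thesis using that[of 0 1] by auto
  qed
qed

lemma topspace_half_open_interval:
  fixes I :: "'a::linordered_field set"
  assumes "I \<in> intervals"
  shows "topspace (half_open_interval I) = (\<lambda>x. [x]) ` I"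
proof -
  let ?B = "{(\<lambda>z. [z]) ` {x..<y} |x y. x \<in> I \<and> y \<in> I \<and> x < y}"
  have "\<Union> ?B = (\<lambda>x. [x]) ` I"
  proof (intro set_eqI iffI)
    fix z assume "z \<in> \<Union> ?B"
    then obtain x y w where "x \<in> I" "y \<in> I" "z = [w]" "x \<le> w" "w < y" by auto
    moreover from this have "w \<in> I" using intervals_convex[OF assms, of x y w] by simp
    ultimately show "z \<in> (\<lambda>x. [x]) ` I" by blast
  next
    fix z assume "z \<in> (\<lambda>x. [x]) ` I"
    then obtain x where x: "x \<in> I" "z = [x]" by blast
    obtain y where y: "y \<in> I" "x < y" using intervals_above[OF assms x(1)] by blast
    have "z \<in> (\<lambda>z. [z]) ` {x..<y}" using x y by simp
    then show "z \<in> \<Union> ?B" using x y by blast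
  qed
  then show ?thesis unfolding half_open_interval_def topology_generated_by_topspace .
qed

lemma openin_half_open_interval:
  fixes I :: "'a::linordered_field set"
  assumes I: "I \<in> intervals"
  shows "openin (half_open_interval I) U \<longleftrightarrow>
    U \<subseteq> (\<lambda>x. [x]) ` I \<and> (\<forall>x\<in>I. [x] \<in> U \<longrightarrow> (\<exists>y\<in>I. x < y \<and> (\<lambda>z. [z]) ` {x..<y} \<subseteq> U))"
    (is "_ \<longleftrightarrow> _ \<and> ?R U")
proof
  assume U: "openin (half_open_interval I) U"
  have "?R U"
    using openin_topology_generated_by[OF U[unfolded half_open_interval_def]]
  proof induction
    case (Int A B)
    show ?case
    proof (intro ballI impI)
      fix x assume x: "x \<in> I" "[x] \<in> A \<inter> B"
      obtain y z where yz: "y \<in> I" "x < y" "(\<lambda>z. [z]) ` {x..<y} \<subseteq> A" "z \<in> I" "x < z" "(\<lambda>z. [z]) ` {x..<z} \<subseteq> B"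
        using Int.IH x by blast
      have "{x..<min y z} \<subseteq> {x..<y}" "{x..<min y z} \<subseteq> {x..<z}" by auto
      then have "(\<lambda>z. [z]) ` {x..<min y z} \<subseteq> A \<inter> B" using yz(3,6) by blast
      moreover have "min y z \<in> I" "x < min y z" using yz by (auto simp: min_def)
      ultimately show "\<exists>y\<in>I. x < y \<and> (\<lambda>z. [z]) ` {x..<y} \<subseteq> A \<inter> B" by blast
    qed
  next
    case (UN K)
    then show ?case by (meson UnionE Union_upper order_trans)
  next
    case (Basis S)
    then obtain u v where uv: "u \<in> I" "v \<in> I" "S = (\<lambda>z. [z]) ` {u..<v}" by blast
    show ?case
    proof (intro ballI impI)
      fix x assume "x \<in> I" "[x] \<in> S"
      then have "u \<le> x" "x < v" using uv(3) by auto
      then show "\<exists>y\<in>I. x < y \<and> (\<lambda>z. [z]) ` {x..<y} \<subseteq> S" using uv by (intro bexI[of _ v]) auto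
    qed
  qed simp
  then show "U \<subseteq> (\<lambda>x. [x]) ` I \<and> ?R U" using openin_subset[OF U] topspace_half_open_interval[OF I] by auto
next
  assume *: "U \<subseteq> (\<lambda>x. [x]) ` I \<and> ?R U"
  show "openin (half_open_interval I) U"
  proof (subst openin_subopen, rule ballI)
    fix z assume "z \<in> U"
    then obtain x where x: "x \<in> I" "z = [x]" "[x] \<in> U" using * by blast
    then obtain y where y: "y \<in> I" "x < y" "(\<lambda>z. [z]) ` {x..<y} \<subseteq> U" using * by blast
    have "openin (half_open_interval I) ((\<lambda>z. [z]) ` {x..<y})"
      unfolding half_open_interval_def by (rule topology_generated_by_Basis) (use x y in blast)
    moreover have "z \<in> (\<lambda>z. [z]) ` {x..<y}" using x y by simp
    ultimately show "\<exists>V. openin (half_open_interval I) V \<and> z \<in> V \<and> V \<subseteq> U" using y(3) by blast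
  qed
qed

text \<open>The last two hypotheses compare neighbourhoods in both directions. As s may be
  decreasing, the result also covers left half-open neighbourhoods on \<open>J\<close>.\<close>

lemma homeomorphic_map_half_open_interval:
  fixes s :: "'b \<Rightarrow> 'a::linordered_field"
  assumes I: "I \<in> intervals" and J: "J \<subseteq> topspace T" and s: "bij_betw s J I"
    and nb1: "\<And>x y. x \<in> J \<Longrightarrow> s x < y \<Longrightarrow> \<exists>V. openin T V \<and> x \<in> V \<and> (\<forall>w\<in>V \<inter> J. s x \<le> s w \<and> s w < y)"
    and nb2: "\<And>x V. x \<in> J \<Longrightarrow> openin T V \<Longrightarrow> x \<in> V \<Longrightarrow>
      \<exists>y\<in>I. s x < y \<and> (\<forall>w\<in>J. s x \<le> s w \<and> s w < y \<longrightarrow> w \<in> V)"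
  shows "homeomorphic_map (subtopology T J) (half_open_interval I) (\<lambda>x. [s x])"
  unfolding homeomorphic_map_def quotient_map_def
proof (intro conjI allI impI)
  have J': "topspace (subtopology T J) = J" using J by auto
  have sJ: "s ` J = I" and inj: "inj_on s J" using s unfolding bij_betw_def by auto
  show "(\<lambda>x. [s x]) ` topspace (subtopology T J) = topspace (half_open_interval I)"
    unfolding J' topspace_half_open_interval[OF I] by (simp add: sJ[symmetric] image_image)
  show "inj_on (\<lambda>x. [s x]) (topspace (subtopology T J))"
    using inj unfolding J' inj_on_def by simp
  fix U assume "U \<subseteq> topspace (half_open_interval I)"
  then have U: "U \<subseteq> (\<lambda>x. [x]) ` I" unfolding topspace_half_open_interval[OF I] .
  define V where "V = {x \<in> J. [s x] \<in> U}"
  have "openin (subtopology T J) V \<longleftrightarrow> openin (half_open_interval I) U"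
  proof
    assume "openin (subtopology T J) V"
    then obtain O' where O': "openin T O'" "V = O' \<inter> J" unfolding openin_subtopology by blast
    have "\<exists>y\<in>I. a < y \<and> (\<lambda>z. [z]) ` {a..<y} \<subseteq> U" if a: "a \<in> I" "[a] \<in> U" for a
    proof -
      obtain x where x: "x \<in> J" "s x = a" using a(1) sJ by blast
      then have "x \<in> O'" using a(2) O'(2) unfolding V_def by blast
      then obtain y where y: "y \<in> I" "s x < y" "\<And>w. w \<in> J \<Longrightarrow> s x \<le> s w \<Longrightarrow> s w < y \<Longrightarrow> w \<in> O'"
        using nb2[OF x(1) O'(1)] by blast
      have "[z] \<in> U" if z: "a \<le> z" "z < y" for z
      proof -
        have "z \<in> I" by (rule intervals_convex[OF I a(1) y(1) z(1)]) (use z in simp)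
        then obtain w where w: "w \<in> J" "s w = z" using sJ by blast
        then have "w \<in> V" using y(3)[of w] z x(2) O'(2) by auto
        then show ?thesis using w(2) unfolding V_def by simp
      qed
      then show ?thesis using y(1,2) x(2) by (intro bexI[of _ y]) auto
    qed
    then show "openin (half_open_interval I) U" unfolding openin_half_open_interval[OF I] using U by blast
  next
    assume op: "openin (half_open_interval I) U"
    show "openin (subtopology T J) V"
    proof (subst openin_subopen, rule ballI)
      fix x assume "x \<in> V"
      then have x: "x \<in> J" "[s x] \<in> U" unfolding V_def by auto
      then have "s x \<in> I" using sJ by blast
      then obtain y where y: "y \<in> I" "s x < y" "(\<lambda>z. [z]) ` {s x..<y} \<subseteq> U"
        using op x(2) unfolding openin_half_open_interval[OF I] by blast
      obtain O' where O': "openin T O'" "x \<in> O'" "\<forall>w\<in>O' \<inter> J. s x \<le> s w \<and> s w < y"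
        using nb1[OF x(1) y(2)] by blast
      have "O' \<inter> J \<subseteq> V"
      proof
        fix w assume w: "w \<in> O' \<inter> J"
        then have "s w \<in> {s x..<y}" using O'(3) by simp
        then show "w \<in> V" using w y(3) unfolding V_def by blast
      qed
      moreover have "openin (subtopology T J) (O' \<inter> J)" using O'(1) by (rule openin_subtopology_Int)
      ultimately show "\<exists>W. openin (subtopology T J) W \<and> x \<in> W \<and> W \<subseteq> V" using O'(2) x(1) by blast
    qed
  qed
  then show "openin (subtopology T J) {x \<in> topspace (subtopology T J). [s x] \<in> U} \<longleftrightarrow>
      openin (half_open_interval I) U"
    unfolding J' V_def .
qed

lemma homeomorphic_map_discrete_interval:
  assumes J: "J \<subseteq> topspace T" and iso: "\<And>x. x \<in> J \<Longrightarrow> \<exists>V. openin T V \<and> x \<in> V \<and> V \<inter> J \<subseteq> {x}"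
  shows "homeomorphic_map (subtopology T J) (discrete_interval J) (\<lambda>x. [x])"
proof -
  have "openin (subtopology T J) U" if "U \<subseteq> J" for U
  proof (subst openin_subopen, rule ballI)
    fix x assume x: "x \<in> U"
    then obtain V where V: "openin T V" "x \<in> V" "V \<inter> J \<subseteq> {x}" using iso \<open>U \<subseteq> J\<close> by blast
    have "V \<inter> J \<subseteq> U" "x \<in> V \<inter> J" using V x \<open>U \<subseteq> J\<close> by auto
    then show "\<exists>W. openin (subtopology T J) W \<and> x \<in> W \<and> W \<subseteq> U"
      using openin_subtopology_Int[OF V(1)] by blast
  qed
  then have op: "openin (subtopology T J) {x \<in> J. [x] \<in> U}" for U by simp
  have J': "topspace (subtopology T J) = J" using J by auto
  show ?thesis
    unfolding homeomorphic_map_def quotient_map_def J' discrete_interval_def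
    using op by (auto simp: inj_on_def)
qed

section \<open>Transport to the line\<close>

context o_minimal_field
begin

lemma definable_map_list:
  assumes X: "definable M n X" and us: "\<And>u. u \<in> set us \<Longrightarrow> dlfun n u"
  shows "definable M (length us) ((\<lambda>x. map (\<lambda>u. u x) us) ` X)"
    "definable_map M n X (length us) ((\<lambda>x. map (\<lambda>u. u x) us) ` X) (\<lambda>x. map (\<lambda>u. u x) us)"
proof -
  let ?m = "length us" and ?f = "\<lambda>x. map (\<lambda>u. u x) us"
  have u: "dlfun n (us ! i)" if "i < ?m" for i using us that by simp
  show Y: "definable M ?m (?f ` X)"
  proof (rule definableI[where P = "\<lambda>z. \<exists>x. length x = n \<and> (x \<in> X \<and> (\<forall>i\<in>{..<?m}. (us ! i) x = z ! i))"])
    show "dfn M (\<lambda>e. \<exists>x. length x = n \<and> (x \<in> X \<and> (\<forall>i\<in>{..<?m}. (us ! i) x = map e [0..<?m] ! i)))"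
      by (intro dfn_exlist dfn_conj dfn_finite_all finite_lessThan dfn_mem[OF X] dlist_id dfn_eq
          dtm_lfun[OF u] dtm_nth[OF dlist_env]) auto
    fix z
    have "z = ?f x \<longleftrightarrow> length z = ?m \<and> (\<forall>i\<in>{..<?m}. (us ! i) x = z ! i)" for x
      by (auto simp: list_eq_iff_nth_eq)
    then show "z \<in> ?f ` X \<longleftrightarrow> length z = ?m \<and>
        (\<exists>x. length x = n \<and> (x \<in> X \<and> (\<forall>i\<in>{..<?m}. (us ! i) x = z ! i)))"
      using definable_length[OF X] by blast
  qed
  have "definable M (n + ?m) ((\<lambda>x. x @ ?f x) ` X)"
  proof (rule definableI[where P = "\<lambda>z. \<exists>x. length x = n \<and> (x \<in> X \<and> ((\<forall>i\<in>{..<n}. x ! i = z ! i) \<and>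
      (\<forall>i\<in>{..<?m}. (us ! i) x = z ! (n + i))))"])
    show "dfn M (\<lambda>e. \<exists>x. length x = n \<and> (x \<in> X \<and> ((\<forall>i\<in>{..<n}. x ! i = map e [0..<n + ?m] ! i) \<and>
      (\<forall>i\<in>{..<?m}. (us ! i) x = map e [0..<n + ?m] ! (n + i)))))"
      by (intro dfn_exlist dfn_conj dfn_finite_all finite_lessThan dfn_mem[OF X] dlist_id dfn_eq
          dtm_lfun[OF u] dtm_nth[OF dlist_env] dtm_nth[OF dlist_id]) auto
    fix z
    have "z = x @ ?f x \<longleftrightarrow> length z = n + ?m \<and> (\<forall>i\<in>{..<n}. x ! i = z ! i) \<and>
        (\<forall>i\<in>{..<?m}. (us ! i) x = z ! (n + i))" if "length x = n" for x
    proof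
      assume R: "length z = n + ?m \<and> (\<forall>i\<in>{..<n}. x ! i = z ! i) \<and> (\<forall>i\<in>{..<?m}. (us ! i) x = z ! (n + i))"
      show "z = x @ ?f x"
      proof (rule nth_equalityI)
        fix i assume "i < length z"
        then have "i < n \<or> (\<exists>j<?m. i = n + j)" using R by (metis add_less_cancel_left le_Suc_ex not_le)
        then show "z ! i = (x @ ?f x) ! i" using R that by (auto simp: nth_append)
      qed (use R that in simp)
    qed (use that in \<open>auto simp: nth_append\<close>)
    then show "z \<in> (\<lambda>x. x @ ?f x) ` X \<longleftrightarrow> length z = n + ?m \<and> (\<exists>x. length x = n \<and> (x \<in> X \<and>
        ((\<forall>i\<in>{..<n}. x ! i = z ! i) \<and> (\<forall>i\<in>{..<?m}. (us ! i) x = z ! (n + i)))))"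
      using definable_length[OF X] by blast
  qed
  then show "definable_map M n X ?m (?f ` X) ?f" unfolding definable_map_def using X Y by blast
qed

text \<open>The topology is carried to the image of g by pulling back along the inverse of g. Its
  basis is again a definable family with the same parameter set, because g and the original basis
  are definable.\<close>

lemma line_model:
  assumes T: "definable_topological_space M n T" "Hausdorff_space T"
    and g: "dlfun n g" "inj_on g (topspace T)" "\<And>x. x \<in> topspace T \<Longrightarrow> 0 < g x \<and> g x < 1"
  obtains L k P W where "definable_line_space M L k P W" "homeomorphic_map T L g"
proof -
  define X where "X = topspace T"
  have X: "definable M n X" using T(1) unfolding definable_topological_space_def X_def by blast
  obtain \<B> where \<B>: "definable_family M n \<B>" "openin T = arbitrary union_of (\<lambda>U. U \<in> \<B>)"
    using T(1) unfolding definable_topological_space_def by blast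
  then obtain k P W0 where P: "definable M k P" and W0: "definable M (k + n) W0"
    and \<B>_eq: "\<B> = (\<lambda>b. {x. length x = n \<and> b @ x \<in> W0}) ` P"
    unfolding definable_family_def by blast
  define N where "N b = {x. length x = n \<and> b @ x \<in> W0}" for b
  have openT: "openin T U \<longleftrightarrow> (\<exists>Q\<subseteq>P. U = (\<Union>b\<in>Q. N b))" for U
  proof -
    have "openin T U \<longleftrightarrow> (\<exists>\<U>\<subseteq>N ` P. \<Union> \<U> = U)"
      unfolding \<B>(2) union_of_def arbitrary_def \<B>_eq N_def by auto
    also have "\<dots> \<longleftrightarrow> (\<exists>Q\<subseteq>P. U = (\<Union>b\<in>Q. N b))" by (metis subset_image_iff)
    finally show ?thesis .
  qed
  have openN: "openin T (N b)" if "b \<in> P" for b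
    unfolding openT using that by (intro exI[of _ "{b}"]) auto
  have NX: "N b \<subseteq> X" if "b \<in> P" for b using openin_subset[OF openN[OF that]] unfolding X_def .
  have openT': "openin T U \<longleftrightarrow> (\<forall>x\<in>U. \<exists>b\<in>P. x \<in> N b \<and> N b \<subseteq> U)" for U
  proof
    assume "openin T U"
    then show "\<forall>x\<in>U. \<exists>b\<in>P. x \<in> N b \<and> N b \<subseteq> U" unfolding openT by blast
  next
    assume *: "\<forall>x\<in>U. \<exists>b\<in>P. x \<in> N b \<and> N b \<subseteq> U"
    show "openin T U" by (subst openin_subopen, rule ballI) (use * openN in blast)
  qed
  \<comment> \<open>The image under g of each basic set, fibre by fibre. The clause on
    \<open>X\<close> restricts g to the set on which it is injective; basic sets lie inside
    \<open>X\<close>, so nothing is lost.\<close>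
  define W where "W = {b @ [y] |b y. length b = k \<and> (\<exists>x. length x = n \<and> (x \<in> X \<and> b @ x \<in> W0 \<and> g x = y))}"
  have W: "definable M (Suc k) W"
  proof (rule definableI[where P = "\<lambda>z. \<exists>x. length x = n \<and> (x \<in> X \<and> take k z @ x \<in> W0 \<and> g x = z ! k)"])
    have tk: "take k (map e [0..<Suc k]) = map e [0..<k]" for e :: "nat \<Rightarrow> 'a" by (simp add: take_map)
    show "dfn M (\<lambda>e. \<exists>x. length x = n \<and> (x \<in> X \<and> take k (map e [0..<Suc k]) @ x \<in> W0 \<and> g x = map e [0..<Suc k] ! k))"
      unfolding tk
      by (intro dfn_exlist dfn_conj dfn_mem[OF X] dfn_mem[OF W0] dlist_append dlist_id dlist_env dfn_eq
          dtm_lfun[OF g(1)] dtm_nth[OF dlist_env]) simp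
    fix z
    show "z \<in> W \<longleftrightarrow> length z = Suc k \<and> (\<exists>x. length x = n \<and> (x \<in> X \<and> take k z @ x \<in> W0 \<and> g x = z ! k))"
    proof
      assume "z \<in> W"
      then obtain b x where "z = b @ [g x]" "length b = k" "length x = n" "x \<in> X" "b @ x \<in> W0"
        unfolding W_def by blast
      then show "length z = Suc k \<and> (\<exists>x. length x = n \<and> (x \<in> X \<and> take k z @ x \<in> W0 \<and> g x = z ! k))"
        by (auto simp: nth_append)
    next
      assume R: "length z = Suc k \<and> (\<exists>x. length x = n \<and> (x \<in> X \<and> take k z @ x \<in> W0 \<and> g x = z ! k))"
      then obtain b y where "z = b @ [y]" "length b = k" by (metis length_Suc_conv_rev)
      then show "z \<in> W" using R unfolding W_def by (auto simp: nth_append)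
    qed
  qed
  have WN: "{y. b @ [y] \<in> W} = g ` N b" if "b \<in> P" for b
    using NX[OF that] definable_length[OF P that] unfolding W_def N_def by auto
  define L where "L = pullback_topology (g ` X) (inv_into X g) T"
  have inj: "inj_on g X" using g(2) unfolding X_def .
  have pre: "inv_into X g -` U \<inter> g ` X = g ` U" if "U \<subseteq> X" for U
    using inj that by (auto simp: inv_into_f_f subset_iff)
  have openL: "openin L V \<longleftrightarrow> (\<exists>U. openin T U \<and> V = g ` U)" for V
  proof -
    have "inv_into X g -` U \<inter> g ` X = g ` U" if "openin T U" for U
      by (rule pre) (use openin_subset[OF that] in \<open>simp add: X_def\<close>)
    then show ?thesis unfolding L_def openin_pullback_topology
      by (intro ex_cong1 conj_cong refl) simp
  qed
  have topL: "topspace L = g ` X" unfolding L_def topspace_pullback_topology using pre[of X] by (simp add: X_def)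
  have gL: "homeomorphic_map T L g"
  proof (rule bijective_open_imp_homeomorphic_map)
    show "open_map T L g" unfolding open_map_def openL by blast
    show "g ` topspace T = topspace L" "inj_on g (topspace T)" using topL g(2) unfolding X_def by auto
    show "continuous_map T L g" unfolding continuous_map_def
    proof (intro conjI allI impI)
      fix V assume "openin L V"
      then obtain U where U: "openin T U" "V = g ` U" unfolding openL by blast
      have "{x \<in> topspace T. g x \<in> V} = U"
        using openin_subset[OF U(1)] g(2) unfolding U(2) by (auto dest: inj_onD)
      then show "openin T {x \<in> topspace T. g x \<in> V}" using U(1) by simp
    qed (use topL X_def in auto)
  qed
  have "definable_line_space M L k P W"
  proof (unfold_locales)
    show "definable M k P" by (rule P)
    show "definable M (Suc k) W" by (rule W)
    show "openin L {y. b @ [y] \<in> W}" if "b \<in> P" for b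
      unfolding WN[OF that] openL using openN[OF that] by blast
    show "openin L U \<longleftrightarrow> (\<forall>x\<in>U. \<exists>b\<in>P. b @ [x] \<in> W \<and> {y. b @ [y] \<in> W} \<subseteq> U)" for U
    proof
      assume "openin L U"
      then obtain V where V: "openin T V" "U = g ` V" unfolding openL by blast
      show "\<forall>x\<in>U. \<exists>b\<in>P. b @ [x] \<in> W \<and> {y. b @ [y] \<in> W} \<subseteq> U"
      proof
        fix y assume "y \<in> U"
        then obtain x where x: "x \<in> V" "y = g x" using V by blast
        then obtain b where b: "b \<in> P" "x \<in> N b" "N b \<subseteq> V" using V(1) openT' by blast
        have "y \<in> {y. b @ [y] \<in> W}" "{y. b @ [y] \<in> W} \<subseteq> U" unfolding WN[OF b(1)] using b x V(2) by auto
        then show "\<exists>b\<in>P. b @ [y] \<in> W \<and> {y. b @ [y] \<in> W} \<subseteq> U" using b(1) by blast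
      qed
    next
      assume *: "\<forall>x\<in>U. \<exists>b\<in>P. b @ [x] \<in> W \<and> {y. b @ [y] \<in> W} \<subseteq> U"
      have op: "openin L {y. b @ [y] \<in> W}" if "b \<in> P" for b
        unfolding WN[OF that] openL using openN[OF that] by blast
      show "openin L U" by (subst openin_subopen, rule ballI) (use * op in blast)
    qed
    show "Hausdorff_space L"
      using homeomorphic_Hausdorff_space[OF homeomorphic_map_imp_homeomorphic_space[OF gL]] T(2) by blast
    show "dset (topspace L)"
    proof -
      have "dset {y. \<exists>x. length x = n \<and> (x \<in> X \<and> g x = y)}"
        unfolding dset_Collect
        by (intro dfn_exlist dfn_conj dfn_mem[OF X] dlist_id dfn_eq dtm_lfun[OF g(1)] dtm_var)
      moreover have "{y. \<exists>x. length x = n \<and> (x \<in> X \<and> g x = y)} = g ` X"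
        using definable_length[OF X] by blast
      ultimately show ?thesis unfolding topL by simp
    qed
    show "0 < x \<and> x < 1" if "x \<in> topspace L" for x
      using that g(3) unfolding topL X_def by blast
  qed
  then show ?thesis using that gL by blast
qed

end

context definable_line_space
begin

text \<open>The identity serves the discrete and the right half-open case; the reflection x
  \<mapsto> - x turns left half-open neighbourhoods into right half-open ones.\<close>

lemma sorgenfrey_homeomorphic:
  assumes "sorgenfrey_interval c d False False \<or> sorgenfrey_interval c d True False \<or>
    sorgenfrey_interval c d False True"
  obtains I s where "I \<in> intervals" "dfun1 M s" "s ` {c<..<d} = I"
    "homeomorphic_map (subtopology T {c<..<d}) (discrete_interval I) (\<lambda>x. [s x]) \<or>
     homeomorphic_map (subtopology T {c<..<d}) (half_open_interval I) (\<lambda>x. [s x])"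
proof -
  let ?J = "{c<..<d}"
  have cd: "c < d" and J: "?J \<subseteq> topspace T" using assms unfolding sorgenfrey_interval_def by blast+
  have ints: "{a<..<b} \<in> intervals" if "a < b" for a b :: 'a using that unfolding intervals_def by blast
  have Ji: "?J \<in> intervals" and Ji': "{- d<..<- c} \<in> intervals" using cd by (simp_all add: ints)
  have id: "dfun1 M (\<lambda>x. x)" and um: "dfun1 M uminus" unfolding dfun1_def by (intro dfn_rules)+
  from assms show ?thesis
  proof (elim disjE)
    assume S: "sorgenfrey_interval c d False False"
    have "\<exists>V. openin T V \<and> x \<in> V \<and> V \<inter> ?J \<subseteq> {x}" if x: "x \<in> ?J" for x
    proof -
      have "x < x + 1" "x - 1 < x" by simp_all
      then have "\<exists>V. openin T V \<and> x \<in> V \<and> V \<inter> ?J \<subseteq> {w. w = x \<or> False \<and> x < w \<and> w < x + 1 \<or> False \<and> x - 1 < w \<and> w < x}"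
        using S x unfolding sorgenfrey_interval_def greaterThanLessThan_iff by blast
      then show ?thesis by simp
    qed
    then show ?thesis using that[of ?J "\<lambda>x. x"] Ji id homeomorphic_map_discrete_interval[OF J] by auto
  next
    assume S: "sorgenfrey_interval c d True False"
    have "homeomorphic_map (subtopology T ?J) (half_open_interval ?J) (\<lambda>x. [(\<lambda>x. x) x])"
    proof (rule homeomorphic_map_half_open_interval[OF Ji J])
      show "bij_betw (\<lambda>x. x) ?J ?J" by (simp add: bij_betw_def inj_on_def)
      show "\<exists>V. openin T V \<and> x \<in> V \<and> (\<forall>w\<in>V \<inter> ?J. x \<le> w \<and> w < y)" if x: "x \<in> ?J" "x < y" for x y
      proof -
        have "x - 1 < x" by simp
        then obtain V where V: "openin T V" "x \<in> V" "V \<inter> ?J \<subseteq> {w. w = x \<or> True \<and> x < w \<and> w < y \<or> False \<and> x - 1 < w \<and> w < x}"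
          using S x unfolding sorgenfrey_interval_def greaterThanLessThan_iff by blast
        then have "\<forall>w\<in>V \<inter> ?J. x \<le> w \<and> w < y" using x(2) by fastforce
        then show ?thesis using V by blast
      qed
      show "\<exists>y\<in>?J. x < y \<and> (\<forall>w\<in>?J. x \<le> w \<and> w < y \<longrightarrow> w \<in> V)"
        if x: "x \<in> ?J" and V: "openin T V" "x \<in> V" for x V
      proof -
        have "rgerm V x" using S x V unfolding sorgenfrey_interval_def greaterThanLessThan_iff by blast
        then obtain z where z: "x < z" "{x<..<z} \<subseteq> V" unfolding rgerm_def by blast
        obtain y where y: "x < y" "y < min z d" using dense[of x "min z d"] z x by auto
        have "w \<in> V" if "x \<le> w" "w < y" for w using that z(2) y(2) V(2) by (cases "w = x") auto
        then show ?thesis using y x by (intro bexI[of _ y]) auto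
      qed
    qed
    then show ?thesis using that[of ?J "\<lambda>x. x"] Ji id by auto
  next
    assume S: "sorgenfrey_interval c d False True"
    have img: "uminus ` ?J = {- d<..<- c}"
      by (auto simp: image_iff minus_less_iff less_minus_iff intro: bexI[of _ "- _"])
    have "homeomorphic_map (subtopology T ?J) (half_open_interval {- d<..<- c}) (\<lambda>x. [- x])"
    proof (rule homeomorphic_map_half_open_interval[OF Ji' J])
      show "bij_betw uminus ?J {- d<..<- c}" by (simp add: bij_betw_def inj_on_def img)
      show "\<exists>V. openin T V \<and> x \<in> V \<and> (\<forall>w\<in>V \<inter> ?J. - x \<le> - w \<and> - w < y)" if x: "x \<in> ?J" "- x < y" for x y
      proof -
        have "x < x + 1" "- y < x" using x(2) by (simp_all add: minus_less_iff)
        then obtain V where V: "openin T V" "x \<in> V" "V \<inter> ?J \<subseteq> {w. w = x \<or> False \<and> x < w \<and> w < x + 1 \<or> True \<and> - y < w \<and> w < x}"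
          using S x unfolding sorgenfrey_interval_def greaterThanLessThan_iff by blast
        then have "\<forall>w\<in>V \<inter> ?J. - x \<le> - w \<and> - w < y" using x(2) by (fastforce simp: minus_less_iff)
        then show ?thesis using V by blast
      qed
      show "\<exists>y\<in>{- d<..<- c}. - x < y \<and> (\<forall>w\<in>?J. - x \<le> - w \<and> - w < y \<longrightarrow> w \<in> V)"
        if x: "x \<in> ?J" and V: "openin T V" "x \<in> V" for x V
      proof -
        have "lgerm V x" using S x V unfolding sorgenfrey_interval_def greaterThanLessThan_iff by blast
        then obtain z where z: "z < x" "{z<..<x} \<subseteq> V" unfolding lgerm_def by blast
        obtain y where y: "max z c < y" "y < x" using dense[of "max z c" x] z x by auto
        have "w \<in> V" if "- x \<le> - w" "- w < - y" for w using that z(2) y(1) V(2) by (cases "w = x") auto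
        then show ?thesis using y x by (intro bexI[of _ "- y"]) auto
      qed
    qed
    then show ?thesis using that[of "{- d<..<- c}" uminus] Ji' um img by auto
  qed
qed

end

section \<open>The alternative for spaces of dimension at most one, and its exclusiveness\<close>

context o_minimal_field
begin

theorem dichotomy:
  assumes T: "definable_topological_space M n T" "Hausdorff_space T" "o_dim M n (topspace T) \<le> 1"
  shows "contains_discrete_or_half_open_interval M n T \<or> definably_homeomorphic_to_euclidean M n T"
proof -
  have X: "definable M n (topspace T)" using T(1) unfolding definable_topological_space_def by blast
  obtain g where g: "dlfun n g" "inj_on g (topspace T)" "\<And>x. x \<in> topspace T \<Longrightarrow> 0 < g x \<and> g x < 1"
    using o_dim_le_1_embeddable[OF X T(3)] unfolding embeddable_def by blast
  obtain L k P W where L: "definable_line_space M L k P W" and gL: "homeomorphic_map T L g"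
    by (rule line_model[OF T(1,2) g]) (assumption, rule that)
  interpret L: definable_line_space M L k P W by (rule L)
  have gX: "g ` topspace T = topspace L" by (rule homeomorphic_imp_surjective_map[OF gL])
  have comp: "dlfun n (\<lambda>x. u (g x))" if "dfun1 M u" for u
    unfolding dlfun_def by (intro dtm_fun1[OF that] dtm_lfun[OF g(1)] dlist_id)
  show ?thesis
  proof (cases "finite {y \<in> topspace L. \<not> (L.rlim y y \<and> L.llim y y)}")
    case True
    obtain us where us: "\<And>u. u \<in> set us \<Longrightarrow> dfun1 M u"
      and hom: "homeomorphic_map L (subtopology (euclid (length us)) ((\<lambda>y. map (\<lambda>u. u y) us) ` topspace L))
        (\<lambda>y. map (\<lambda>u. u y) us)"
      by (rule L.euclidean_case[OF True]) (rule that)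
    define vs where "vs = map (\<lambda>u x. u (g x)) us"
    have vs: "dlfun n v" if "v \<in> set vs" for v using that comp us unfolding vs_def by auto
    have f: "(\<lambda>x. map (\<lambda>v. v x) vs) = (\<lambda>y. map (\<lambda>u. u y) us) \<circ> g" unfolding vs_def by auto
    have lv: "length vs = length us" by (simp add: vs_def)
    define Y where "Y = (\<lambda>x. map (\<lambda>v. v x) vs) ` topspace T"
    have Y: "Y = (\<lambda>y. map (\<lambda>u. u y) us) ` topspace L"
      unfolding Y_def f gX[symmetric] by (rule image_comp[symmetric])
    have "homeomorphic_map T (subtopology (euclid (length us)) Y) (\<lambda>x. map (\<lambda>v. v x) vs)"
      unfolding f Y by (rule homeomorphic_map_compose[OF gL hom])
    moreover have "definable M (length us) Y" "definable_map M n (topspace T) (length us) Y (\<lambda>x. map (\<lambda>v. v x) vs)"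
      unfolding Y_def using definable_map_list[of n "topspace T" vs, OF X vs]
      unfolding lv by blast+
    moreover have "topspace (subtopology (euclid (length us)) Y) = Y"
      unfolding Y by (auto simp: topspace_euclid)
    ultimately show ?thesis
      unfolding definably_homeomorphic_to_euclidean_def definably_homeomorphic_def by metis
  next
    case False
    obtain c d where cd: "L.sorgenfrey_interval c d False False \<or> L.sorgenfrey_interval c d True False \<or>
        L.sorgenfrey_interval c d False True"
      by (rule L.non_euclidean_interval[OF False]) (rule that)
    have J: "{c<..<d} \<subseteq> topspace L" using cd unfolding L.sorgenfrey_interval_def by blast
    obtain I s where I: "I \<in> intervals" and s: "dfun1 M s" "s ` {c<..<d} = I"
      and hom: "homeomorphic_map (subtopology L {c<..<d}) (discrete_interval I) (\<lambda>x. [s x]) \<or>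
         homeomorphic_map (subtopology L {c<..<d}) (half_open_interval I) (\<lambda>x. [s x])"
      by (rule L.sorgenfrey_homeomorphic[OF cd]) (rule that)
    define S where "S = {x \<in> topspace T. g x \<in> {c<..<d}}"
    have gS: "g ` S = {c<..<d}"
    proof
      show "{c<..<d} \<subseteq> g ` S"
      proof
        fix y assume y: "y \<in> {c<..<d}"
        then have "y \<in> g ` topspace T" using J gX by blast
        then obtain x where "x \<in> topspace T" "y = g x" by blast
        then show "y \<in> g ` S" using y unfolding S_def by simp
      qed
    qed (auto simp: S_def)
    have topS: "topspace (subtopology T S) = S" unfolding S_def by auto
    have dS: "definable M n S"
    proof (rule definableI[where P = "\<lambda>x. x \<in> topspace T \<and> c < g x \<and> g x < d"])
      show "dfn M (\<lambda>e. map e [0..<n] \<in> topspace T \<and> c < g (map e [0..<n]) \<and> g (map e [0..<n]) < d)"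
        by (intro dfn_rules dfn_mem[OF X] dtm_lfun[OF g(1)] dlist_id)
    qed (use definable_length[OF X] in \<open>auto simp: S_def\<close>)
    have hS: "homeomorphic_map (subtopology T S) (subtopology L {c<..<d}) g"
      by (rule homeomorphic_map_subtopologies_alt[OF gL]) (simp add: S_def)
    have "(\<lambda>x. map (\<lambda>v. v x) [\<lambda>x. s (g x)]) ` S = (\<lambda>x. [x]) ` I"
      unfolding s(2)[symmetric] gS[symmetric] by (auto simp: image_image)
    then have "definable_map M n S 1 ((\<lambda>x. [x]) ` I) (\<lambda>x. [s (g x)])"
      using definable_map_list(2)[OF dS, of "[\<lambda>x. s (g x)]"] comp[OF s(1)] by simp
    then have map: "definable_map M n S 1 (topspace D) (\<lambda>x. [s (g x)])"
      if "D = discrete_interval I \<or> D = half_open_interval I" for D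
      using that topspace_half_open_interval[OF I] by (auto simp: discrete_interval_def)
    have "definably_homeomorphic M n (subtopology T S) 1 D"
      if D: "D = discrete_interval I \<or> D = half_open_interval I"
        "homeomorphic_map (subtopology L {c<..<d}) D (\<lambda>x. [s x])" for D
    proof -
      have "homeomorphic_map (subtopology T S) D (\<lambda>x. [s (g x)])"
        using homeomorphic_map_compose[OF hS D(2)] by (simp add: comp_def)
      then show ?thesis unfolding definably_homeomorphic_def topS using map[OF D(1)] by blast
    qed
    then have "definably_homeomorphic M n (subtopology T S) 1 (discrete_interval I) \<or>
        definably_homeomorphic M n (subtopology T S) 1 (half_open_interval I)" using hom by blast
    moreover have "S \<subseteq> topspace T" unfolding S_def by blast
    ultimately show ?thesis unfolding contains_discrete_or_half_open_interval_def using I by blast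
  qed
qed

text \<open>The coordinates of f after the inverse of h are definable functions on an interval,
  hence continuous at some x0 in it. Points t < x0 near x0 then have images near that of x0,
  although both interval topologies separate x0 from everything on its left.\<close>

theorem exclusion:
  assumes "contains_discrete_or_half_open_interval M n T" "definably_homeomorphic_to_euclidean M n T"
  shows False
proof -
  obtain S I D where S: "S \<subseteq> topspace T" and I: "I \<in> intervals"
    and D: "D = discrete_interval I \<or> D = half_open_interval I"
    and SD: "definably_homeomorphic M n (subtopology T S) 1 D"
    using assms(1) unfolding contains_discrete_or_half_open_interval_def by blast
  have topS: "topspace (subtopology T S) = S" using S by auto
  have topD: "topspace D = (\<lambda>x. [x]) ` I"
    using D topspace_half_open_interval[OF I] by (auto simp: discrete_interval_def)
  \<comment> \<open>The feature shared by the discrete and the right half-open topology, on which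
    the contradiction rests.\<close>
  have sep: "\<exists>V. openin D V \<and> [x] \<in> V \<and> (\<forall>t<x. [t] \<notin> V)" if x: "x \<in> I" for x
    using D
  proof
    assume "D = discrete_interval I"
    then show ?thesis using x by (intro exI[of _ "{[x]}"]) (auto simp: discrete_interval_def)
  next
    assume D: "D = half_open_interval I"
    obtain y where y: "y \<in> I" "x < y" using intervals_above[OF I x] by blast
    have "openin D ((\<lambda>z. [z]) ` {x..<y})"
      unfolding D half_open_interval_def by (rule topology_generated_by_Basis) (use x y in blast)
    then show ?thesis using y by (intro exI[of _ "(\<lambda>z. [z]) ` {x..<y}"]) auto
  qed
  obtain h where h: "definable_map M n S 1 ((\<lambda>x. [x]) ` I) h" "homeomorphic_map (subtopology T S) D h"
    using SD unfolding definably_homeomorphic_def topS topD by blast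
  obtain m Y f where f: "definable_map M n (topspace T) m (topspace (subtopology (euclid m) Y)) f"
    "homeomorphic_map T (subtopology (euclid m) Y) f"
    using assms(2) unfolding definably_homeomorphic_to_euclidean_def definably_homeomorphic_def by blast
  define Gh where "Gh = (\<lambda>x. x @ h x) ` S"
  define Gf where "Gf = (\<lambda>x. x @ f x) ` topspace T"
  have Gh: "definable M (n + 1) Gh" and Gf: "definable M (n + m) Gf"
    using h(1) f(1) unfolding definable_map_def Gh_def Gf_def by blast+
  have Sn: "length x = n" if "x \<in> topspace T" for x
    using f(1) that definable_length unfolding definable_map_def by blast
  have fm: "length (f x) = m" if "x \<in> topspace T" for x
    using f(1) that unfolding definable_map_def by (auto simp: topspace_euclid)
  have hS: "h ` S = (\<lambda>x. [x]) ` I" using homeomorphic_imp_surjective_map[OF h(2)] unfolding topS topD .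
  have h_inj: "inj_on h S" using homeomorphic_imp_injective_map[OF h(2)] unfolding topS .
  \<comment> \<open>Coordinate i of f after the inverse of h, read off the two definable graphs; the
    description takes the value 0 off \<open>I\<close>.\<close>
  define \<kappa> where "\<kappa> i t = the0 (\<lambda>y. \<exists>x. length x = n \<and> (x @ [t] \<in> Gh \<and>
    (\<exists>z. length z = m \<and> (x @ z \<in> Gf \<and> z ! i = y))))" for i t
  have d\<kappa>: "dfun1 M (\<kappa> i)" if "i \<in> {..<m}" for i
    unfolding dfun1_def \<kappa>_def
    by (intro dtm_the0 dfn_exlist dfn_conj dfn_mem[OF Gh] dfn_mem[OF Gf] dlist_append dlist_single dlist_id
        dlist_env dfn_eq dtm_nth[OF dlist_id] dtm_var) (use that in simp)
  have \<kappa>: "\<kappa> i t = f x ! i" if "x \<in> S" "h x = [t]" for i t x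
    unfolding \<kappa>_def
  proof (rule the0_equality)
    have xT: "x \<in> topspace T" using that S by blast
    have "x @ [t] \<in> Gh" "x @ f x \<in> Gf" using that xT unfolding Gh_def Gf_def by (auto intro!: image_eqI[of _ _ x])
    then show "\<exists>x'. length x' = n \<and> (x' @ [t] \<in> Gh \<and> (\<exists>z. length z = m \<and> (x' @ z \<in> Gf \<and> z ! i = f x ! i)))"
      using Sn[OF xT] fm[OF xT] by blast
    fix y assume "\<exists>x'. length x' = n \<and> (x' @ [t] \<in> Gh \<and> (\<exists>z. length z = m \<and> (x' @ z \<in> Gf \<and> z ! i = y)))"
    then obtain x' z where x': "length x' = n" "x' @ [t] \<in> Gh" "length z = m" "x' @ z \<in> Gf" "z ! i = y"
      by blast
    then obtain u v where uv: "u \<in> S" "x' @ [t] = u @ h u" "v \<in> topspace T" "x' @ z = v @ f v"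
      unfolding Gh_def Gf_def by blast
    have "u = x'" "h u = [t]" using uv(1,2) x'(1) Sn[of u] S by (auto simp: append_eq_append_conv)
    then have "x' = x" using inj_onD[OF h_inj, of u x] uv(1) that by simp
    moreover have "v = x'" "f v = z" using uv(3,4) x'(1) Sn[of v] by (auto simp: append_eq_append_conv)
    ultimately show "y = f x ! i" using x'(5) by simp
  qed
  obtain a b where ab: "a < b" "{a<..<b} \<subseteq> I" by (rule intervals_bounded_subset[OF I])
  obtain c d where cd: "a \<le> c" "c < d" "d \<le> b"
    "\<And>x i. i \<in> {..<m} \<Longrightarrow> c < x \<Longrightarrow> x < d \<Longrightarrow> cont_at (\<kappa> i) x"
    by (rule common_continuity_interval[OF finite_lessThan d\<kappa> ab(1)]) (assumption, rule that)
  obtain x0 where x0: "c < x0" "x0 < d" using dense[OF cd(2)] by blast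
  have cdI: "t \<in> I" if "c < t" "t < d" for t using that ab(2) cd by auto
  obtain p where p: "p \<in> S" "h p = [x0]" using hS cdI[OF x0] by (metis image_iff)
  obtain V where V: "openin D V" "[x0] \<in> V" "\<And>t. t < x0 \<Longrightarrow> [t] \<notin> V" using sep[OF cdI[OF x0]] by blast
  have "openin (subtopology T S) {x \<in> topspace (subtopology T S). h x \<in> V}"
    using homeomorphic_imp_continuous_map[OF h(2)] V(1) unfolding continuous_map_def by blast
  then obtain U where U: "openin T U" "{x \<in> S. h x \<in> V} = U \<inter> S" unfolding openin_subtopology topS by blast
  have "openin (subtopology (euclid m) Y) (f ` U)"
    using homeomorphic_imp_open_map[OF f(2)] U(1) unfolding open_map_def by blast
  then obtain O' where O': "openin (euclid m) O'" "f ` U = O' \<inter> Y" unfolding openin_subtopology by blast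
  have "p \<in> {x \<in> S. h x \<in> V}" using p V(2) by simp
  then have "p \<in> U" unfolding U(2) by blast
  then have "f p \<in> O'" using O'(2) by blast
  then obtain \<epsilon> where \<epsilon>: "\<epsilon> > 0" "\<And>z. length z = m \<Longrightarrow> (\<And>i. i < m \<Longrightarrow> \<bar>z ! i - f p ! i\<bar> < \<epsilon>) \<Longrightarrow> z \<in> O'"
    using O'(1) unfolding openin_euclid by blast
  have ex: "\<exists>d>0. \<forall>\<eta>. 0 < \<eta> \<and> \<eta> \<le> d \<longrightarrow> (\<forall>t. \<bar>t - x0\<bar> < \<eta> \<longrightarrow> \<bar>\<kappa> i t - \<kappa> i x0\<bar> < \<epsilon>)"
    if "i \<in> {..<m}" for i
    using cont_atD[OF cd(4)[OF that x0] \<epsilon>(1)] by (meson less_le_trans)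
  obtain \<delta> where \<delta>: "\<delta> > 0"
    "\<And>i \<eta>. i \<in> {..<m} \<Longrightarrow> 0 < \<eta> \<Longrightarrow> \<eta> \<le> \<delta> \<Longrightarrow> \<forall>t. \<bar>t - x0\<bar> < \<eta> \<longrightarrow> \<bar>\<kappa> i t - \<kappa> i x0\<bar> < \<epsilon>"
    by (rule finite_uniform_bound[OF finite_lessThan ex]) (assumption, rule that)
  obtain t where t: "max c (x0 - \<delta>) < t" "t < x0" using dense[of "max c (x0 - \<delta>)" x0] x0(1) \<delta>(1) by auto
  have tI: "t \<in> I" by (rule cdI) (use t x0 in auto)
  then obtain q where q: "q \<in> S" "h q = [t]" using hS by (metis image_iff)
  have qT: "q \<in> topspace T" using q(1) S by blast
  have "f q \<in> O'"
  proof (rule \<epsilon>(2)[OF fm[OF qT]])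
    fix i assume i: "i < m"
    have "\<bar>t - x0\<bar> < \<delta>" using t by (simp add: abs_less_iff)
    then have "\<bar>\<kappa> i t - \<kappa> i x0\<bar> < \<epsilon>" using \<delta>(2)[of i \<delta>] i \<delta>(1) by simp
    then show "\<bar>f q ! i - f p ! i\<bar> < \<epsilon>" using \<kappa>[OF q] \<kappa>[OF p] by simp
  qed
  moreover have "f q \<in> Y" using homeomorphic_imp_surjective_map[OF f(2)] qT by auto
  ultimately have "f q \<in> f ` U" using O'(2) by blast
  then have "q \<in> U"
    using homeomorphic_imp_injective_map[OF f(2)] qT openin_subset[OF U(1)] by (auto dest: inj_onD)
  then have "q \<in> {x \<in> S. h x \<in> V}" unfolding U(2) using q(1) by blast
  then have "[t] \<in> V" using q(2) by simp
  then show False using V(3) t(2) by blast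
qed

end

theorem theorem9p1:
  fixes M :: "('a::{linordered_field, linorder_topology}, 'f, 'r) fo_structure"
    and n :: nat
    and T :: "'a list topology"
  assumes "o_minimal M"
    and "expands_ordered_field M"
    and "definable_topological_space M n T"
    and "Hausdorff_space T"
    and "o_dim M n (topspace T) \<le> 1"
  shows "(contains_discrete_or_half_open_interval M n T \<or> definably_homeomorphic_to_euclidean M n T) \<and>
    \<not> (contains_discrete_or_half_open_interval M n T \<and> definably_homeomorphic_to_euclidean M n T)"
proof -
  interpret o_minimal_field M using assms(1,2) by (rule o_minimal_field.intro)
  show ?thesis using dichotomy[OF assms(3-5)] exclusion by blast
qed

end
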